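(* Let $\mathcal{L}$ be a framed, oriented link with $d$ components, labeled by a vector $\vec\lambda=(\lambda^1,\dots,\lambda^d)$ of Young diagrams, and let $\vec\lambda^{\,\mathrm{T}}=((\lambda^1)^{\mathrm{T}},\dots,(\lambda^d)^{\mathrm{T}})$ be the vector of transposed Young diagrams. Then the colored HOMFLY--PT polynomials satisfy $$\mathcal{P}^{a,q}(\mathcal{L}(\vec\lambda))=(-1)^{c}\,\mathcal{P}^{a,q^{-1}}(\mathcal{L}(\vec\lambda^{\,\mathrm{T}})),$$ where $c$ is the sum of the numbers of nodes in the $\lambda^i$ for $1\le i\le d$.
   Context: Let $\mathbb{C}_{a,q}=\mathbb{C}(q)(a)$ with $a,q$ independent indeterminates; $[s]=\frac{q^s-q^{-s}}{q-q^{-1}}$, $[t]!=[1][2]\cdots[t]$. **Hecke algebras and trace.** $H_K(q)$ is the Iwahori--Hecke algebra over $\mathbb{C}_{a,q}$ with generators $H_1,\dots,H_{K-1}$ and relations $H_i^2=(q-q^{-1})H_i+1$, $H_iH_j=H_jH_i$ for $|i-j|>1$, $H_iH_jH_i=H_jH_iH_j$ for $|i-j|=1$; $H_w$, $w\in S_K$, is the standard basis and $\ell$ the length function. Elements are drawn as diagrams of upward-oriented strands, the product $xy$ being $x$ stacked on top of $y$; $H_i$ is the crossing of strands $i,i+1$ in which the strand from bottom left to top right passes over. Let $p_K\colon\mathbb{C}_{a,q}[B_K]\to H_K(q)$, $b_i\mapsto H_i$, where $b_i$ is the same crossing in the braid group $B_K$. The Jones--Ocneanu trace $\mathrm{tr}$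 on $\bigoplus_KH_K(q)$ (normalized as in the paper) is the linear map with $\mathrm{tr}(1)=1$ on $H_0(q)$, $\mathrm{tr}(xy)=\mathrm{tr}(yx)$, and, for $x\in H_K(q)\subset H_{K+1}(q)$, $\mathrm{tr}_{K+1}(x)=\frac{a-a^{-1}}{q-q^{-1}}\mathrm{tr}_K(x)$ and $\mathrm{tr}_{K+1}(xH_K)=a\,\mathrm{tr}_K(x)$. (Equivalently it is the evaluation of the annular closure in which a circle has value $\frac{a-a^{-1}}{q-q^{-1}}$ and the partial closure of $q-H_1\in H_2(q)$ is $\frac{aq^{-1}-a^{-1}q}{q-q^{-1}}$ times a strand.) **Idempotents.** Put $e^-_K=\frac{q^{K(K-1)/2}}{[K]!}\sum_{w\in S_K}(-q)^{-\ell(w)}H_w$ and $e^+_K=\frac{q^{-K(K-1)/2}}{[K]!}\sum_{w\in S_K}q^{\ell(w)}H_w$. For a Young diagram $\lambda$ with $K$ nodes (English notation), column lengths $\mathrm{col}_i$ and row lengths $\mathrm{row}_i$, put $e_{\mathrm{col}}(\lambda)=e^-_{\mathrm{col}_1}\otimes e^-_{\mathrm{col}_2}\otimes\cdots$ and $e_{\mathrm{row}}(\lambda)=e^+_{\mathrm{row}_1}\otimes e^+_{\mathrm{row}_2}\otimes\cdots$ ($\otimes$ = juxtaposition). Let $T^{\rightarrow}_\lambda$, $T^{\downarrow}_\lambda$ be the tableaux filled with $1,\dots,K$ row by row, resp. column by column, and let $H_{w(\lambda)}$ be the positive permutation braid element in which, for each node $b$, the strand at bottom position $T^{\rightarrow}_\lambda(b)$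 ends at top position $T^{\downarrow}_\lambda(b)$. Then $\tilde e_q(\lambda)=e_{\mathrm{col}}(\lambda)H_{w(\lambda)}e_{\mathrm{row}}(\lambda)H_{w(\lambda)}^{-1}$ satisfies $\tilde e_q(\lambda)^2=a(\lambda)\tilde e_q(\lambda)$ with a non-zero scalar $a(\lambda)\in\mathbb{C}(q)$, and $e_q(\lambda)=a(\lambda)^{-1}\tilde e_q(\lambda)$ is a primitive idempotent. **Colored HOMFLY--PT polynomial.** Let $\mathcal{L}(\vec\lambda)$ be presented as the (blackboard-framed) closure of a braid diagram $b_D^K$ on $K$ strands, each strand carrying the Young diagram labeling its link component. Replace each strand labeled $\lambda^i$ by $K_i$ parallel strands, $K_i$ the number of nodes of $\lambda^i$, to get a braid $\tilde b_D^{K'}$ on $K'$ strands, and let $e_q(\vec\lambda)\in H_{K'}(q)$ be the tensor product, over the $K$ original strands in order, of the idempotents $e_q(\lambda^i)$ placed on the corresponding cables. Then $\mathcal{P}^{a,q}(\mathcal{L}(\vec\lambda))=\mathrm{tr}(p_{K'}(\tilde b_D^{K'})\,e_q(\vec\lambda))\in\mathbb{C}_{a,q}$ (the framing-dependent, unnormalized version); it does not depend on the choices and is an invariant of framed, oriented, labeled links. $\mathcal{P}^{a,q^{-1}}$ denotes the result of substituting $q\mapsto q^{-1}$ in $\mathcal{P}^{a,q}$. *)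

theory Defs
  imports
    "HOL-Library.Poly_Mapping"
    "HOL-Computational_Algebra.Polynomial"
    "HOL-Computational_Algebra.Fraction_Field"
    "HOL-Combinatorics.Permutations"
begin

section \<open>The field \<open>\<complex>(q)(a)\<close>\<close>

type_synonym caq = "complex poly fract poly fract"

definition q_base :: "complex poly fract" where
  "q_base = Fract [:0, 1:] 1"

definition qv :: caq where
  "qv = Fract [:q_base:] 1"

definition av :: caq where
  "av = Fract [:0, 1:] 1"

text \<open>Extension of an injective ring homomorphism from an integral domain into a field to the
  field of fractions.\<close>

definition fract_extend :: "('a::idom \<Rightarrow> 'b::field) \<Rightarrow> 'a fract \<Rightarrow> 'b" where
  "fract_extend h x = (THE y. \<exists>n d. d \<noteq> 0 \<and> x = Fract n d \<and> y = h n / h d)"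

text \<open>The substitution \<open>q \<mapsto> q\<inverse>\<close>, first on \<open>\<complex>(q)\<close> and then on the coefficients of
  elements of \<open>\<complex>(q)(a)\<close>.\<close>

definition subst_q_inverse_base :: "complex poly fract \<Rightarrow> complex poly fract" where
  "subst_q_inverse_base =
     fract_extend (\<lambda>p. poly (map_poly (\<lambda>c. Fract [:c:] 1) p) (inverse q_base))"

definition subst_q_inverse :: "caq \<Rightarrow> caq" where
  "subst_q_inverse = fract_extend (\<lambda>p. Fract (map_poly subst_q_inverse_base p) 1)"

definition qint :: "nat \<Rightarrow> caq" where
  "qint s = (qv ^ s - inverse qv ^ s) / (qv - inverse qv)"

definition qfact :: "nat \<Rightarrow> caq" where
  "qfact t = (\<Prod>s=1..t. qint s)"


section \<open>Iwahori--Hecke algebras by generators and relations\<close>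

text \<open>Lists with concatenation are the free monoid, so \<open>nat list \<Rightarrow>\<^sub>0 caq\<close> with the
  convolution product is the free associative algebra on countably many generators.\<close>

instantiation list :: (type) monoid_add
begin

definition zero_list :: "'a list" where "zero_list = []"

definition plus_list :: "'a list \<Rightarrow> 'a list \<Rightarrow> 'a list" where "plus_list = (@)"

instance by standard (simp_all add: zero_list_def plus_list_def)

end

type_synonym free_hecke = "nat list \<Rightarrow>\<^sub>0 caq"

definition free_gen :: "nat \<Rightarrow> free_hecke" where
  "free_gen i = Poly_Mapping.single [i] 1"

definition free_const :: "caq \<Rightarrow> free_hecke" where
  "free_const c = Poly_Mapping.single [] c"

inductive_set hecke_relators :: "free_hecke set" where
  quadratic:
    "free_gen i * free_gen i - (free_const (qv - inverse qv) * free_gen i + 1) \<in> hecke_relators"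
| far: "Suc i < j \<or> Suc j < i \<Longrightarrow>
    free_gen i * free_gen j - free_gen j * free_gen i \<in> hecke_relators"
| braid: "j = Suc i \<or> i = Suc j \<Longrightarrow>
    free_gen i * free_gen j * free_gen i - free_gen j * free_gen i * free_gen j \<in> hecke_relators"

inductive_set hecke_ideal :: "free_hecke set" where
  zero: "0 \<in> hecke_ideal"
| relator: "r \<in> hecke_relators \<Longrightarrow> u * r * v \<in> hecke_ideal"
| add: "x \<in> hecke_ideal \<Longrightarrow> y \<in> hecke_ideal \<Longrightarrow> x + y \<in> hecke_ideal"

lemma hecke_ideal_mult:
  assumes "x \<in> hecke_ideal"
  shows "u * x * v \<in> hecke_ideal"
  using assms
proof induction
  case zero
  then show ?case by (simp add: hecke_ideal.zero)
next
  case (relator r u' v')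
  then show ?case
    using hecke_ideal.relator[of r "u * u'" "v' * v"] by (simp add: mult.assoc)
next
  case (add x y)
  then show ?case
    using hecke_ideal.add by (simp add: distrib_left distrib_right)
qed

lemma hecke_ideal_mult_left: "x \<in> hecke_ideal \<Longrightarrow> u * x \<in> hecke_ideal"
  using hecke_ideal_mult[of x u 1] by simp

lemma hecke_ideal_mult_right: "x \<in> hecke_ideal \<Longrightarrow> x * v \<in> hecke_ideal"
  using hecke_ideal_mult[of x 1 v] by simp

lemma hecke_ideal_uminus: "x \<in> hecke_ideal \<Longrightarrow> - x \<in> hecke_ideal"
  using hecke_ideal_mult_left[of x "- 1"] by simp

text \<open>Linear extension of a function on words.\<close>

definition lin_ext :: "(nat list \<Rightarrow> caq \<Rightarrow> 'b::ring) \<Rightarrow> free_hecke \<Rightarrow> 'b" where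
  "lin_ext F x = (\<Sum>w\<in>Poly_Mapping.keys x. F w (Poly_Mapping.lookup x w))"

lemma lin_ext_add:
  assumes "\<And>w. F w 0 = 0" "\<And>w c d. F w (c + d) = F w c + F w d"
  shows "lin_ext F (x + y) = lin_ext F x + lin_ext F y"
proof -
  let ?S = "Poly_Mapping.keys x \<union> Poly_Mapping.keys y"
  have *: "lin_ext F z = (\<Sum>w\<in>?S. F w (Poly_Mapping.lookup z w))"
    if "Poly_Mapping.keys z \<subseteq> ?S" for z
    unfolding lin_ext_def
    by (rule sum.mono_neutral_left) (use that assms(1) in \<open>auto simp: in_keys_iff\<close>)
  show ?thesis
    using Poly_Mapping.keys_add[of x y]
    by (simp add: * lookup_add assms(2) sum.distrib)
qed

lemma lin_ext_single:
  assumes "\<And>w. F w 0 = 0"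
  shows "lin_ext F (Poly_Mapping.single w c) = F w c"
  by (simp add: lin_ext_def assms)

lemma free_hecke_induct [case_names single add]:
  fixes x :: free_hecke
  assumes single: "\<And>w c. P (Poly_Mapping.single w c)"
    and add: "\<And>x y. P x \<Longrightarrow> P y \<Longrightarrow> P (x + y)"
  shows "P x"
proof (induction x rule: update_induct)
  case const
  show ?case using single[of "[]" 0] by simp
next
  case (update f a b)
  have "Poly_Mapping.update a b f = f + Poly_Mapping.single a b"
    using update(1)
    by (intro poly_mapping_eqI) (auto simp: lookup_update lookup_add lookup_single in_keys_iff when_def)
  then show ?case using add[OF update(3) single] by simp
qed

lemma lin_ext_mult:
  assumes "\<And>w. F w 0 = 0" "\<And>w c d. F w (c + d) = F w c + F w d"
    and "\<And>v w c d. F (v @ w) (c * d) = F v c * F w d"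
  shows "lin_ext F (x * y) = lin_ext F x * lin_ext F y"
proof (induction x rule: free_hecke_induct)
  case (single v c)
  show ?case
  proof (induction y rule: free_hecke_induct)
    case (single w d)
    then show ?case
      using assms(3) by (simp add: mult_single lin_ext_single assms(1) plus_list_def)
  next
    case (add y z)
    then show ?case
      using lin_ext_add[of F] assms(1,2) by (simp add: distrib_left)
  qed
next
  case (add y z)
  then show ?case
    using lin_ext_add[of F] assms(1,2) by (simp add: distrib_right)
qed

lemma lin_ext_diff:
  assumes "\<And>w. F w 0 = 0" "\<And>w c d. F w (c + d) = F w c + F w d"
  shows "lin_ext F (x - y) = lin_ext F x - lin_ext F y"
proof -
  have "lin_ext F (x - y + y) = lin_ext F (x - y) + lin_ext F y"
    using assms by (rule lin_ext_add)
  then show ?thesis by simp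
qed

text \<open>The union \<open>H\<^sub>\<infinity>\<close> of the tower \<open>H\<^sub>0(q) \<subseteq> H\<^sub>1(q) \<subseteq> H\<^sub>2(q) \<subseteq> \<dots>\<close>, on generators
  \<open>H\<^sub>i\<close> for all natural numbers \<open>i\<close>. Strands and generators are counted from \<open>0\<close>: \<open>hgen i\<close>
  is the crossing of the strands \<open>i\<close> and \<open>i + 1\<close>.\<close>

quotient_type hecke = free_hecke / "\<lambda>x y. x - y \<in> hecke_ideal"
proof (rule equivpI)
  show "reflp (\<lambda>x y. x - y \<in> hecke_ideal)"
    by (rule reflpI) (simp add: hecke_ideal.zero)
  show "symp (\<lambda>x y. x - y \<in> hecke_ideal)"
    by (rule sympI) (metis hecke_ideal_uminus minus_diff_eq)
  show "transp (\<lambda>x y. x - y \<in> hecke_ideal)"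
  proof (rule transpI)
    fix x y z assume "x - y \<in> hecke_ideal" "y - z \<in> hecke_ideal"
    from hecke_ideal.add[OF this] show "x - z \<in> hecke_ideal" by simp
  qed
qed

instantiation hecke :: ring
begin

lift_definition zero_hecke :: hecke is "0" .

lift_definition plus_hecke :: "hecke \<Rightarrow> hecke \<Rightarrow> hecke" is "(+)"
  by (metis add_diff_add hecke_ideal.add)

lift_definition uminus_hecke :: "hecke \<Rightarrow> hecke" is "uminus"
  by (metis hecke_ideal_uminus minus_diff_minus)

lift_definition minus_hecke :: "hecke \<Rightarrow> hecke \<Rightarrow> hecke" is "(-)"
proof -
  fix x x' y y' :: free_hecke
  assume "x - x' \<in> hecke_ideal" "y - y' \<in> hecke_ideal"
  then have "(x - x') + - (y - y') \<in> hecke_ideal"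
    by (intro hecke_ideal.add hecke_ideal_uminus)
  then show "x - y - (x' - y') \<in> hecke_ideal"
    by (simp add: algebra_simps)
qed

lift_definition times_hecke :: "hecke \<Rightarrow> hecke \<Rightarrow> hecke" is "(*)"
proof -
  fix x x' y y' :: free_hecke
  assume "x - x' \<in> hecke_ideal" "y - y' \<in> hecke_ideal"
  then have "(x - x') * y + x' * (y - y') \<in> hecke_ideal"
    by (intro hecke_ideal.add hecke_ideal_mult_left hecke_ideal_mult_right)
  then show "x * y - x' * y' \<in> hecke_ideal"
    by (simp add: algebra_simps)
qed

instance
  by standard (transfer; simp add: algebra_simps hecke_ideal.zero)+

end

text \<open>The character \<open>H\<^sub>i \<mapsto> q\<close>; it shows that the quotient is not trivial.\<close>

definition free_char :: "free_hecke \<Rightarrow> caq" where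
  "free_char = lin_ext (\<lambda>w c. c * qv ^ length w)"

lemma free_char_simps:
  "free_char (x + y) = free_char x + free_char y"
  "free_char (x - y) = free_char x - free_char y"
  "free_char (x * y) = free_char x * free_char y"
  "free_char (free_gen i) = qv"
  "free_char (free_const c) = c"
  "free_char 1 = 1"
  "free_char 0 = 0"
proof -
  show "free_char 1 = 1"
    unfolding free_char_def single_one[symmetric]
    by (subst lin_ext_single) (auto simp: zero_list_def)
qed (simp_all add: free_char_def free_gen_def free_const_def lin_ext_single lin_ext_add
    lin_ext_diff lin_ext_mult algebra_simps power_add lin_ext_def[of _ 0])

lemma qv_nonzero: "qv \<noteq> 0"
  by (simp add: qv_def q_base_def Zero_fract_def eq_fract)

lemma free_char_hecke_ideal: "x \<in> hecke_ideal \<Longrightarrow> free_char x = 0"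
proof (induction rule: hecke_ideal.induct)
  case (relator r u v)
  have "free_char r = 0"
    using relator
  proof (cases rule: hecke_relators.cases)
    case (quadratic i)
    show ?thesis
      unfolding quadratic free_char_simps using qv_nonzero by (simp add: field_simps)
  next
    case (far i j)
    show ?thesis unfolding far(1) free_char_simps by simp
  next
    case (braid j i)
    show ?thesis unfolding braid(1) free_char_simps by simp
  qed
  then show ?case by (simp add: free_char_simps)
qed (simp_all add: free_char_simps)

instantiation hecke :: ring_1
begin

lift_definition one_hecke :: hecke is "1" .

instance
proof
  fix x :: hecke
  show "1 * x = x" "x * 1 = x"
    by (transfer; simp add: hecke_ideal.zero)+
  show "(0 :: hecke) \<noteq> 1"
  proof (transfer, rule notI)
    assume "0 - 1 \<in> hecke_ideal"
    from free_char_hecke_ideal[OF this] show False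
      unfolding free_char_simps by simp
  qed
qed

end

lift_definition hgen :: "nat \<Rightarrow> hecke" is free_gen .

lift_definition hconst :: "caq \<Rightarrow> hecke" is free_const .

definition hscale :: "caq \<Rightarrow> hecke \<Rightarrow> hecke" (infixr \<open>*\<^sub>H\<close> 75) where
  "c *\<^sub>H x = hconst c * x"

text \<open>The inverse of \<open>hgen i\<close>, by the quadratic relation.\<close>

definition hgen_inv :: "nat \<Rightarrow> hecke" where
  "hgen_inv i = hgen i - hconst (qv - inverse qv)"

lemma hgen_inv: "hgen i * hgen_inv i = 1"
proof -
  have "hgen i * hgen i = hconst (qv - inverse qv) * hgen i + 1"
    by transfer (rule hecke_ideal.relator[OF hecke_relators.quadratic, of 1 _ 1, simplified])
  moreover have "hgen i * hconst c = hconst c * hgen i" for c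
    by transfer (simp add: free_gen_def free_const_def mult_single plus_list_def hecke_ideal.zero)
  ultimately show ?thesis
    by (simp add: hgen_inv_def right_diff_distrib)
qed

text \<open>\<open>H\<^sub>K(q)\<close>, as the subalgebra of \<open>H\<^sub>\<infinity>\<close> generated by its \<open>K - 1\<close> generators.\<close>

inductive_set hecke_alg :: "nat \<Rightarrow> hecke set" for K :: nat where
  const: "hconst c \<in> hecke_alg K"
| gen: "Suc i < K \<Longrightarrow> hgen i \<in> hecke_alg K"
| add: "x \<in> hecke_alg K \<Longrightarrow> y \<in> hecke_alg K \<Longrightarrow> x + y \<in> hecke_alg K"
| mult: "x \<in> hecke_alg K \<Longrightarrow> y \<in> hecke_alg K \<Longrightarrow> x * y \<in> hecke_alg K"


section \<open>Juxtaposition\<close>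

text \<open>\<open>hshift m\<close> is the algebra endomorphism \<open>hgen i \<mapsto> hgen (m + i)\<close>, that is, juxtaposition
  with \<open>m\<close> vertical strands on the left.\<close>

definition free_shift :: "nat \<Rightarrow> free_hecke \<Rightarrow> free_hecke" where
  "free_shift m = lin_ext (\<lambda>w c. Poly_Mapping.single (map ((+) m) w) c)"

lemma free_shift_simps:
  "free_shift m (x + y) = free_shift m x + free_shift m y"
  "free_shift m (x - y) = free_shift m x - free_shift m y"
  "free_shift m (x * y) = free_shift m x * free_shift m y"
  "free_shift m (free_gen i) = free_gen (m + i)"
  "free_shift m (free_const c) = free_const c"
  "free_shift m 1 = 1"
  "free_shift m 0 = 0"
proof -
  show "free_shift m 1 = 1"
    unfolding free_shift_def single_one[symmetric]
    by (subst lin_ext_single) (auto simp: zero_list_def)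
  show "free_shift m (x * y) = free_shift m x * free_shift m y"
    unfolding free_shift_def
    by (rule lin_ext_mult) (simp_all add: single_add mult_single plus_list_def)
qed (simp_all add: free_shift_def free_gen_def free_const_def lin_ext_single lin_ext_add
    lin_ext_diff single_add lin_ext_def[of _ 0])

lemma free_shift_hecke_ideal: "x \<in> hecke_ideal \<Longrightarrow> free_shift m x \<in> hecke_ideal"
proof (induction rule: hecke_ideal.induct)
  case (relator r u v)
  then have "free_shift m r \<in> hecke_relators"
  proof (cases rule: hecke_relators.cases)
    case (quadratic i)
    show ?thesis unfolding quadratic free_shift_simps by (rule hecke_relators.quadratic)
  next
    case (far i j)
    show ?thesis unfolding far(1) free_shift_simps
      by (rule hecke_relators.far) (use far(2) in auto)
  next
    case (braid j i)
    show ?thesis unfolding braid(1) free_shift_simps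
      by (rule hecke_relators.braid) (use braid(2) in auto)
  qed
  then show ?case by (simp add: free_shift_simps hecke_ideal.relator)
qed (simp_all add: free_shift_simps hecke_ideal.zero hecke_ideal.add)

lift_definition hshift :: "nat \<Rightarrow> hecke \<Rightarrow> hecke" is free_shift
  by (metis free_shift_hecke_ideal free_shift_simps(2))

text \<open>\<open>x\<^sub>1 \<otimes> x\<^sub>2 \<otimes> \<dots>\<close> for \<open>x\<^sub>i \<in> H\<^bsub>k\<^sub>i\<^esub>(q)\<close>, given as a list of pairs \<open>(k\<^sub>i, x\<^sub>i)\<close>.\<close>

fun juxtapose :: "(nat \<times> hecke) list \<Rightarrow> hecke" where
  "juxtapose [] = 1"
| "juxtapose ((k, x) # xs) = x * hshift k (juxtapose xs)"


section \<open>Braids and permutations\<close>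

text \<open>A braid diagram is a list of letters \<open>(i, s)\<close>, the crossing of strands \<open>i\<close> and \<open>i + 1\<close> that
  is \<open>b\<^sub>i\<close> if \<open>s\<close> holds and \<open>b\<^sub>i\<inverse>\<close> otherwise. The head of the list is the topmost crossing, in
  accordance with stacking as product.\<close>

type_synonym braid = "(nat \<times> bool) list"

definition is_braid :: "nat \<Rightarrow> braid \<Rightarrow> bool" where
  "is_braid n b \<longleftrightarrow> (\<forall>(i, s)\<in>set b. Suc i < n)"

definition braid_inverse :: "braid \<Rightarrow> braid" where
  "braid_inverse b = rev (map (\<lambda>(i, s). (i, \<not> s)) b)"

definition braid_hecke :: "braid \<Rightarrow> hecke" where
  "braid_hecke b = prod_list (map (\<lambda>(i, s). if s then hgen i else hgen_inv i) b)"

text \<open>The strand starting at bottom position \<open>j\<close> ends at top position \<open>word_perm ws j\<close>.\<close>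

fun word_perm :: "nat list \<Rightarrow> nat \<Rightarrow> nat" where
  "word_perm [] = id"
| "word_perm (i # ws) = transpose i (Suc i) \<circ> word_perm ws"

definition braid_perm :: "braid \<Rightarrow> nat \<Rightarrow> nat" where
  "braid_perm b = word_perm (map fst b)"

definition perm_length :: "(nat \<Rightarrow> nat) \<Rightarrow> nat" where
  "perm_length w = (LEAST k. \<exists>ws. length ws = k \<and> word_perm ws = w)"

definition reduced_word :: "(nat \<Rightarrow> nat) \<Rightarrow> nat list" where
  "reduced_word w = (SOME ws. word_perm ws = w \<and> length ws = perm_length w)"

definition perm_braid :: "(nat \<Rightarrow> nat) \<Rightarrow> braid" where
  "perm_braid w = map (\<lambda>i. (i, True)) (reduced_word w)"

definition hbasis :: "(nat \<Rightarrow> nat) \<Rightarrow> hecke" where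
  "hbasis w = braid_hecke (perm_braid w)"


section \<open>The Jones--Ocneanu trace\<close>

text \<open>With generators counted from \<open>0\<close>, the generator of \<open>H\<^bsub>K+1\<^esub>(q)\<close> not in \<open>H\<^sub>K(q)\<close> is
  \<open>hgen (K - 1)\<close>; it exists for \<open>K \<ge> 1\<close>.\<close>

definition is_jones_ocneanu_trace :: "(nat \<Rightarrow> hecke \<Rightarrow> caq) \<Rightarrow> bool" where
  "is_jones_ocneanu_trace t \<longleftrightarrow>
     (\<forall>K. \<forall>x\<in>hecke_alg K. \<forall>y\<in>hecke_alg K. t K (x + y) = t K x + t K y) \<and>
     (\<forall>K c. \<forall>x\<in>hecke_alg K. t K (c *\<^sub>H x) = c * t K x) \<and>
     t 0 1 = 1 \<and>
     (\<forall>K. \<forall>x\<in>hecke_alg K. \<forall>y\<in>hecke_alg K. t K (x * y) = t K (y * x)) \<and>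
     (\<forall>K. \<forall>x\<in>hecke_alg K. t (K + 1) x = (av - inverse av) / (qv - inverse qv) * t K x) \<and>
     (\<forall>K\<ge>1. \<forall>x\<in>hecke_alg K. t (K + 1) (x * hgen (K - 1)) = av * t K x)"

text \<open>The value of \<open>jones_ocneanu_trace K\<close> is determined on \<open>hecke_alg K\<close> and irrelevant elsewhere.\<close>

definition jones_ocneanu_trace :: "nat \<Rightarrow> hecke \<Rightarrow> caq" where
  "jones_ocneanu_trace = (SOME t. is_jones_ocneanu_trace t)"


section \<open>Young diagrams and idempotents\<close>

text \<open>A Young diagram in English notation is the set of its nodes \<open>(i, j)\<close>, with row index \<open>i\<close>
  and column index \<open>j\<close> counted from \<open>0\<close>.\<close>

type_synonym diagram = "(nat \<times> nat) set"

definition young_diagram :: "diagram \<Rightarrow> bool" where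
  "young_diagram D \<longleftrightarrow>
     finite D \<and> (\<forall>i j i' j'. (i, j) \<in> D \<and> i' \<le> i \<and> j' \<le> j \<longrightarrow> (i', j') \<in> D)"

definition diagram_transpose :: "diagram \<Rightarrow> diagram" where
  "diagram_transpose D = {(j, i) | i j. (i, j) \<in> D}"

definition row_len :: "diagram \<Rightarrow> nat \<Rightarrow> nat" where
  "row_len D i = card {j. (i, j) \<in> D}"

definition col_len :: "diagram \<Rightarrow> nat \<Rightarrow> nat" where
  "col_len D j = card {i. (i, j) \<in> D}"

definition e_minus :: "nat \<Rightarrow> hecke" where
  "e_minus K = (qv ^ (K * (K - 1) div 2) / qfact K) *\<^sub>H
     (\<Sum>w | w permutes {..<K}. (- qv) powi (- int (perm_length w)) *\<^sub>H hbasis w)"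

definition e_plus :: "nat \<Rightarrow> hecke" where
  "e_plus K = (qv powi (- int (K * (K - 1) div 2)) / qfact K) *\<^sub>H
     (\<Sum>w | w permutes {..<K}. qv ^ perm_length w *\<^sub>H hbasis w)"

text \<open>Row \<open>0\<close> and column \<open>0\<close> are the longest, so \<open>row_len D 0\<close> is the number of columns and
  \<open>col_len D 0\<close> the number of rows.\<close>

definition e_col :: "diagram \<Rightarrow> hecke" where
  "e_col D = juxtapose (map (\<lambda>j. (col_len D j, e_minus (col_len D j))) [0..<row_len D 0])"

definition e_row :: "diagram \<Rightarrow> hecke" where
  "e_row D = juxtapose (map (\<lambda>i. (row_len D i, e_plus (row_len D i))) [0..<col_len D 0])"

text \<open>The tableaux \<open>T\<^sup>\<rightarrow>\<close> and \<open>T\<^sup>\<down>\<close>, with entries \<open>0, \<dots>, K - 1\<close>.\<close>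

definition row_tableau :: "diagram \<Rightarrow> nat \<times> nat \<Rightarrow> nat" where
  "row_tableau D = (\<lambda>(i, j). (\<Sum>i'<i. row_len D i') + j)"

definition col_tableau :: "diagram \<Rightarrow> nat \<times> nat \<Rightarrow> nat" where
  "col_tableau D = (\<lambda>(i, j). (\<Sum>j'<j. col_len D j') + i)"

definition diagram_perm :: "diagram \<Rightarrow> nat \<Rightarrow> nat" where
  "diagram_perm D m =
     (if m < card D then col_tableau D (inv_into D (row_tableau D) m) else m)"

definition e_tilde :: "diagram \<Rightarrow> hecke" where
  "e_tilde D = e_col D * hbasis (diagram_perm D) * e_row D *
     braid_hecke (braid_inverse (perm_braid (diagram_perm D)))"

definition e_scalar :: "diagram \<Rightarrow> caq" where
  "e_scalar D = (THE c. e_tilde D * e_tilde D = c *\<^sub>H e_tilde D)"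

definition e_idem :: "diagram \<Rightarrow> hecke" where
  "e_idem D = inverse (e_scalar D) *\<^sub>H e_tilde D"


section \<open>Colored HOMFLY--PT polynomials\<close>

text \<open>A framed oriented link is given by a braid diagram, whose closure joins the top and bottom
  position \<open>j\<close> of each strand and has the blackboard framing. The components of the closure are
  the orbits of the permutation of the braid; \<open>component\<close> enumerates them.\<close>

record framed_link =
  strands :: nat
  diagram :: braid
  num_components :: nat
  component :: "nat \<Rightarrow> nat"

definition is_framed_link :: "framed_link \<Rightarrow> bool" where
  "is_framed_link L \<longleftrightarrow>
     is_braid (strands L) (diagram L) \<and>
     component L ` {..<strands L} = {..<num_components L} \<and>
     (\<forall>i<strands L. \<forall>j<strands L.
        component L i = component L j \<longleftrightarrow> (\<exists>k. (braid_perm (diagram L) ^^ k) i = j))"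

text \<open>The crossing in which \<open>m\<close> parallel strands, starting at the bottom positions
  \<open>p, \<dots>, p + m - 1\<close>, pass over the \<open>n\<close> parallel strands to their right. The strands of the left
  cable cross one after the other, beginning (at the bottom) with the rightmost one.\<close>

definition cable_positive :: "nat \<Rightarrow> nat \<Rightarrow> nat \<Rightarrow> braid" where
  "cable_positive p m n = concat (map (\<lambda>k. map (\<lambda>i. (i, True)) (rev [p + k..<p + k + n])) [0..<m])"

text \<open>Here \<open>sz j\<close> is the number of strands replacing the strand at bottom position \<open>j\<close>. The inverse
  of the positive crossing exchanges the roles of bottom and top, hence \<open>n\<close> and \<open>m\<close> are
  interchanged for negative crossings.\<close>

definition cable_crossing :: "(nat \<Rightarrow> nat) \<Rightarrow> nat \<times> bool \<Rightarrow> braid" where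
  "cable_crossing sz = (\<lambda>(i, s).
     let p = (\<Sum>j<i. sz j); m = sz i; n = sz (Suc i)
     in if s then cable_positive p m n else braid_inverse (cable_positive p n m))"

fun cable :: "(nat \<Rightarrow> nat) \<Rightarrow> braid \<Rightarrow> braid" where
  "cable sz [] = []"
| "cable sz (g # b) = cable_crossing (sz \<circ> inv (braid_perm b)) g @ cable sz b"

text \<open>\<open>P\<^bsup>a,q\<^esup>(\<L>(\<lambda>))\<close> for a list \<open>lam\<close> of Young diagrams labeling the components; \<open>D j\<close> is the label
  of the strand at bottom position \<open>j\<close>.\<close>

definition colored_homflypt :: "framed_link \<Rightarrow> diagram list \<Rightarrow> caq" where
  "colored_homflypt L lam =
     (let D = (\<lambda>j. lam ! component L j);
          sz = (\<lambda>j. card (D j))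
      in jones_ocneanu_trace (\<Sum>j<strands L. sz j)
           (braid_hecke (cable sz (diagram L)) *
            juxtapose (map (\<lambda>j. (sz j, e_idem (D j))) [0..<strands L])))"

end

theory Submission
  imports Defs
begin

text \<open>
  Let \<open>\<phi>\<close> be the semilinear automorphism \<open>q \<mapsto> q\<inverse>\<close>, \<open>H\<^sub>i \<mapsto> - H\<^sub>i\<close> and \<open>\<iota>\<close> the linear anti-automorphism
  fixing every \<open>H\<^sub>i\<close>. The trace satisfies \<open>tr\<^sub>K \<circ> \<phi> = (-1)\<^sup>K tr\<^sub>K\<close> up to \<open>q \<mapsto> q\<inverse>\<close>, and \<open>\<phi>\<close> multiplies
  the cabled braid by \<open>-1\<close> to the number of its crossings; together these signs give \<open>(-1)\<close> to the
  number of cycles of the cabled permutation, which is \<open>c\<close>. Writing \<open>m\<close>, \<open>p\<close>, \<open>h\<close> for \<open>e_col\<close>, \<open>e_row\<close>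
  and \<open>H\<^bsub>w(\<lambda>)\<^esub>\<close>, and \<open>k = \<iota> h\<close>, \<open>\<phi>\<close> maps the unnormalized idempotent of the transposed diagram to
  \<open>p k m k\<inverse>\<close>, and \<open>\<iota>\<close> maps this to a conjugate of \<open>m h p h\<inverse>\<close>, so that both have the same scalar.
  Since every \<open>m x p\<close> is a multiple of \<open>m h p\<close>, there is a scalar \<open>b\<close> with \<open>p h\<inverse> m = b p k m\<close> and
  \<open>m k\<inverse> p = b m h p\<close>. Hence replacing products \<open>x y\<close> by \<open>y x\<close> leads from \<open>m h p h\<inverse>\<close> and from
  \<open>p k m k\<inverse>\<close> to the same element \<open>b p k m h\<close>. Such a replacement, made simultaneously on all cables of
  a component, does not change the trace, because elements can be slid along the cables.
\<close>

section \<open>The substitution \<open>q \<mapsto> q\<inverse>\<close>\<close>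

text \<open>The automorphism \<open>hphi\<close> exchanges the two symmetrizers, and transposition
  exchanges rows with columns and inverts \<open>diagram_perm\<close>. But in the image of
  \<open>e_tilde\<close> the two symmetrizers stand in the opposite order. Hence the labels cannot
  be identified as elements of the algebra, only up to moves that the closure does not see. The
  spaces m H p, at most one-dimensional, are what makes the results of such moves on both sides
  proportional with one common factor. The trace enters only through its axioms. Since it is chosen
  among the maps that satisfy them, one such map has to be constructed. Closing strands from the
  left gives a bimodule map over the remaining strands; the price is that coordinates with respect
  to cosets must be well defined, which is achieved by letting the algebra act on sequences of
  coordinates. As for signs, \<open>hphi\<close> negates a generator and its inverse alike. So the
  sign of a cabled braid is a count of crossings modulo 2, which depends on the underlying
  permutation alone.\<close>

lemma fract_extend_Fract:
  fixes h :: "'a::idom \<Rightarrow> 'b::field"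
  assumes mult: "\<And>x y. h (x * y) = h x * h y"
    and inj: "\<And>x. h x = 0 \<longleftrightarrow> x = 0"
    and d: "d \<noteq> 0"
  shows "fract_extend h (Fract n d) = h n / h d"
  unfolding fract_extend_def
proof (rule the_equality)
  show "\<exists>n' d'. d' \<noteq> 0 \<and> Fract n d = Fract n' d' \<and> h n / h d = h n' / h d'"
    using d by blast
next
  fix y assume "\<exists>n' d'. d' \<noteq> 0 \<and> Fract n d = Fract n' d' \<and> y = h n' / h d'"
  then obtain n' d' where *: "d' \<noteq> 0" "Fract n d = Fract n' d'" "y = h n' / h d'"
    by blast
  then have "h n * h d' = h n' * h d"
    using d by (metis eq_fract(1) mult)
  moreover have "h d \<noteq> 0" "h d' \<noteq> 0"
    using d *(1) by (simp_all add: inj)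
  ultimately show "y = h n / h d"
    using *(3) by (simp add: frac_eq_eq)
qed

text \<open>Instantiated twice: for evaluation of polynomials in q at \<open>inverse q_base\<close>,
  and for the coefficientwise substitution on polynomials in a. Injectivity keeps denominators
  nonzero.\<close>

locale inj_hom =
  fixes h :: "'a::idom \<Rightarrow> 'b::field"
  assumes mult: "h (x * y) = h x * h y"
    and add: "h (x + y) = h x + h y"
    and one: "h 1 = 1"
    and inj: "h x = 0 \<longleftrightarrow> x = 0"
begin

lemmas ext = fract_extend_Fract[of h, OF mult inj]

lemma ext_add: "fract_extend h (x + y) = fract_extend h x + fract_extend h y"
  by (cases x; cases y) (simp add: ext mult add inj add_frac_eq algebra_simps)

lemma ext_mult: "fract_extend h (x * y) = fract_extend h x * fract_extend h y"
  by (cases x; cases y) (simp add: ext mult)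

lemma ext_of: "fract_extend h (Fract x 1) = h x"
  by (simp add: ext one)

lemma ext_one: "fract_extend h 1 = 1"
  using ext_of[of 1] by (simp add: One_fract_def one)

lemma ext_eq_0: "fract_extend h x = 0 \<longleftrightarrow> x = 0"
  by (cases x) (simp add: ext inj Zero_fract_def eq_fract)

end

lemma map_poly_add_hom:
  assumes "f 0 = 0" "\<And>x y. f (x + y) = f x + f y"
  shows "map_poly f (p + q) = map_poly f p + map_poly f q"
  using assms by (intro poly_eqI) (simp add: coeff_map_poly)

lemma map_poly_mult_hom:
  fixes f :: "'a::comm_semiring_1 \<Rightarrow> 'b::comm_semiring_1"
  assumes "f 0 = 0" "\<And>x y. f (x + y) = f x + f y" "\<And>x y. f (x * y) = f x * f y"
  shows "map_poly f (p * q) = map_poly f p * map_poly f q"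
proof -
  have "f (sum g A) = (\<Sum>x\<in>A. f (g x))" for g :: "nat \<Rightarrow> 'a" and A
    using assms(1,2) by (induction A rule: infinite_finite_induct) auto
  then show ?thesis
    using assms by (intro poly_eqI) (simp add: coeff_map_poly coeff_mult)
qed

definition cst :: "complex \<Rightarrow> complex poly fract" where
  "cst = (\<lambda>c. Fract [:c:] 1)"

lemma cst_simps: "cst 0 = 0" "cst 1 = 1" "cst (x + y) = cst x + cst y" "cst (x * y) = cst x * cst y"
  "cst x = 0 \<longleftrightarrow> x = 0"
  by (simp_all add: cst_def Zero_fract_def One_fract_def one_pCons eq_fract)

lemma poly_cst_q_base: "poly (map_poly cst p) q_base = Fract p 1"
proof (induction p)
  case (pCons c p)
  have "map_poly cst (pCons c p) = pCons (cst c) (map_poly cst p)"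
    by (rule map_poly_pCons) (simp add: cst_simps)
  then show ?case
    using pCons by (simp add: q_base_def cst_def)
qed (simp add: Zero_fract_def)

lemma q_base_nonzero: "q_base \<noteq> 0"
  by (simp add: q_base_def Zero_fract_def eq_fract)

text \<open>Clearing powers of q turns the value at 1/q into the value at q of the reversed
  polynomial, and a polynomial evaluated at the indeterminate q is itself. So 1/q is as
  transcendental as q; this is the injectivity on which the extension to fractions rests.\<close>

lemma poly_cst_inverse_q_base: "poly (map_poly cst p) (inverse q_base) = 0 \<longleftrightarrow> p = 0"
proof -
  have "reflect_poly (map_poly cst p) = map_poly cst (reflect_poly p)"
    by (intro poly_eqI)
      (simp add: coeff_map_poly cst_simps coeff_reflect_poly degree_map_poly)
  then have "q_base ^ degree p * poly (map_poly cst p) (inverse q_base) = Fract (reflect_poly p) 1"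
    using poly_reflect_poly_nz[OF q_base_nonzero, of "map_poly cst p"]
    by (simp add: poly_cst_q_base degree_map_poly cst_simps)
  then have "poly (map_poly cst p) (inverse q_base) = 0 \<longleftrightarrow> reflect_poly p = 0"
    using q_base_nonzero
    by (metis cst_simps(1) eq_fract(3) Zero_fract_def zero_neq_one mult_eq_0_iff power_not_zero
        mult.right_neutral mult_zero_left eq_fract(1))
  then show ?thesis by simp
qed

interpretation base: inj_hom "\<lambda>p. poly (map_poly cst p) (inverse q_base)"
  by standard (simp_all add: map_poly_add_hom[of cst] map_poly_mult_hom[of cst] cst_simps poly_cst_inverse_q_base map_poly_1')

lemma subst_base_simps:
  "subst_q_inverse_base (x + y) = subst_q_inverse_base x + subst_q_inverse_base y"
  "subst_q_inverse_base (x * y) = subst_q_inverse_base x * subst_q_inverse_base y"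
  "subst_q_inverse_base 1 = 1"
  "subst_q_inverse_base x = 0 \<longleftrightarrow> x = 0"
  "subst_q_inverse_base 0 = 0"
  unfolding subst_q_inverse_base_def cst_def[symmetric]
  by (simp_all only: base.ext_add base.ext_mult base.ext_one base.ext_eq_0)

lemma subst_base_q_base: "subst_q_inverse_base q_base = inverse q_base"
  unfolding subst_q_inverse_base_def cst_def[symmetric]
  using base.ext_of[of "[:0, 1:]"]
  by (simp add: map_poly_pCons cst_simps flip: q_base_def)

lemma map_poly_subst_base_eq_0: "map_poly subst_q_inverse_base p = 0 \<longleftrightarrow> p = 0"
  by (simp add: poly_eq_iff coeff_map_poly subst_base_simps)

interpretation top: inj_hom "\<lambda>p. Fract (map_poly subst_q_inverse_base p) 1"
proof
  fix x y :: "complex poly fract poly"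
  show "Fract (map_poly subst_q_inverse_base (x * y)) 1 =
      Fract (map_poly subst_q_inverse_base x) 1 * Fract (map_poly subst_q_inverse_base y) 1"
    by (simp add: map_poly_mult_hom[of subst_q_inverse_base, OF subst_base_simps(5,1,2)])
  show "Fract (map_poly subst_q_inverse_base (x + y)) 1 =
      Fract (map_poly subst_q_inverse_base x) 1 + Fract (map_poly subst_q_inverse_base y) 1"
    by (simp add: map_poly_add_hom[of subst_q_inverse_base, OF subst_base_simps(5,1)])
  show "Fract (map_poly subst_q_inverse_base 1) 1 = 1"
    by (simp add: map_poly_1' subst_base_simps fract_collapse)
  have "Fract (map_poly subst_q_inverse_base x) 1 = 0 \<longleftrightarrow> map_poly subst_q_inverse_base x = 0"
    by (simp add: Zero_fract_def[where 'a = "complex poly fract poly"] eq_fract)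
  then show "Fract (map_poly subst_q_inverse_base x) 1 = 0 \<longleftrightarrow> x = 0"
    by (simp only: map_poly_subst_base_eq_0)
qed

lemma subst_hom:
  "subst_q_inverse (x + y) = subst_q_inverse x + subst_q_inverse y"
  "subst_q_inverse (x * y) = subst_q_inverse x * subst_q_inverse y"
  "subst_q_inverse 1 = 1"
  "subst_q_inverse x = 0 \<longleftrightarrow> x = 0"
  "subst_q_inverse 0 = 0"
  unfolding subst_q_inverse_def
  by (simp_all add: top.ext_add top.ext_mult top.ext_one top.ext_eq_0)

lemma subst_uminus: "subst_q_inverse (- x) = - subst_q_inverse x"
  using subst_hom(1)[of x "- x"] subst_hom(5) by (simp add: eq_neg_iff_add_eq_0 add.commute)

lemma subst_diff: "subst_q_inverse (x - y) = subst_q_inverse x - subst_q_inverse y"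
  using subst_hom(1)[of x "- y"] by (simp add: subst_uminus)

lemma subst_inverse: "subst_q_inverse (inverse x) = inverse (subst_q_inverse x)"
proof (cases "x = 0")
  case False
  then have "subst_q_inverse x * subst_q_inverse (inverse x) = 1"
    by (simp add: subst_hom(3) flip: subst_hom(2))
  then show ?thesis by (metis inverse_unique)
qed (simp add: subst_hom)

lemma subst_divide: "subst_q_inverse (x / y) = subst_q_inverse x / subst_q_inverse y"
  by (simp add: divide_inverse subst_hom subst_inverse)

lemma subst_power: "subst_q_inverse (x ^ n) = subst_q_inverse x ^ n"
  by (induction n) (simp_all add: subst_hom)

lemma subst_powi: "subst_q_inverse (x powi n) = subst_q_inverse x powi n"
  by (simp add: power_int_def subst_power subst_inverse)

lemma subst_prod: "subst_q_inverse (prod f A) = (\<Prod>x\<in>A. subst_q_inverse (f x))"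
  by (induction A rule: infinite_finite_induct) (simp_all add: subst_hom)

lemma subst_qv: "subst_q_inverse qv = inverse qv"
proof -
  have "subst_q_inverse qv = Fract [:inverse q_base:] 1"
    unfolding subst_q_inverse_def qv_def
    using top.ext_of[of "[:q_base:]"] by (simp add: map_poly_pCons subst_base_simps subst_base_q_base)
  moreover have "\<dots> * qv = 1"
    using q_base_nonzero by (simp add: qv_def One_fract_def one_pCons)
  ultimately show ?thesis
    by (metis inverse_unique mult.commute)
qed

lemma subst_av: "subst_q_inverse av = av"
  unfolding subst_q_inverse_def av_def
  using top.ext_of[of "[:0, 1:]"] by (simp add: map_poly_pCons subst_base_simps)

lemmas subst_simps = subst_hom subst_uminus subst_diff subst_inverse subst_divide subst_power
  subst_powi subst_prod subst_qv subst_av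

lemma qv_power_neq_1: assumes "n > 0" shows "qv ^ n \<noteq> 1"
proof
  assume *: "qv ^ n = 1"
  have "qv ^ n = Fract [:Fract ([:0,1:] ^ n) 1:] 1"
  proof (induction n)
    case 0
    then show ?case by (simp add: One_fract_def one_pCons)
  next
    case (Suc n)
    then show ?case by (simp add: qv_def q_base_def)
  qed
  with * have "Fract [:Fract ([:0,1:] ^ n) 1:] 1 = (Fract 1 1 :: caq)"
    by (simp add: One_fract_def)
  then have "Fract ([:0,1:] ^ n) 1 = (1 :: complex poly fract)"
    by (simp add: eq_fract one_pCons)
  then have "[:0,1:] ^ n = (1 :: complex poly)"
    unfolding One_fract_def by (simp add: eq_fract)
  then have "degree ([:0,1:] ^ n :: complex poly) = 0" by simp
  with assms show False by (simp add: degree_power_eq)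
qed

text \<open>Separates the eigenvalues \<open>qv\<close> and \<open>- inverse qv\<close> of a
  generator: if they coincided, q would be a fourth root of unity.\<close>

lemma qv_sq_plus_1: "qv ^ 2 + 1 \<noteq> 0"
proof
  assume "qv ^ 2 + 1 = 0"
  then have "(qv ^ 2) ^ 2 = 1" by (metis add_eq_0_iff2 power2_minus power_one)
  then show False using qv_power_neq_1[of 4] by simp
qed

section \<open>The Hecke algebra and its (anti-)automorphisms\<close>

lemma free_one: "(1 :: free_hecke) = Poly_Mapping.single [] 1"
  by (simp flip: zero_list_def)

lemma hconst_simps:
  "hconst (c + d) = hconst c + hconst d"
  "hconst (c * d) = hconst c * hconst d"
  "hconst 0 = 0"
  "hconst 1 = 1"
  by (transfer; simp add: free_const_def free_one single_add mult_single plus_list_def hecke_ideal.zero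
       del: single_one)+

lemma hconst_uminus: "hconst (- c) = - hconst c"
  using hconst_simps(1)[of c "- c"] by (simp add: hconst_simps eq_neg_iff_add_eq_0 add.commute)

lemma hconst_diff: "hconst (c - d) = hconst c - hconst d"
  using hconst_simps(1)[of c "- d"] by (simp add: hconst_uminus)

lemma free_const_commute: "free_const c * x = x * free_const c"
proof (induction x rule: free_hecke_induct)
  case (single w d)
  show ?case by (simp add: free_const_def mult_single plus_list_def mult.commute)
qed (simp add: distrib_left distrib_right)

lemma hconst_commute: "x * hconst c = hconst c * x"
  by transfer (simp add: free_const_commute hecke_ideal.zero)

lemma hconst_left_commute: "x * (hconst c * y) = hconst c * (x * y)"
  by (metis hconst_commute mult.assoc)

lemma hgen_square: "hgen i * hgen i = hconst (qv - inverse qv) * hgen i + 1"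
  by transfer (rule hecke_ideal.relator[OF hecke_relators.quadratic, of 1 _ 1, simplified])

lemma hgen_far: "Suc i < j \<or> Suc j < i \<Longrightarrow> hgen i * hgen j = hgen j * hgen i"
  by transfer (use hecke_ideal.relator[OF hecke_relators.far, of _ _ 1 1] in simp)

lemma hgen_braid:
  "hgen i * (hgen (Suc i) * hgen i) = hgen (Suc i) * (hgen i * hgen (Suc i))"
  by (transfer)
    (use hecke_ideal.relator[OF hecke_relators.braid, of "Suc _" _ 1 1] in \<open>simp add: mult.assoc\<close>)

lemma hgen_inv_left: "hgen_inv i * hgen i = 1"
  using hgen_inv[of i] by (simp add: hgen_inv_def algebra_simps hconst_commute)

lemma free_single_eq:
  "Poly_Mapping.single w c = free_const c * prod_list (map free_gen w)"
proof -
  have "prod_list (map free_gen w) = Poly_Mapping.single w 1"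
    by (induction w)
      (simp_all add: free_one free_gen_def mult_single plus_list_def del: single_one)
  then show ?thesis by (simp add: free_const_def mult_single plus_list_def)
qed

lemma hecke_induct [case_names single add]:
  assumes single: "\<And>c w. P (hconst c * prod_list (map hgen w))"
    and add: "\<And>x y. P x \<Longrightarrow> P y \<Longrightarrow> P (x + y)"
  shows "P x"
proof -
  have 1: "abs_hecke (x + y) = abs_hecke x + abs_hecke y" for x y
    by (simp add: plus_hecke.abs_eq)
  have 2: "abs_hecke (x * y) = abs_hecke x * abs_hecke y" for x y
    by (simp add: times_hecke.abs_eq)
  have 3: "abs_hecke (prod_list (map free_gen w)) = prod_list (map hgen w)" for w
    by (induction w) (simp_all add: 2 hgen.abs_eq one_hecke.abs_eq)
  have "P (abs_hecke y)" for y
  proof (induction y rule: free_hecke_induct)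
    case (single w c)
    then show ?case
      using assms(1)[of c w] by (simp add: free_single_eq 2 3 hconst.abs_eq)
  qed (simp add: 1 add)
  moreover obtain y where "x = abs_hecke y" by (induction x rule: hecke.abs_induct) blast
  ultimately show ?thesis by simp
qed

lemma hecke_induct_left [case_names const gen add]:
  assumes const: "\<And>c. P (hconst c)"
    and gen: "\<And>i x. P x \<Longrightarrow> P (hgen i * x)"
    and add: "\<And>x y. P x \<Longrightarrow> P y \<Longrightarrow> P (x + y)"
  shows "P x"
proof (induction x rule: hecke_induct)
  case (single c w)
  show ?case
  proof (induction w)
    case Nil
    then show ?case using const by simp
  next
    case (Cons i w)
    then show ?case using gen[of "hconst c * prod_list (map hgen w)" i]
      by (simp add: hconst_left_commute)
  qed
qed (rule add)

lemma hecke_induct_right [case_names const gen add]: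
  assumes const: "\<And>c. P (hconst c)"
    and gen: "\<And>i x. P x \<Longrightarrow> P (x * hgen i)"
    and add: "\<And>x y. P x \<Longrightarrow> P y \<Longrightarrow> P (x + y)"
  shows "P x"
proof (induction x rule: hecke_induct)
  case (single c w)
  show ?case
  proof (induction w rule: rev_induct)
    case Nil
    then show ?case using const by simp
  next
    case (snoc i w)
    then show ?case using gen[of "hconst c * prod_list (map hgen w)" i]
      by (simp add: mult.assoc)
  qed
qed (rule add)

subsection \<open>Shifts and the trivial character\<close>

lemma hshift_simps:
  "hshift m (x + y) = hshift m x + hshift m y"
  "hshift m (x - y) = hshift m x - hshift m y"
  "hshift m (x * y) = hshift m x * hshift m y"
  "hshift m (hgen i) = hgen (m + i)"
  "hshift m (hconst c) = hconst c"
  "hshift m 1 = 1"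
  "hshift m 0 = 0"
  by (transfer; simp add: free_shift_simps hecke_ideal.zero)+

lemma hshift_hscale: "hshift m (c *\<^sub>H x) = c *\<^sub>H hshift m x"
  by (simp add: hscale_def hshift_simps)

lemma hshift_hshift: "hshift m (hshift n x) = hshift (m + n) x"
  by (induction x rule: hecke_induct_left) (simp_all add: hshift_simps add.assoc)

lemma hshift_0: "hshift 0 x = x"
  by (induction x rule: hecke_induct_left) (simp_all add: hshift_simps)

text \<open>Serves to read off the scalar c from \<open>hconst c\<close>, hence the value of an
  element on zero strands.\<close>

lift_definition hchar :: "hecke \<Rightarrow> caq" is free_char
  by (metis free_char_hecke_ideal free_char_simps(2) eq_iff_diff_eq_0)

lemma hchar_simps:
  "hchar (x + y) = hchar x + hchar y"
  "hchar (x * y) = hchar x * hchar y"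
  "hchar (hconst c) = c"
  "hchar 1 = 1"
  by (transfer; simp add: free_char_simps)+

subsection \<open>The semilinear automorphism\<close>

definition free_phi :: "free_hecke \<Rightarrow> free_hecke" where
  "free_phi = lin_ext (\<lambda>w c. Poly_Mapping.single w ((- 1) ^ length w * subst_q_inverse c))"

lemma free_phi_simps:
  "free_phi (x + y) = free_phi x + free_phi y"
  "free_phi (x - y) = free_phi x - free_phi y"
  "free_phi (x * y) = free_phi x * free_phi y"
  "free_phi (free_gen i) = - free_gen i"
  "free_phi (free_const c) = free_const (subst_q_inverse c)"
  "free_phi 1 = 1"
  "free_phi 0 = 0"
proof -
  show "free_phi 1 = 1"
    unfolding free_phi_def single_one[symmetric]
    by (subst lin_ext_single) (auto simp: zero_list_def subst_simps)
  show "free_phi (x * y) = free_phi x * free_phi y"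
    unfolding free_phi_def
    by (rule lin_ext_mult)
      (simp_all add: single_add mult_single plus_list_def subst_simps power_add algebra_simps)
qed (simp_all add: free_phi_def free_gen_def free_const_def lin_ext_single lin_ext_add
    lin_ext_diff single_add lin_ext_def[of _ 0] subst_simps algebra_simps single_uminus)

lemma free_const_uminus: "free_const (- c) = - free_const c"
  by (simp add: free_const_def single_uminus)

text \<open>In the quadratic relator the sign of q - 1/q cancels the sign of the generator, so the
  relator is fixed. A far relator has even degree and is fixed as well; a braid relator has degree
  three and is negated.\<close>

lemma free_phi_hecke_ideal: "x \<in> hecke_ideal \<Longrightarrow> free_phi x \<in> hecke_ideal"
proof (induction rule: hecke_ideal.induct)
  case (relator r u v)
  then have "free_phi r \<in> hecke_relators \<or> - free_phi r \<in> hecke_relators"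
  proof (cases rule: hecke_relators.cases)
    case (quadratic i)
    have "free_const (inverse qv - qv) = - free_const (qv - inverse qv)"
      by (simp flip: free_const_uminus)
    then show ?thesis unfolding quadratic free_phi_simps subst_simps
      using hecke_relators.quadratic[of i] by simp
  next
    case (far i j)
    then show ?thesis unfolding far(1) free_phi_simps
      using hecke_relators.far[of i j] by simp
  next
    case (braid j i)
    then show ?thesis unfolding braid(1) free_phi_simps
      using hecke_relators.braid[of i j] hecke_relators.braid[of j i] by auto
  qed
  moreover have "u' * r' * v' \<in> hecke_ideal" if "- r' \<in> hecke_relators" for u' r' v' :: free_hecke
    using hecke_ideal.relator[OF that, of "- u'" v'] by simp
  ultimately show ?case using hecke_ideal.relator by (auto simp: free_phi_simps)
qed (simp_all add: free_phi_simps hecke_ideal.zero hecke_ideal.add)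

lift_definition hphi :: "hecke \<Rightarrow> hecke" is free_phi
  by (metis free_phi_hecke_ideal free_phi_simps(2))

lemma hphi_simps:
  "hphi (x + y) = hphi x + hphi y"
  "hphi (x - y) = hphi x - hphi y"
  "hphi (x * y) = hphi x * hphi y"
  "hphi (hgen i) = - hgen i"
  "hphi (hconst c) = hconst (subst_q_inverse c)"
  "hphi 1 = 1"
  "hphi 0 = 0"
  by (transfer; simp add: free_phi_simps hecke_ideal.zero)+

lemma hphi_hscale: "hphi (c *\<^sub>H x) = subst_q_inverse c *\<^sub>H hphi x"
  by (simp add: hscale_def hphi_simps)

lemma hphi_sum: "hphi (sum f A) = (\<Sum>x\<in>A. hphi (f x))"
  by (induction A rule: infinite_finite_induct) (simp_all add: hphi_simps)

text \<open>Both kinds of crossing acquire the same sign, so on a braid \<open>hphi\<close> counts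
  crossings modulo 2 without regard to their type.\<close>

lemma hphi_hgen_inv: "hphi (hgen_inv i) = - hgen_inv i"
  by (simp add: hgen_inv_def hphi_simps subst_simps hconst_diff)

lemma hphi_hshift: "hphi (hshift m x) = hshift m (hphi x)"
proof (induction x rule: hecke_induct_left)
  case (gen i x)
  have "hshift m (- y) = - hshift m y" for y
    using hshift_simps(2)[of m 0 y] by (simp add: hshift_simps)
  with gen show ?case by (simp add: hshift_simps hphi_simps)
qed (simp_all add: hshift_simps hphi_simps)

subsection \<open>The reversal anti-automorphism\<close>

definition free_rev :: "free_hecke \<Rightarrow> free_hecke" where
  "free_rev = lin_ext (\<lambda>w c. Poly_Mapping.single (rev w) c)"

lemma free_rev_single: "free_rev (Poly_Mapping.single w c) = Poly_Mapping.single (rev w) c"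
  by (simp add: free_rev_def lin_ext_single)

lemma free_rev_simps:
  "free_rev (x + y) = free_rev x + free_rev y"
  "free_rev (x - y) = free_rev x - free_rev y"
  "free_rev (free_gen i) = free_gen i"
  "free_rev (free_const c) = free_const c"
  "free_rev 1 = 1"
  "free_rev 0 = 0"
proof -
  show "free_rev 1 = 1"
    unfolding single_one[symmetric] by (simp add: free_rev_single zero_list_def)
qed (simp_all add: free_rev_def free_gen_def free_const_def lin_ext_single lin_ext_add
    lin_ext_diff single_add lin_ext_def[of _ 0])

lemma free_rev_mult: "free_rev (x * y) = free_rev y * free_rev x"
proof (induction x rule: free_hecke_induct)
  case (single v c)
  show ?case
  proof (induction y rule: free_hecke_induct)
    case (single w d)
    then show ?case by (simp add: mult_single free_rev_single plus_list_def mult.commute)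
  qed (simp add: distrib_left distrib_right free_rev_simps)
qed (simp add: distrib_left distrib_right free_rev_simps)

lemma free_rev_hecke_ideal: "x \<in> hecke_ideal \<Longrightarrow> free_rev x \<in> hecke_ideal"
proof (induction rule: hecke_ideal.induct)
  case (relator r u v)
  then have "free_rev r \<in> hecke_relators"
  proof (cases rule: hecke_relators.cases)
    case (quadratic i)
    then show ?thesis
      using hecke_relators.quadratic[of i]
      by (simp add: free_rev_simps free_rev_mult free_const_commute)
  next
    case (far i j)
    then show ?thesis using hecke_relators.far[of j i] by (auto simp: free_rev_simps free_rev_mult)
  next
    case (braid j i)
    then show ?thesis using hecke_relators.braid[of j i]
      by (auto simp: free_rev_simps free_rev_mult mult.assoc)
  qed
  then show ?case by (simp add: free_rev_mult hecke_ideal.relator flip: mult.assoc)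
qed (simp_all add: free_rev_simps hecke_ideal.zero hecke_ideal.add)

lift_definition hrev :: "hecke \<Rightarrow> hecke" is free_rev
  by (metis free_rev_hecke_ideal free_rev_simps(2))

lemma hrev_simps:
  "hrev (x + y) = hrev x + hrev y"
  "hrev (x - y) = hrev x - hrev y"
  "hrev (x * y) = hrev y * hrev x"
  "hrev (hgen i) = hgen i"
  "hrev (hconst c) = hconst c"
  "hrev 1 = 1"
  "hrev 0 = 0"
  by (transfer; simp add: free_rev_simps free_rev_mult hecke_ideal.zero)+

lemma hrev_hscale: "hrev (c *\<^sub>H x) = c *\<^sub>H hrev x"
  by (simp add: hscale_def hrev_simps hconst_commute)

lemma hrev_sum: "hrev (sum f A) = (\<Sum>x\<in>A. hrev (f x))"
  by (induction A rule: infinite_finite_induct) (simp_all add: hrev_simps)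

lemma hrev_hrev: "hrev (hrev x) = x"
  by (induction x rule: hecke_induct_left) (simp_all add: hrev_simps)

lemma hrev_hshift: "hrev (hshift m x) = hshift m (hrev x)"
  by (induction x rule: hecke_induct_left) (simp_all add: hrev_simps hshift_simps)

subsection \<open>The finite-rank subalgebras\<close>

lemma hecke_alg_1: "1 \<in> hecke_alg K"
  using hecke_alg.const[of 1 K] by (simp add: hconst_simps)

lemma hecke_alg_0: "0 \<in> hecke_alg K"
  using hecke_alg.const[of 0 K] by (simp add: hconst_simps)

lemma hecke_alg_hscale: "x \<in> hecke_alg K \<Longrightarrow> c *\<^sub>H x \<in> hecke_alg K"
  by (simp add: hscale_def hecke_alg.intros)

lemma hecke_alg_uminus: "x \<in> hecke_alg K \<Longrightarrow> - x \<in> hecke_alg K"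
  using hecke_alg.mult[OF hecke_alg.const[of "-1" K], of x]
  by (simp add: hconst_uminus hconst_simps)

lemma hecke_alg_diff: "x \<in> hecke_alg K \<Longrightarrow> y \<in> hecke_alg K \<Longrightarrow> x - y \<in> hecke_alg K"
  using hecke_alg.add[of x K "- y"] by (simp add: hecke_alg_uminus)

lemma hecke_alg_hgen_inv: "Suc i < K \<Longrightarrow> hgen_inv i \<in> hecke_alg K"
  by (simp add: hgen_inv_def hecke_alg_diff hecke_alg.intros)

lemma hecke_alg_sum: "(\<And>x. x \<in> A \<Longrightarrow> f x \<in> hecke_alg K) \<Longrightarrow> sum f A \<in> hecke_alg K"
  by (induction A rule: infinite_finite_induct) (auto simp: hecke_alg_0 hecke_alg.add)

lemma hecke_alg_mono: "x \<in> hecke_alg K \<Longrightarrow> K \<le> L \<Longrightarrow> x \<in> hecke_alg L"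
  by (induction rule: hecke_alg.induct) (auto intro: hecke_alg.intros)

lemma hecke_alg_hshift: "x \<in> hecke_alg K \<Longrightarrow> hshift m x \<in> hecke_alg (m + K)"
  by (induction rule: hecke_alg.induct) (auto simp: hshift_simps intro: hecke_alg.intros)

lemma hecke_alg_hphi: "x \<in> hecke_alg K \<Longrightarrow> hphi x \<in> hecke_alg K"
  by (induction rule: hecke_alg.induct)
    (auto simp: hphi_simps intro: hecke_alg.intros hecke_alg_uminus)

lemma hecke_alg_hrev: "x \<in> hecke_alg K \<Longrightarrow> hrev x \<in> hecke_alg K"
  by (induction rule: hecke_alg.induct) (auto simp: hrev_simps intro: hecke_alg.intros)

lemma commute_hgen_hshift:
  assumes "\<And>i. hgen (m + i) * z = z * hgen (m + i)"
  shows "hshift m x * z = z * hshift m x"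
proof (induction x rule: hecke_induct_left)
  case (gen i x)
  then show ?case by (simp add: hshift_simps) (metis assms mult.assoc)
qed (simp_all add: hshift_simps distrib_left distrib_right hconst_commute)

text \<open>The generators \<open>hgen j\<close> of \<open>hecke_alg m\<close> satisfy j + 2 \<le>
  m, so their indices are at distance at least two from m + i.\<close>

lemma hecke_alg_commute_hshift:
  assumes "z \<in> hecke_alg m"
  shows "hshift m x * z = z * hshift m x"
proof (rule commute_hgen_hshift)
  fix i
  show "hgen (m + i) * z = z * hgen (m + i)"
    using assms
  proof induction
    case (gen j)
    then show ?case by (intro hgen_far) auto
  next
    case (mult x y)
    then show ?case by (metis mult.assoc)
  qed (simp_all add: distrib_left distrib_right hconst_commute)
qed

section \<open>Additive spans stable under right multiplication\<close>

inductive_set add_span :: "hecke set \<Rightarrow> hecke set" for B where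
  base: "b \<in> B \<Longrightarrow> b \<in> add_span B"
| add: "x \<in> add_span B \<Longrightarrow> y \<in> add_span B \<Longrightarrow> x + y \<in> add_span B"

text \<open>Stability under right multiplication by constants and generators passes to sums and
  products, so the span absorbs every element of the algebra from the right; apply this to
  1.\<close>

lemma hecke_alg_add_span:
  assumes "x \<in> hecke_alg K" "1 \<in> B"
    and const: "\<And>b c. b \<in> B \<Longrightarrow> b * hconst c \<in> add_span B"
    and gen: "\<And>b i. b \<in> B \<Longrightarrow> Suc i < K \<Longrightarrow> b * hgen i \<in> add_span B"
  shows "x \<in> add_span B"
proof -
  have span: "b * y \<in> add_span B" if "b \<in> add_span B" "\<And>b. b \<in> B \<Longrightarrow> b * y \<in> add_span B" for b y
    using that(1) by induction (auto simp: distrib_right that(2) intro: add_span.add)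
  have "\<forall>b\<in>add_span B. b * x \<in> add_span B"
    using assms(1)
  proof induction
    case (mult x y)
    then show ?case by (auto simp flip: mult.assoc)
  qed (auto simp: distrib_left intro: span const gen add_span.add)
  then show ?thesis using assms(2) add_span.base by fastforce
qed

section \<open>Inversions and Matsumoto's theorem\<close>

definition invs :: "(nat \<Rightarrow> nat) \<Rightarrow> (nat \<times> nat) set" where
  "invs w = {(a, b). a < b \<and> w b < w a}"

definition ninv :: "(nat \<Rightarrow> nat) \<Rightarrow> nat" where
  "ninv w = card (invs w)"

abbreviation adj :: "nat \<Rightarrow> nat \<Rightarrow> nat" where
  "adj i \<equiv> transpose i (Suc i)"

lemma adj_less_iff:
  "adj i y < adj i x \<longleftrightarrow> (if x = i \<and> y = Suc i then True else if x = Suc i \<and> y = i then False else y < x)"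
  by (auto simp: transpose_def)

text \<open>Exchanging the adjacent values i and i + 1 alters the order of no other pair of values,
  so only the pair of their preimages changes its status.\<close>

lemma invs_up:
  assumes "bij w" "inv w i < inv w (Suc i)"
  shows "invs (adj i \<circ> w) = insert (inv w i, inv w (Suc i)) (invs w)"
    and "(inv w i, inv w (Suc i)) \<notin> invs w"
proof -
  define a where "a = inv w i"
  define b where "b = inv w (Suc i)"
  have w: "w x = i \<longleftrightarrow> x = a" "w x = Suc i \<longleftrightarrow> x = b" for x
    using assms(1) unfolding a_def b_def by (metis bij_inv_eq_iff)+
  then have "w a = i" "w b = Suc i" by blast+
  then show "(inv w i, inv w (Suc i)) \<notin> invs w"
    by (simp add: invs_def flip: a_def b_def)
  have "a < b" using assms(2) by (simp add: a_def b_def)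
  have "(x, y) \<in> invs (adj i \<circ> w) \<longleftrightarrow> (x, y) = (a, b) \<or> (x, y) \<in> invs w" for x y
    using \<open>a < b\<close> \<open>w a = i\<close> \<open>w b = Suc i\<close>
    by (auto simp: invs_def adj_less_iff w)
  then show "invs (adj i \<circ> w) = insert (inv w i, inv w (Suc i)) (invs w)"
    by (auto simp flip: a_def b_def)
qed

lemma adj_comp_adj: "adj i \<circ> (adj i \<circ> w) = w"
  by (simp add: fun_eq_iff)

lemma adj_permutes: "Suc i < K \<Longrightarrow> adj i permutes {..<K}"
  by (intro permutes_swap_id) auto

lemma bij_adj: "bij (adj i)"
  by simp

lemma inv_adj_comp: "bij w \<Longrightarrow> inv (adj i \<circ> w) = inv w \<circ> adj i"
  by (subst o_inv_distrib) (simp_all add: bij_adj)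

text \<open>The preceding lemma read backwards, with \<open>adj i \<circ> w\<close> in place of
  \<open>w\<close>.\<close>

lemma invs_down:
  assumes "bij w" "inv w (Suc i) < inv w i"
  shows "invs w = insert (inv w (Suc i), inv w i) (invs (adj i \<circ> w))"
    and "(inv w (Suc i), inv w i) \<notin> invs (adj i \<circ> w)"
proof -
  have "bij (adj i \<circ> w)" using assms(1) by (simp add: bij_comp)
  note up = invs_up[OF this, of i]
  have e: "inv (adj i \<circ> w) i = inv w (Suc i)" "inv (adj i \<circ> w) (Suc i) = inv w i"
    using assms(1) by (simp_all add: inv_adj_comp)
  show "invs w = insert (inv w (Suc i), inv w i) (invs (adj i \<circ> w))"
    using up(1) assms(2) unfolding e adj_comp_adj by blast
  show "(inv w (Suc i), inv w i) \<notin> invs (adj i \<circ> w)"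
    using up(2) assms(2) unfolding e by blast
qed

lemma bij_cases_inv:
  fixes w :: "nat \<Rightarrow> nat"
  assumes "bij w"
  obtains "inv w i < inv w (Suc i)" | "inv w (Suc i) < inv w i"
proof -
  have "inv w i \<noteq> inv w (Suc i)"
    by (metis assms bij_inv_eq_iff n_not_Suc_n)
  then have "inv w i < inv w (Suc i) \<or> inv w (Suc i) < inv w i" by (simp add: nat_neq_iff)
  then show ?thesis using that by blast
qed

lemma finite_invs_adj:
  assumes "bij w"
  shows "finite (invs (adj i \<circ> w)) \<longleftrightarrow> finite (invs w)"
  using assms
proof (cases rule: bij_cases_inv[of w i])
  case 1
  then show ?thesis using invs_up[OF assms] by simp
next
  case 2
  show ?thesis using invs_down(1)[OF assms 2] by (metis finite_insert)
qed

lemma ninv_up: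
  assumes "bij w" "finite (invs w)" "inv w i < inv w (Suc i)"
  shows "ninv (adj i \<circ> w) = Suc (ninv w)"
  using invs_up[OF assms(1,3)] assms(2) by (simp add: ninv_def)

lemma ninv_down:
  assumes "bij w" "finite (invs w)" "inv w (Suc i) < inv w i"
  shows "ninv w = Suc (ninv (adj i \<circ> w))"
proof -
  have "finite (invs (adj i \<circ> w))" using assms by (simp add: finite_invs_adj)
  with invs_down[OF assms(1,3)] show ?thesis by (simp add: ninv_def)
qed

lemma bij_word_perm: "bij (word_perm ws)"
proof (induction ws)
  case (Cons i ws)
  then show ?case using bij_comp[OF Cons bij_adj[of i]] by (simp del: o_apply)
qed (simp del: id_apply)

lemma word_perm_append: "word_perm (u @ v) = word_perm u \<circ> word_perm v"
  by (induction u) (simp_all add: comp_assoc)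

lemma word_perm_rev: "word_perm (rev ws) = inv (word_perm ws)"
proof (induction ws)
  case (Cons i ws)
  then show ?case
    using inv_adj_comp[OF bij_word_perm[of ws], of i] by (simp add: word_perm_append del: o_apply)
qed (simp del: id_apply)

lemma word_perm_permutes: "(\<And>i. i \<in> set ws \<Longrightarrow> Suc i < K) \<Longrightarrow> word_perm ws permutes {..<K}"
proof (induction ws)
  case Nil
  show ?case by (simp add: permutes_id del: id_apply)
next
  case (Cons i ws)
  have "adj i permutes {..<K}"
    using Cons.prems[of i] by (simp add: adj_permutes)
  with Cons show ?case by (auto intro: permutes_compose simp del: o_apply)
qed

lemma word_perm_permutes_ex: "\<exists>K. word_perm ws permutes {..<K}"
proof -
  have "Suc i < Suc (Suc (Max (set ws)))" if "i \<in> set ws" for i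
    using that by (simp add: less_Suc_eq_le)
  then show ?thesis using word_perm_permutes by blast
qed

lemma finite_invs_permutes:
  assumes "w permutes {..<K}"
  shows "finite (invs w)"
proof (rule finite_subset)
  show "invs w \<subseteq> {..<K} \<times> {..<K}"
  proof clarify
    fix a b assume "(a, b) \<in> invs w"
    then have ab: "a < b" "w b < w a" by (auto simp: invs_def)
    have "b < K"
    proof (rule ccontr)
      assume "\<not> b < K"
      with assms ab(2) have "w a > b" by (simp add: permutes_not_in)
      with \<open>\<not> b < K\<close> have "\<not> a < K"
        using permutes_in_image[OF assms, of a] by auto
      with assms \<open>w a > b\<close> ab show False by (simp add: permutes_not_in)
    qed
    with ab show "a \<in> {..<K} \<and> b \<in> {..<K}" by auto
  qed
qed simp

lemma finite_invs_word_perm: "finite (invs (word_perm ws))"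
  using word_perm_permutes_ex finite_invs_permutes by blast

lemma ninv_id: "ninv id = 0"
proof -
  have "invs id = {}" by (auto simp: invs_def)
  then show ?thesis by (simp add: ninv_def)
qed

lemma ninv_word_perm_le: "ninv (word_perm ws) \<le> length ws"
proof (induction ws)
  case Nil
  then show ?case by (simp add: ninv_id del: id_apply)
next
  case (Cons i ws)
  note * = bij_word_perm[of ws] finite_invs_word_perm[of ws]
  from *(1) show ?case
  proof (cases rule: bij_cases_inv[of _ i])
    case 1
    with Cons show ?thesis using ninv_up[OF *] by (simp del: o_apply)
  next
    case 2
    with Cons show ?thesis using ninv_down[OF *] by (simp del: o_apply)
  qed
qed

lemma strict_mono_bij_nat_id:
  fixes f :: "nat \<Rightarrow> nat"
  assumes "bij f" "strict_mono f"
  shows "f = id"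
proof
  fix n
  show "f n = id n"
  proof (induction n rule: less_induct)
    case (less n)
    obtain m where m: "f m = n" using assms(1) by (metis bij_pointE)
    have "n \<le> m" using less[of m] m by (cases "m < n") auto
    then have "f n \<le> n" using m assms(2) by (metis strict_mono_less_eq)
    with strict_mono_imp_increasing[OF assms(2), of n] show ?case by simp
  qed
qed

text \<open>Were the first letter an ascent of w, the rest of the word would yield a permutation
  with two more inversions than the rest has letters.\<close>

lemma reduced_descent:
  assumes "word_perm (i # u) = w" "length (i # u) = ninv w"
  shows "inv w (Suc i) < inv w i" "length u = ninv (word_perm u)" "word_perm u = adj i \<circ> w"
proof -
  show u: "word_perm u = adj i \<circ> w"
    using assms(1) adj_comp_adj[of i "word_perm u"] by (metis word_perm.simps(2))
  have w: "bij w" "finite (invs w)"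
    using assms(1) bij_word_perm finite_invs_word_perm by blast+
  have "\<not> inv w i < inv w (Suc i)"
    using ninv_up[OF w, of i] assms(2) ninv_word_perm_le[of u] u by auto
  then show d: "inv w (Suc i) < inv w i"
    using w(1) by (metis bij_cases_inv)
  show "length u = ninv (word_perm u)"
    using ninv_down[OF w d] assms(2) u by simp
qed

lemma permutes_adj:
  assumes "w permutes {..<K}" "inv w (Suc i) < inv w i"
  shows "Suc i < K" "adj i \<circ> w permutes {..<K}"
proof -
  have iw: "inv w permutes {..<K}" using assms(1) by (rule permutes_inv)
  show *: "Suc i < K"
  proof (rule ccontr)
    assume "\<not> Suc i < K"
    then have "inv w (Suc i) = Suc i"
      using permutes_not_in[OF iw] by auto
    moreover have "inv w i \<le> i"
    proof (cases "i < K")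
      case True
      then have "inv w i < K" using permutes_in_image[OF iw, of i] by auto
      with \<open>\<not> Suc i < K\<close> show ?thesis by simp
    next
      case False
      then show ?thesis using permutes_not_in[OF iw, of i] by auto
    qed
    ultimately show False using assms(2) by simp
  qed
  then have "adj i permutes {..<K}" by (rule adj_permutes)
  with assms(1) show "adj i \<circ> w permutes {..<K}" by (rule permutes_compose)
qed

text \<open>Descents are split off until none is left; then the inverse is a strictly increasing
  bijection of the natural numbers, hence the identity.\<close>

lemma reduced_word_exists:
  assumes "w permutes {..<K}"
  shows "\<exists>ws. word_perm ws = w \<and> length ws = ninv w"
  using assms
proof (induction "ninv w" arbitrary: w rule: less_induct)
  case less
  note w = permutes_bij[OF less.prems] finite_invs_permutes[OF less.prems]
  show ?case
  proof (cases "\<exists>i. inv w (Suc i) < inv w i")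
    case True
    then obtain i where i: "inv w (Suc i) < inv w i" by blast
    note n = ninv_down[OF w i]
    then obtain ws where "word_perm ws = adj i \<circ> w" "length ws = ninv (adj i \<circ> w)"
      using less.hyps[of "adj i \<circ> w"] permutes_adj(2)[OF less.prems i] by auto
    with n have "word_perm (i # ws) = w \<and> length (i # ws) = ninv w"
      by (simp add: adj_comp_adj)
    then show ?thesis by blast
  next
    case False
    have "inv w i < inv w (Suc i)" for i
      using w(1) False by (metis bij_cases_inv)
    then have "inv w = id"
      using w(1) by (intro strict_mono_bij_nat_id) (auto simp: strict_mono_Suc_iff bij_imp_bij_inv)
    then have "w = id"
      using w(1) by (metis inv_id inv_inv_eq)
    then show ?thesis by (intro exI[of _ "[]"]) (simp add: ninv_id)
  qed
qed

lemma perm_length_ninv: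
  assumes "w permutes {..<K}"
  shows "perm_length w = ninv w"
  unfolding perm_length_def
proof (rule Least_equality)
  show "\<exists>ws. length ws = ninv w \<and> word_perm ws = w"
    using reduced_word_exists[OF assms] by blast
qed (use ninv_word_perm_le in blast)

lemma reduced_word:
  assumes "w permutes {..<K}"
  shows "word_perm (reduced_word w) = w" "length (reduced_word w) = ninv w"
proof -
  have "\<exists>ws. word_perm ws = w \<and> length ws = perm_length w"
    using reduced_word_exists[OF assms] perm_length_ninv[OF assms] by simp
  from someI_ex[OF this] show "word_perm (reduced_word w) = w" "length (reduced_word w) = ninv w"
    unfolding reduced_word_def by (simp_all add: perm_length_ninv[OF assms])
qed

lemma reduced_word_letters:
  assumes "w permutes {..<K}" "word_perm ws = w" "length ws = ninv w" "i \<in> set ws"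
  shows "Suc i < K"
  using assms
proof (induction ws arbitrary: w)
  case (Cons j ws)
  note d = reduced_descent[OF Cons.prems(2,3)]
  note p = permutes_adj[OF Cons.prems(1) d(1)]
  show ?case
    using Cons.IH[OF p(2) d(3) d(2)[unfolded d(3)]] p(1) Cons.prems(4) by auto
qed simp

definition hprod :: "nat list \<Rightarrow> hecke" where
  "hprod ws = prod_list (map hgen ws)"

lemma hprod_simps: "hprod [] = 1" "hprod (i # ws) = hgen i * hprod ws"
  "hprod (u @ v) = hprod u * hprod v"
  by (simp_all add: hprod_def)

lemma reduced_Cons:
  assumes "bij w" "finite (invs w)" "inv w (Suc i) < inv w i"
    and "word_perm x = adj i \<circ> w" "length x = ninv (adj i \<circ> w)"
  shows "word_perm (i # x) = w" "length (i # x) = ninv w"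
  using assms ninv_down[OF assms(1-3)] by (simp_all add: adj_comp_adj)

text \<open>Matsumoto's theorem, by induction on the length. The first letters i and j of the two
  words are both descents of w. So w has reduced words that begin with i j and j i if the letters
  are far apart, or with i j i and j i j if they are adjacent, and have a common remainder x. The
  induction hypothesis compares the given tails with the tails of these words, and one relation of
  the algebra joins the two.\<close>

lemma hprod_reduced_eq:
  assumes "word_perm u = w" "word_perm v = w" "length u = ninv w" "length v = ninv w"
  shows "hprod u = hprod v"
  using assms
proof (induction "ninv w" arbitrary: w u v rule: less_induct)
  case less
  obtain K where w: "w permutes {..<K}"
    using word_perm_permutes_ex less.prems(1) by blast
  note w' = permutes_bij[OF w] finite_invs_permutes[OF w]
  show ?case
  proof (cases u)
    case Nil
    with less.prems show ?thesis by simp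
  next
    case u: (Cons i u')
    with less.prems obtain j v' where v: "v = j # v'" by (cases v) auto
    note du = reduced_descent[OF less.prems(1,3)[unfolded u]]
    note dv = reduced_descent[OF less.prems(2,4)[unfolded v]]
    note IH = less.hyps[of "adj _ \<circ> w"]
    have lt: "ninv (adj i \<circ> w) < ninv w" "ninv (adj j \<circ> w) < ninv w"
      using ninv_down[OF w' du(1)] ninv_down[OF w' dv(1)] by simp_all
    note IHi = IH[OF lt(1) du(3) _ du(2)[unfolded du(3)]]
    note IHj = IH[OF lt(2) dv(3) _ dv(2)[unfolded dv(3)]]
    have inv_adj: "inv (adj k \<circ> w) = inv w \<circ> adj k" for k
      using w'(1) by (rule inv_adj_comp)
    have inv_adj2: "inv (adj l \<circ> (adj k \<circ> w)) = inv w \<circ> adj k \<circ> adj l" for k l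
      using w'(1) by (subst inv_adj_comp) (simp_all add: bij_comp inv_adj)
    have wk: "bij (adj k \<circ> w)" "finite (invs (adj k \<circ> w))" for k
      using w' by (simp_all add: bij_comp finite_invs_adj)
    have wkl: "bij (adj l \<circ> (adj k \<circ> w))" "finite (invs (adj l \<circ> (adj k \<circ> w)))" for k l
      using wk by (simp_all add: bij_comp finite_invs_adj del: o_apply)
    have far: ?thesis if ij: "Suc i < j \<or> Suc j < i"
    proof -
      have c: "adj j \<circ> (adj i \<circ> w) = adj i \<circ> (adj j \<circ> w)"
        using ij by (auto simp: fun_eq_iff transpose_def)
      have d1: "inv (adj i \<circ> w) (Suc j) < inv (adj i \<circ> w) j"
        using ij dv(1) by (auto simp: inv_adj transpose_def)
      have d2: "inv (adj j \<circ> w) (Suc i) < inv (adj j \<circ> w) i"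
        using ij du(1) by (auto simp: inv_adj transpose_def)
      have "adj j \<circ> (adj i \<circ> w) permutes {..<K}"
        using permutes_adj(2)[OF permutes_adj(2)[OF w du(1)] d1] .
      from reduced_word_exists[OF this] obtain x
        where x: "word_perm x = adj j \<circ> (adj i \<circ> w)" "length x = ninv (adj j \<circ> (adj i \<circ> w))"
        by blast
      have "hprod u' = hprod (j # x)"
        using reduced_Cons[OF wk d1 x] by (intro IHi) simp_all
      moreover have "hprod v' = hprod (i # x)"
        using reduced_Cons[OF wk d2] x[unfolded c] by (intro IHj) simp_all
      ultimately show ?thesis
        using hgen_far[OF ij] by (simp add: u v hprod_simps flip: mult.assoc)
    qed
    have adjacent: ?thesis if "i = Suc j \<or> j = Suc i"
    proof -
      define k where "k = min i j"
      have k: "(i = k \<and> j = Suc k) \<or> (i = Suc k \<and> j = k)"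
        using that by (auto simp: k_def)
      \<comment> \<open>Two adjacent descents put the preimages of k, k + 1, k + 2 in decreasing
        order, so three letters can be split off in either of two ways.\<close>
      have dk: "inv w (Suc k) < inv w k" "inv w (Suc (Suc k)) < inv w (Suc k)"
        using k du(1) dv(1) by auto
      let ?l = "Suc k"
      have c: "adj k \<circ> (adj ?l \<circ> (adj k \<circ> w)) = adj ?l \<circ> (adj k \<circ> (adj ?l \<circ> w))"
        by (auto simp: fun_eq_iff transpose_def)
      have d1: "inv (adj k \<circ> w) (Suc ?l) < inv (adj k \<circ> w) ?l"
        using dk by (auto simp: inv_adj transpose_def)
      have d2: "inv (adj ?l \<circ> (adj k \<circ> w)) (Suc k) < inv (adj ?l \<circ> (adj k \<circ> w)) k"
        using dk by (auto simp: inv_adj2 transpose_def)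
      have e1: "inv (adj ?l \<circ> w) (Suc k) < inv (adj ?l \<circ> w) k"
        using dk by (auto simp: inv_adj transpose_def)
      have e2: "inv (adj k \<circ> (adj ?l \<circ> w)) (Suc ?l) < inv (adj k \<circ> (adj ?l \<circ> w)) ?l"
        using dk by (auto simp: inv_adj2 transpose_def)
      have "adj k \<circ> (adj ?l \<circ> (adj k \<circ> w)) permutes {..<K}"
        using permutes_adj(2)[OF permutes_adj(2)[OF permutes_adj(2)[OF w dk(1)] d1] d2] .
      from reduced_word_exists[OF this] obtain x
        where x: "word_perm x = adj k \<circ> (adj ?l \<circ> (adj k \<circ> w))"
          "length x = ninv (adj k \<circ> (adj ?l \<circ> (adj k \<circ> w)))"
        by blast
      note r1 = reduced_Cons[OF wkl d2 x]
      note r1' = reduced_Cons[OF wk d1 r1]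
      note r2 = reduced_Cons[OF wkl e2 x[unfolded c]]
      note r2' = reduced_Cons[OF wk e1 r2]
      have IHk: "hprod y = hprod (?l # k # x)" if "word_perm y = adj k \<circ> w" "length y = ninv (adj k \<circ> w)" for y
        using that r1' ninv_down[OF w' dk(1)] by (intro less.hyps[of "adj k \<circ> w"]) simp_all
      have IHl: "hprod y = hprod (k # ?l # x)" if "word_perm y = adj ?l \<circ> w" "length y = ninv (adj ?l \<circ> w)" for y
        using that r2' ninv_down[OF w' dk(2)] by (intro less.hyps[of "adj ?l \<circ> w"]) simp_all
      have "hgen k * hprod (?l # k # x) = hgen ?l * hprod (k # ?l # x)"
        using arg_cong[OF hgen_braid[of k], of "\<lambda>z. z * hprod x"]
        by (simp add: hprod_simps mult.assoc)
      note * = this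
      from k show ?thesis
      proof
        assume ij: "i = k \<and> j = ?l"
        have "hprod u' = hprod (?l # k # x)"
          using du(2,3) ij by (intro IHk) simp_all
        moreover have "hprod v' = hprod (k # ?l # x)"
          using dv(2,3) ij by (intro IHl) simp_all
        ultimately show ?thesis using ij * by (simp add: u v hprod_simps(2)[of _ u'] hprod_simps(2)[of _ v'])
      next
        assume ij: "i = ?l \<and> j = k"
        have "hprod v' = hprod (?l # k # x)"
          using dv(2,3) ij by (intro IHk) simp_all
        moreover have "hprod u' = hprod (k # ?l # x)"
          using du(2,3) ij by (intro IHl) simp_all
        ultimately show ?thesis using ij * by (simp add: u v hprod_simps(2)[of _ u'] hprod_simps(2)[of _ v'])
      qed
    qed
    consider "i = j" | "Suc i < j \<or> Suc j < i" | "i = Suc j" | "j = Suc i" by linarith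
    then show ?thesis
    proof cases
      case 1
      with dv have "hprod u' = hprod v'" by (intro IHi) simp_all
      with 1 show ?thesis by (simp add: u v hprod_simps)
    next
      case 2
      then show ?thesis by (rule far)
    next
      case 3
      show ?thesis by (rule adjacent) (simp add: 3)
    next
      case 4
      show ?thesis by (rule adjacent) (simp add: 4)
    qed
  qed
qed

section \<open>Standard basis elements and their products with generators\<close>

lemma hbasis_hprod: "hbasis w = hprod (reduced_word w)"
  by (simp add: hbasis_def braid_hecke_def perm_braid_def hprod_def comp_def)

lemma hbasis_word: "word_perm ws = w \<Longrightarrow> length ws = ninv w \<Longrightarrow> hbasis w = hprod ws"
proof -
  assume *: "word_perm ws = w" "length ws = ninv w"
  then obtain K where "w permutes {..<K}" using word_perm_permutes_ex by blast
  from reduced_word[OF this] * show ?thesis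
    unfolding hbasis_hprod by (intro hprod_reduced_eq)
qed

lemma hbasis_id: "hbasis id = 1"
  using hbasis_word[of "[]" id] by (simp add: ninv_id hprod_simps)

lemma hbasis_down:
  assumes "w permutes {..<K}" "inv w (Suc i) < inv w i"
  shows "hbasis w = hgen i * hbasis (adj i \<circ> w)"
proof -
  note w = permutes_bij[OF assms(1)] finite_invs_permutes[OF assms(1)]
  note r = reduced_word[OF permutes_adj(2)[OF assms]]
  show ?thesis
    using hbasis_word[OF reduced_Cons[OF w assms(2) r]] by (simp add: hbasis_hprod hprod_simps)
qed

lemma hbasis_up:
  assumes "w permutes {..<K}" "inv w i < inv w (Suc i)"
  shows "hgen i * hbasis w = hbasis (adj i \<circ> w)"
proof -
  \<comment> \<open>The generator i may reach beyond the first K strands, so room is made for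
    it.\<close>
  define L where "L = max K (Suc (Suc i))"
  have w: "w permutes {..<L}"
    using assms(1) by (rule permutes_subset) (auto simp: L_def)
  have "adj i permutes {..<L}" by (simp add: adj_permutes L_def)
  then have sw: "adj i \<circ> w permutes {..<L}" by (rule permutes_compose[OF w])
  have "inv (adj i \<circ> w) (Suc i) < inv (adj i \<circ> w) i"
    using assms(2) by (simp add: inv_adj_comp[OF permutes_bij[OF w]])
  from hbasis_down[OF sw this] show ?thesis by (simp add: adj_comp_adj)
qed

lemma ninv_inv:
  assumes "bij w"
  shows "ninv (inv w) = ninv w"
  unfolding ninv_def
proof (rule bij_betw_same_card)
  show "bij_betw (\<lambda>(a, b). (inv w b, inv w a)) (invs (inv w)) (invs w)"
    using assms
    by (intro bij_betw_byWitness[where f' = "\<lambda>(a, b). (w b, w a)"])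
      (auto simp: invs_def bij_is_inj bij_is_surj surj_f_inv_f)
qed

lemma hrev_hprod: "hrev (hprod ws) = hprod (rev ws)"
  by (induction ws) (simp_all add: hprod_simps hrev_simps)

lemma hrev_hbasis:
  assumes "w permutes {..<K}"
  shows "hrev (hbasis w) = hbasis (inv w)"
proof -
  have "hbasis (inv w) = hprod (rev (reduced_word w))"
    using reduced_word[OF assms] permutes_bij[OF assms]
    by (intro hbasis_word) (simp_all add: word_perm_rev ninv_inv)
  then show ?thesis by (simp add: hrev_hprod hbasis_hprod)
qed

text \<open>Mirror image of the rule for left multiplication: \<open>hrev\<close> turns w into its
  inverse and exchanges the sides.\<close>

lemma hbasis_right_up:
  assumes "w permutes {..<K}" "w i < w (Suc i)"
  shows "hbasis w * hgen i = hbasis (w \<circ> adj i)"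
proof -
  have iw: "inv w permutes {..<K}" and b: "bij w"
    using assms(1) by (auto intro: permutes_inv permutes_bij)
  have "hgen i * hbasis (inv w) = hbasis (adj i \<circ> inv w)"
    using iw by (rule hbasis_up) (simp add: inv_inv_eq b assms)
  then have "hrev (hbasis (inv w)) * hgen i = hrev (hbasis (adj i \<circ> inv w))"
    by (metis hrev_simps(3,4))
  moreover have "hrev (hbasis (inv w)) = hbasis w"
    using hrev_hbasis[OF iw] by (simp add: inv_inv_eq b)
  moreover have "hrev (hbasis (adj i \<circ> inv w)) = hbasis (w \<circ> adj i)"
  proof -
    define L where "L = max K (Suc (Suc i))"
    have "inv w permutes {..<L}"
      using iw by (rule permutes_subset) (auto simp: L_def)
    moreover have "adj i permutes {..<L}" by (simp add: adj_permutes L_def)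
    ultimately have "adj i \<circ> inv w permutes {..<L}" by (rule permutes_compose)
    from hrev_hbasis[OF this] show ?thesis
      using b by (simp add: inv_adj_comp bij_imp_bij_inv inv_inv_eq)
  qed
  ultimately show ?thesis by simp
qed

lemma hprod_hecke_alg: "(\<And>i. i \<in> set ws \<Longrightarrow> Suc i < K) \<Longrightarrow> hprod ws \<in> hecke_alg K"
  by (induction ws) (auto simp: hprod_simps hecke_alg_1 intro: hecke_alg.intros)

lemma hbasis_hecke_alg: "w permutes {..<K} \<Longrightarrow> hbasis w \<in> hecke_alg K"
  unfolding hbasis_hprod
  by (rule hprod_hecke_alg) (rule reduced_word_letters[OF _ reduced_word])

lemma hphi_hprod: "hphi (hprod ws) = hconst ((- 1) ^ length ws) * hprod ws"
  by (induction ws) (simp_all add: hprod_simps hphi_simps hconst_simps hconst_uminus hconst_left_commute)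

lemma hphi_hbasis: "w permutes {..<K} \<Longrightarrow> hphi (hbasis w) = (- 1) ^ ninv w *\<^sub>H hbasis w"
  by (simp add: hbasis_hprod hphi_hprod reduced_word hscale_def)

lemma hbasis_hgen_cases:
  assumes "w permutes {..<K}" "Suc i < K"
  obtains w' where "w' permutes {..<K}" "hbasis w * hgen i = hbasis w'"
  | w' where "w' permutes {..<K}"
      "hbasis w * hgen i = hbasis w * hconst (qv - inverse qv) + hbasis w'"
proof -
  have ws: "w \<circ> adj i permutes {..<K}" by (rule permutes_compose[OF adj_permutes[OF assms(2)] assms(1)])
  have "w i \<noteq> w (Suc i)" using permutes_inj[OF assms(1)] by (simp add: inj_eq)
  then consider "w i < w (Suc i)" | "w (Suc i) < w i" by linarith
  then show ?thesis
  proof cases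
    case 1
    then show ?thesis using that(1)[OF ws] hbasis_right_up[OF assms(1)] by blast
  next
    case 2
    then have "hbasis (w \<circ> adj i) * hgen i = hbasis (w \<circ> adj i \<circ> adj i)"
      by (intro hbasis_right_up[OF ws]) simp
    then have w: "hbasis w = hbasis (w \<circ> adj i) * hgen i" by (simp add: comp_assoc)
    then have "hbasis w * hgen i = hbasis (w \<circ> adj i) * (hgen i * hgen i)"
      by (simp only: mult.assoc)
    also have "\<dots> = hbasis w * hconst (qv - inverse qv) + hbasis (w \<circ> adj i)"
      by (simp only: w hgen_square distrib_left mult.assoc mult_1_right hconst_commute[of "hgen i"])
    finally show ?thesis by (rule that(2)[OF ws])
  qed
qed

text \<open>The multiples of the \<open>hbasis w\<close> include 1, and their additive span absorbs
  generators from the right: a product of \<open>hbasis w\<close> with a generator is again such an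
  element, or a sum of two by the quadratic relation.\<close>

lemma hecke_alg_basis_induct [consumes 1, case_names basis add]:
  assumes "x \<in> hecke_alg K"
    and basis: "\<And>c w. w permutes {..<K} \<Longrightarrow> P (c *\<^sub>H hbasis w)"
    and add: "\<And>x y. P x \<Longrightarrow> P y \<Longrightarrow> P (x + y)"
  shows "P x"
proof -
  define B where "B = {c *\<^sub>H hbasis w | c w. w permutes {..<K}}"
  have const: "b * hconst d \<in> B" if "b \<in> B" for b d
  proof -
    obtain c w where b: "b = c *\<^sub>H hbasis w" "w permutes {..<K}" using \<open>b \<in> B\<close> B_def by blast
    have "b * hconst d = (d * c) *\<^sub>H hbasis w"
      using hconst_commute[of "hconst c * hbasis w" d]
      by (simp only: b(1) hscale_def hconst_simps mult.assoc)
    with b show ?thesis by (auto simp: B_def)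
  qed
  have "x \<in> add_span B"
    using assms(1)
  proof (rule hecke_alg_add_span)
    have "1 = 1 *\<^sub>H hbasis id" by (simp add: hbasis_id hscale_def hconst_simps)
    then show "1 \<in> B" unfolding B_def using permutes_id by blast
  next
    fix b i assume "b \<in> B" and i: "Suc i < K"
    then obtain c w where b: "b = c *\<^sub>H hbasis w" and w: "w permutes {..<K}"
      unfolding B_def by blast
    have eq: "b * hgen i = c *\<^sub>H (hbasis w * hgen i)" by (simp add: b hscale_def mult.assoc)
    show "b * hgen i \<in> add_span B"
      using w i
    proof (cases rule: hbasis_hgen_cases)
      case (1 w')
      then show ?thesis unfolding eq by (auto simp: B_def intro: add_span.base)
    next
      case (2 w')
      have "b * hgen i = b * hconst (qv - inverse qv) + c *\<^sub>H hbasis w'"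
        unfolding eq 2(2) by (simp add: b hscale_def distrib_left mult.assoc)
      moreover have "c *\<^sub>H hbasis w' \<in> B" using 2(1) by (auto simp: B_def)
      ultimately show ?thesis using const[OF \<open>b \<in> B\<close>] by (auto intro: add_span.intros)
    qed
  qed (auto intro: add_span.base const)
  then show ?thesis by induction (auto simp: B_def basis add)
qed

section \<open>Scalar multiplication in the Hecke algebra\<close>

lemma hscale_simps:
  "c *\<^sub>H (d *\<^sub>H x) = (c * d) *\<^sub>H x"
  "c *\<^sub>H (x + y) = c *\<^sub>H x + c *\<^sub>H y"
  "x * (c *\<^sub>H y) = c *\<^sub>H (x * y)"
  "(c *\<^sub>H x) * y = c *\<^sub>H (x * y)"
  "1 *\<^sub>H x = x"
  "0 *\<^sub>H x = 0"
  "c *\<^sub>H 0 = 0"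
  unfolding hscale_def
  by (simp_all only: hconst_simps mult.assoc distrib_left mult_1_left mult_zero_left mult_zero_right)
    (rule hconst_left_commute)

lemma hscale_add: "(c + d) *\<^sub>H x = c *\<^sub>H x + d *\<^sub>H x"
  by (simp add: hscale_def hconst_simps distrib_right)

lemma hscale_diff: "(c - d) *\<^sub>H x = c *\<^sub>H x - d *\<^sub>H x"
  by (simp add: hscale_def hconst_diff left_diff_distrib)

lemma hscale_uminus: "c *\<^sub>H (- x) = (- c) *\<^sub>H x"
  by (simp add: hscale_def hconst_uminus)

lemma hphi_uminus: "hphi (- x) = - hphi x"
  using hphi_simps(2)[of 0 x] by (simp add: hphi_simps)

lemma hscale_minus_left: "(- c) *\<^sub>H x = - (c *\<^sub>H x)"
  by (simp add: hscale_def hconst_uminus)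

lemma hscale_sum: "c *\<^sub>H sum f A = (\<Sum>x\<in>A. c *\<^sub>H f x)"
  by (simp add: hscale_def sum_distrib_left)

lemma hscale_cancel: "c *\<^sub>H x = d *\<^sub>H x \<Longrightarrow> x \<noteq> 0 \<Longrightarrow> c = d"
proof (rule ccontr)
  assume *: "c *\<^sub>H x = d *\<^sub>H x" "x \<noteq> 0" "c \<noteq> d"
  then have "(c - d) *\<^sub>H x = 0" by (simp add: hscale_diff)
  then have "inverse (c - d) *\<^sub>H ((c - d) *\<^sub>H x) = 0" by (simp add: hscale_simps)
  with * show False by (simp add: hscale_simps)
qed

section \<open>Symmetrizers, juxtaposition and Young diagrams\<close>

lemma subst_qint: "subst_q_inverse (qint s) = qint s"
proof -
  have "(inverse qv ^ s - qv ^ s) / (inverse qv - qv) = (qv ^ s - inverse qv ^ s) / (qv - inverse qv)"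
    by (metis minus_diff_eq minus_divide_divide)
  then show ?thesis by (simp add: qint_def subst_simps)
qed

lemma subst_qfact: "subst_q_inverse (qfact t) = qfact t"
  by (simp add: qfact_def subst_prod subst_qint)

text \<open>Quantum factorials are invariant under inverting q, the power of q in front is inverted,
  and the sign of (-q)^(-l) cancels against the sign (-1)^l that \<open>hbasis w\<close>
  acquires.\<close>

lemma hphi_e_minus: "hphi (e_minus K) = e_plus K"
proof -
  have 1: "subst_q_inverse (qv ^ n / qfact K) = qv powi (- int n) / qfact K" for n
    by (simp add: subst_simps subst_qfact power_int_minus power_inverse)
  have 2: "subst_q_inverse ((- qv) powi (- int l)) * (- 1) ^ l = qv ^ l" for l
    by (cases "even l") (simp_all add: subst_simps power_int_minus power_inverse)
  show ?thesis
    unfolding e_minus_def e_plus_def hphi_hscale hphi_sum 1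
    by (intro arg_cong[where f = "(*\<^sub>H) _"] sum.cong refl)
      (simp add: hphi_hbasis hscale_simps perm_length_ninv 2)
qed

lemma hphi_e_plus: "hphi (e_plus K) = e_minus K"
proof -
  have 1: "subst_q_inverse (qv powi (- int n) / qfact K) = qv ^ n / qfact K" for n
    by (simp add: subst_simps subst_qfact power_int_minus power_inverse)
  have 2: "subst_q_inverse (qv ^ l) * (- 1) ^ l = (- qv) powi (- int l)" for l
    by (cases "even l") (simp_all add: subst_simps power_int_minus power_inverse)
  show ?thesis
    unfolding e_minus_def e_plus_def hphi_hscale hphi_sum 1
    by (intro arg_cong[where f = "(*\<^sub>H) _"] sum.cong refl)
      (simp add: hphi_hbasis hscale_simps perm_length_ninv 2)
qed

text \<open>A permutation and its inverse have the same length, so the reversal merely permutes the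
  terms of the sum.\<close>

lemma hrev_e_minus: "hrev (e_minus K) = e_minus K"
proof -
  have "(\<Sum>w | w permutes {..<K}. (- qv) powi (- int (perm_length w)) *\<^sub>H hrev (hbasis w)) =
    (\<Sum>w | w permutes {..<K}. (- qv) powi (- int (perm_length w)) *\<^sub>H hbasis w)"
    by (rule sum.reindex_bij_witness[where i = inv and j = inv])
      (auto simp: permutes_inv permutes_inv_inv hrev_hbasis perm_length_ninv[where K = K] ninv_inv
        permutes_bij)
  then show ?thesis by (simp add: e_minus_def hrev_hscale hrev_sum)
qed

lemma hrev_hphi: "hrev (hphi x) = hphi (hrev x)"
proof (induction x rule: hecke_induct_left)
  case (gen i x)
  have "hrev (- y) = - hrev y" for y
    using hrev_simps(2)[of 0 y] by (simp add: hrev_simps)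
  with gen show ?case by (simp add: hrev_simps hphi_simps)
qed (simp_all add: hrev_simps hphi_simps)

lemma hrev_e_plus: "hrev (e_plus K) = e_plus K"
  by (metis hphi_e_minus hrev_e_minus hrev_hphi)

lemma e_minus_hecke_alg: "e_minus K \<in> hecke_alg K"
  unfolding e_minus_def by (auto intro!: hecke_alg_hscale hecke_alg_sum hbasis_hecke_alg)

lemma e_plus_hecke_alg: "e_plus K \<in> hecke_alg K"
  by (metis hphi_e_minus e_minus_hecke_alg hecke_alg_hphi)

lemma ninv_right_up:
  assumes "w permutes {..<K}" "w i < w (Suc i)"
  shows "ninv (w \<circ> adj i) = Suc (ninv w)"
proof -
  have b: "bij w" using assms(1) by (rule permutes_bij)
  have "inv (w \<circ> adj i) = adj i \<circ> inv w"
    using b by (simp add: o_inv_distrib)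
  moreover have "bij (w \<circ> adj i)" using b by (simp add: bij_comp)
  ultimately have "ninv (w \<circ> adj i) = ninv (adj i \<circ> inv w)"
    by (metis ninv_inv)
  also have "\<dots> = Suc (ninv (inv w))"
    using b assms finite_invs_permutes[OF permutes_inv[OF assms(1)]]
    by (intro ninv_up) (simp_all add: bij_imp_bij_inv inv_inv_eq)
  finally show ?thesis using b by (simp add: ninv_inv)
qed

text \<open>Groups the permutations into the cosets {w, w s_i}, each represented by its shorter
  element.\<close>

lemma sum_permutes_adj_split:
  fixes g :: "(nat \<Rightarrow> nat) \<Rightarrow> 'a::comm_monoid_add"
  assumes "Suc i < K"
  shows "(\<Sum>w | w permutes {..<K}. g w) =
    (\<Sum>w | w permutes {..<K} \<and> w i < w (Suc i). g w + g (w \<circ> adj i))"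
proof -
  let ?U = "{w. w permutes {..<K} \<and> w i < w (Suc i)}"
  let ?D = "{w. w permutes {..<K} \<and> w (Suc i) < w i}"
  note adj = adj_permutes[OF assms]
  have eq: "{w. w permutes {..<K}} = ?U \<union> ?D"
  proof (intro set_eqI iffI)
    fix w assume "w \<in> {w. w permutes {..<K}}"
    then have "w permutes {..<K}" by simp
    moreover from permutes_inj[OF this] have "w i \<noteq> w (Suc i)" by (simp add: inj_eq)
    ultimately show "w \<in> ?U \<union> ?D" by auto
  qed auto
  have "finite {w. w permutes {..<K}}" by (rule finite_permutations) simp
  then have fin: "finite ?U" "finite ?D" unfolding eq finite_Un by blast+
  have "(\<Sum>w | w permutes {..<K}. g w) = sum g (?U \<union> ?D)"
    by (rule arg_cong[OF eq])
  also have "\<dots> = sum g ?U + sum g ?D"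
    by (rule sum.union_disjoint[OF fin]) auto
  also have "sum g ?D = (\<Sum>w\<in>?U. g (w \<circ> adj i))"
    by (rule sum.reindex_bij_witness[where i = "\<lambda>w. w \<circ> adj i" and j = "\<lambda>w. w \<circ> adj i"])
      (auto intro: permutes_compose[OF adj] simp: comp_assoc)
  finally show ?thesis by (simp add: sum.distrib)
qed

text \<open>On each coset {w, w s_i} the two terms form a multiple of T - q^(-1) T H_i with T = H_w.
  By the quadratic relation this is an eigenvector of right multiplication by H_i with eigenvalue
  -q^(-1).\<close>

lemma e_minus_hgen:
  assumes "Suc i < K"
  shows "e_minus K * hgen i = (- inverse qv) *\<^sub>H e_minus K"
proof -
  let ?f = "\<lambda>w. (- qv) powi (- int (perm_length w)) *\<^sub>H hbasis w"
  note adj = adj_permutes[OF assms]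
  have "?f w * hgen i + ?f (w \<circ> adj i) * hgen i =
      (- inverse qv) *\<^sub>H ?f w + (- inverse qv) *\<^sub>H ?f (w \<circ> adj i)"
    if w: "w permutes {..<K}" "w i < w (Suc i)" for w
  proof -
    define c where "c = (- qv) powi (- int (ninv w))"
    define T where "T = hbasis w"
    have ws: "w \<circ> adj i permutes {..<K}" using permutes_compose[OF adj w(1)] .
    have 1: "?f w = c *\<^sub>H T"
      using w by (simp add: perm_length_ninv c_def T_def)
    have "(- qv) powi (- int (Suc (ninv w))) = c * (- inverse qv)"
      unfolding c_def power_int_minus power_int_of_nat power_Suc inverse_mult_distrib
      by (simp only: inverse_minus_eq mult.commute)
    then have 2: "?f (w \<circ> adj i) = (c * (- inverse qv)) *\<^sub>H (T * hgen i)"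
      using w ws by (simp add: perm_length_ninv[OF ws] ninv_right_up hbasis_right_up T_def)
    have 3: "T * hgen i * hgen i = (qv - inverse qv) *\<^sub>H (T * hgen i) + T"
      by (simp add: mult.assoc hgen_square distrib_left hscale_def hconst_left_commute)
    \<comment> \<open>The coefficient of T H_i: 1 - q^(-1) (q - q^(-1)) equals q^(-2).\<close>
    have "c + c * (- inverse qv) * (qv - inverse qv) = c * inverse qv * inverse qv"
      using qv_nonzero by (simp add: field_simps)
    then have "c *\<^sub>H (T * hgen i) + (c * (- inverse qv) * (qv - inverse qv)) *\<^sub>H (T * hgen i) =
        (c * inverse qv * inverse qv) *\<^sub>H (T * hgen i)"
      by (simp flip: hscale_add)
    then have key: "c *\<^sub>H (T * hgen i) + (c * (- inverse qv)) *\<^sub>H ((qv - inverse qv) *\<^sub>H (T * hgen i)) =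
        (- inverse qv) *\<^sub>H ((c * (- inverse qv)) *\<^sub>H (T * hgen i))"
      by (simp add: hscale_simps mult.commute mult.left_commute)
    have "?f w * hgen i + ?f (w \<circ> adj i) * hgen i =
        c *\<^sub>H (T * hgen i) + (c * (- inverse qv)) *\<^sub>H ((qv - inverse qv) *\<^sub>H (T * hgen i) + T)"
      unfolding 1 2 by (simp only: hscale_simps(4) 3)
    also have "\<dots> = (c *\<^sub>H (T * hgen i) + (c * (- inverse qv)) *\<^sub>H ((qv - inverse qv) *\<^sub>H (T * hgen i))) +
        (c * (- inverse qv)) *\<^sub>H T"
      by (simp only: hscale_simps(2) add.assoc)
    also have "(c * (- inverse qv)) *\<^sub>H T = (- inverse qv) *\<^sub>H (c *\<^sub>H T)"
      by (simp only: hscale_simps(1) mult.commute)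
    finally show ?thesis
      unfolding key 1 2 by (simp only: add.commute)
  qed
  then have "(\<Sum>w | w permutes {..<K}. ?f w * hgen i) =
      (\<Sum>w | w permutes {..<K}. (- inverse qv) *\<^sub>H ?f w)"
    unfolding sum_permutes_adj_split[OF assms] by (intro sum.cong refl) blast
  then have "(\<Sum>w | w permutes {..<K}. ?f w) * hgen i =
      (- inverse qv) *\<^sub>H (\<Sum>w | w permutes {..<K}. ?f w)"
    by (simp add: sum_distrib_right hscale_sum)
  then show ?thesis
    by (simp add: e_minus_def hscale_simps mult.commute)
qed

subsection \<open>Juxtaposition\<close>

lemma juxtapose_append:
  "juxtapose (xs @ ys) = juxtapose xs * hshift (sum_list (map fst xs)) (juxtapose ys)"
  by (induction xs rule: juxtapose.induct)
    (simp_all add: hshift_0 hshift_simps hshift_hshift mult.assoc)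

lemma hphi_juxtapose: "hphi (juxtapose xs) = juxtapose (map (\<lambda>(k, x). (k, hphi x)) xs)"
  by (induction xs rule: juxtapose.induct) (simp_all add: hphi_simps hphi_hshift)

lemma juxtapose_hecke_alg:
  "(\<And>k x. (k, x) \<in> set xs \<Longrightarrow> x \<in> hecke_alg k) \<Longrightarrow> juxtapose xs \<in> hecke_alg (sum_list (map fst xs))"
proof (induction xs rule: juxtapose.induct)
  case (2 k x xs)
  have "x \<in> hecke_alg (k + sum_list (map fst xs))"
    by (rule hecke_alg_mono[of _ k]) (use 2 in auto)
  moreover have "hshift k (juxtapose xs) \<in> hecke_alg (k + sum_list (map fst xs))"
    using 2 by (intro hecke_alg_hshift) auto
  ultimately show ?case by (auto intro: hecke_alg.mult)
qed (simp add: hecke_alg_1)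

text \<open>An anti-automorphism reverses the order of the factors. The order is restored because
  each block lies in its own \<open>hecke_alg k\<close> and thus commutes with everything shifted
  past it.\<close>

lemma hrev_juxtapose:
  "(\<And>k x. (k, x) \<in> set xs \<Longrightarrow> x \<in> hecke_alg k) \<Longrightarrow>
    hrev (juxtapose xs) = juxtapose (map (\<lambda>(k, x). (k, hrev x)) xs)"
proof (induction xs rule: juxtapose.induct)
  case (2 k x xs)
  have "hrev x \<in> hecke_alg k" using 2 by (auto intro: hecke_alg_hrev)
  with 2 show ?case
    by (simp add: hrev_simps hrev_hshift hecke_alg_commute_hshift)
qed (simp add: hrev_simps)

text \<open>The generator passes the blocks to the right of its own, which are shifted beyond its
  strands, and then meets x.\<close>

lemma juxtapose_block_hgen:
  assumes "x * hgen i = c *\<^sub>H x" "Suc i < k"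
  shows "juxtapose (us @ (k, x) # vs) * hgen (sum_list (map fst us) + i) =
    c *\<^sub>H juxtapose (us @ (k, x) # vs)"
proof -
  have "hshift k (juxtapose vs) * hgen i = hgen i * hshift k (juxtapose vs)"
    by (rule hecke_alg_commute_hshift) (rule hecke_alg.gen[OF assms(2)])
  then have "x * hshift k (juxtapose vs) * hgen i = c *\<^sub>H (x * hshift k (juxtapose vs))"
    by (simp add: mult.assoc) (simp add: assms hscale_simps flip: mult.assoc)
  from arg_cong[OF this, of "\<lambda>y. juxtapose us * hshift (sum_list (map fst us)) y"]
  show ?thesis
    by (simp add: juxtapose_append hshift_simps hshift_hscale hscale_simps mult.assoc)
qed

subsection \<open>Young diagrams\<close>

lemma young_down_closed:
  "young_diagram D \<Longrightarrow> (i, j) \<in> D \<Longrightarrow> i' \<le> i \<Longrightarrow> j' \<le> j \<Longrightarrow> (i', j') \<in> D"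
  unfolding young_diagram_def by blast

lemma transpose_mem: "(i, j) \<in> diagram_transpose D \<longleftrightarrow> (j, i) \<in> D"
  by (auto simp: diagram_transpose_def)

lemma transpose_image: "diagram_transpose D = prod.swap ` D"
  by (force simp: diagram_transpose_def)

lemma transpose_transpose: "diagram_transpose (diagram_transpose D) = D"
  by (auto simp: transpose_mem)

lemma card_transpose: "card (diagram_transpose D) = card D"
  by (simp add: transpose_image card_image)

lemma young_transpose: "young_diagram D \<Longrightarrow> young_diagram (diagram_transpose D)"
  by (auto simp: young_diagram_def transpose_mem) (simp add: transpose_image)

lemma row_len_transpose: "row_len (diagram_transpose D) = col_len D"
  by (simp add: row_len_def col_len_def transpose_mem fun_eq_iff)

lemma col_len_transpose: "col_len (diagram_transpose D) = row_len D"
  by (simp add: row_len_def col_len_def transpose_mem fun_eq_iff)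

lemma down_closed_eq_lessThan:
  fixes S :: "nat set"
  assumes "finite S" "\<And>x y. x \<in> S \<Longrightarrow> y \<le> x \<Longrightarrow> y \<in> S"
  shows "S = {..<card S}"
proof -
  have "S = {..<n}" if "\<forall>x. x \<in> S \<longleftrightarrow> x < n" for n using that by auto
  moreover have "\<exists>n. \<forall>x. x \<in> S \<longleftrightarrow> x < n"
  proof (cases "S = {}")
    case False
    then have "Max S \<in> S" using assms(1) by simp
    then have "x \<in> S \<longleftrightarrow> x < Suc (Max S)" for x
      using assms(2)[of "Max S" x] Max_ge[OF assms(1), of x] by (auto simp: less_Suc_eq_le)
    then show ?thesis by blast
  qed auto
  ultimately show ?thesis by (metis card_lessThan)
qed

lemma young_row: "young_diagram D \<Longrightarrow> (i, j) \<in> D \<longleftrightarrow> j < row_len D i"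
proof -
  assume D: "young_diagram D"
  have "{j. (i, j) \<in> D} = snd ` (D \<inter> {i} \<times> UNIV)" by force
  then have "finite {j. (i, j) \<in> D}"
    using D by (simp add: young_diagram_def)
  then have "{j. (i, j) \<in> D} = {..<row_len D i}"
    unfolding row_len_def
    by (rule down_closed_eq_lessThan) (use D in \<open>unfold young_diagram_def, blast\<close>)
  from arg_cong[OF this, of "\<lambda>S. j \<in> S"] show ?thesis by simp
qed

lemma young_col: "young_diagram D \<Longrightarrow> (i, j) \<in> D \<longleftrightarrow> i < col_len D j"
  using young_row[OF young_transpose, of D j i] by (simp add: transpose_mem row_len_transpose)

lemma bij_betw_flatten:
  fixes f :: "nat \<Rightarrow> nat"
  shows "bij_betw (\<lambda>(i, j). (\<Sum>i'<i. f i') + j) (Sigma {..<r} (\<lambda>i. {..<f i})) {..<\<Sum>i<r. f i}"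
proof (induction r)
  case (Suc r)
  have "bij_betw (\<lambda>(i, j). (\<Sum>i'<i. f i') + j) ({r} \<times> {..<f r})
      {\<Sum>i<r. f i..<(\<Sum>i<r. f i) + f r}"
    by (rule bij_betw_byWitness[where f' = "\<lambda>m. (r, m - (\<Sum>i<r. f i))"]) auto
  from bij_betw_combine[OF Suc this] have "bij_betw (\<lambda>(i, j). (\<Sum>i'<i. f i') + j)
      (Sigma {..<r} (\<lambda>i. {..<f i}) \<union> {r} \<times> {..<f r})
      ({..<\<Sum>i<r. f i} \<union> {\<Sum>i<r. f i..<(\<Sum>i<r. f i) + f r})"
    by fastforce
  moreover have "Sigma {..<r} (\<lambda>i. {..<f i}) \<union> {r} \<times> {..<f r} = Sigma {..<Suc r} (\<lambda>i. {..<f i})"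
    by (auto simp: less_Suc_eq)
  moreover have "{..<\<Sum>i<r. f i} \<union> {\<Sum>i<r. f i..<(\<Sum>i<r. f i) + f r} = {..<\<Sum>i<Suc r. f i}"
    by auto
  ultimately show ?case by simp
qed (simp add: bij_betw_def)

lemma young_Sigma:
  assumes "young_diagram D"
  shows "D = Sigma {..<col_len D 0} (\<lambda>i. {..<row_len D i})"
proof -
  have "i < col_len D 0" if "(i, j) \<in> D" for i j
  proof -
    have "(i, 0) \<in> D" using young_down_closed[OF assms that] by simp
    then show ?thesis by (simp add: young_col[OF assms])
  qed
  then have "(i, j) \<in> D \<longleftrightarrow> i < col_len D 0 \<and> j < row_len D i" for i j
    using young_row[OF assms, of i j] by blast
  then show ?thesis by auto
qed

lemma card_young: "young_diagram D \<Longrightarrow> card D = (\<Sum>i<col_len D 0. row_len D i)"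
  using arg_cong[OF young_Sigma, of D card] by simp

lemma card_young_col: "young_diagram D \<Longrightarrow> card D = (\<Sum>j<row_len D 0. col_len D j)"
  using card_young[OF young_transpose, of D]
  by (simp add: card_transpose row_len_transpose col_len_transpose)

lemma bij_row_tableau:
  assumes "young_diagram D"
  shows "bij_betw (row_tableau D) D {..<card D}"
  using bij_betw_flatten[of "row_len D" "col_len D 0"]
  unfolding young_Sigma[OF assms, symmetric] card_young[OF assms, symmetric] row_tableau_def .

lemma col_tableau_eq: "col_tableau D = row_tableau (diagram_transpose D) \<circ> prod.swap"
  by (auto simp: col_tableau_def row_tableau_def row_len_transpose fun_eq_iff)

lemma row_tableau_eq: "row_tableau D = col_tableau (diagram_transpose D) \<circ> prod.swap"
  by (auto simp: col_tableau_def row_tableau_def col_len_transpose fun_eq_iff)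

lemma bij_swap: "bij_betw prod.swap D (diagram_transpose D)"
  by (simp add: bij_betw_def transpose_image)

lemma bij_col_tableau: "young_diagram D \<Longrightarrow> bij_betw (col_tableau D) D {..<card D}"
  using bij_betw_trans[OF bij_swap bij_row_tableau[OF young_transpose]]
  by (simp add: col_tableau_eq card_transpose)

lemma diagram_perm_row_tableau:
  assumes "young_diagram D" "b \<in> D"
  shows "diagram_perm D (row_tableau D b) = col_tableau D b"
proof -
  have "row_tableau D b < card D"
    using bij_row_tableau[OF assms(1)] assms(2) by (auto simp: bij_betw_def)
  moreover have "inv_into D (row_tableau D) (row_tableau D b) = b"
    using bij_row_tableau[OF assms(1)] assms(2) by (auto simp: bij_betw_def)
  ultimately show ?thesis by (simp add: diagram_perm_def)
qed

lemma diagram_perm_permutes: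
  assumes "young_diagram D"
  shows "diagram_perm D permutes {..<card D}"
proof (rule bij_imp_permutes)
  have "bij_betw (col_tableau D \<circ> inv_into D (row_tableau D)) {..<card D} {..<card D}"
    by (rule bij_betw_trans[OF bij_betw_inv_into[OF bij_row_tableau[OF assms]] bij_col_tableau[OF assms]])
  then show "bij_betw (diagram_perm D) {..<card D} {..<card D}"
    by (subst bij_betw_cong[where g = "col_tableau D \<circ> inv_into D (row_tableau D)"])
      (auto simp: diagram_perm_def)
qed (simp add: diagram_perm_def)

lemma permutes_eq_diagram_perm:
  assumes "young_diagram D" "v permutes {..<card D}" "\<And>b. b \<in> D \<Longrightarrow> v (row_tableau D b) = col_tableau D b"
  shows "v = diagram_perm D"
proof
  fix m
  show "v m = diagram_perm D m"
  proof (cases "m < card D")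
    case True
    then obtain b where "b \<in> D" "m = row_tableau D b"
      using bij_betw_imp_surj_on[OF bij_row_tableau[OF assms(1)]] by blast
    then show ?thesis using assms by (simp add: diagram_perm_row_tableau)
  next
    case False
    then show ?thesis using assms(2) by (simp add: diagram_perm_def permutes_not_in)
  qed
qed

text \<open>Reflection in the diagonal exchanges reading by rows with reading by columns, so every
  strand is traversed backwards.\<close>

lemma diagram_perm_transpose:
  assumes "young_diagram D"
  shows "diagram_perm (diagram_transpose D) = inv (diagram_perm D)"
proof -
  have "inv (diagram_perm D) = diagram_perm (diagram_transpose D)"
  proof (rule permutes_eq_diagram_perm)
    show "young_diagram (diagram_transpose D)" using assms by (rule young_transpose)
    show "inv (diagram_perm D) permutes {..<card (diagram_transpose D)}"
      using diagram_perm_permutes[OF assms] by (simp add: card_transpose permutes_inv)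
    fix b assume b: "b \<in> diagram_transpose D"
    obtain i j where [simp]: "b = (i, j)" by (cases b)
    have "(j, i) \<in> D" using b by (simp add: transpose_mem)
    from diagram_perm_row_tableau[OF assms this]
    have "diagram_perm D (col_tableau (diagram_transpose D) b) = row_tableau (diagram_transpose D) b"
      by (simp add: row_tableau_eq[of D] col_tableau_eq[of D])
    then show "inv (diagram_perm D) (row_tableau (diagram_transpose D) b) =
        col_tableau (diagram_transpose D) b"
      using permutes_bij[OF diagram_perm_permutes[OF assms]] by (metis bij_inv_eq_iff)
  qed
  then show ?thesis by simp
qed

lemma hphi_e_col: "hphi (e_col D) = e_row (diagram_transpose D)"
  by (simp add: e_col_def e_row_def hphi_juxtapose hphi_e_minus row_len_transpose col_len_transpose comp_def)

lemma hphi_e_row: "hphi (e_row D) = e_col (diagram_transpose D)"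
  by (simp add: e_col_def e_row_def hphi_juxtapose hphi_e_plus row_len_transpose col_len_transpose comp_def)

lemma hrev_e_col: "hrev (e_col D) = e_col D"
  unfolding e_col_def
  by (subst hrev_juxtapose) (auto simp: e_minus_hecke_alg hrev_e_minus comp_def)

lemma hrev_e_row: "hrev (e_row D) = e_row D"
  unfolding e_row_def
  by (subst hrev_juxtapose) (auto simp: e_plus_hecke_alg hrev_e_plus comp_def)

lemma e_col_hecke_alg:
  assumes "young_diagram D"
  shows "e_col D \<in> hecke_alg (card D)"
proof -
  let ?xs = "map (\<lambda>j. (col_len D j, e_minus (col_len D j))) [0..<row_len D 0]"
  have "juxtapose ?xs \<in> hecke_alg (sum_list (map fst ?xs))"
    by (rule juxtapose_hecke_alg) (auto simp: e_minus_hecke_alg)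
  also have "sum_list (map fst ?xs) = card D"
    by (simp add: card_young_col[OF assms] comp_def interv_sum_list_conv_sum_set_nat atLeast0LessThan)
  finally show ?thesis by (simp add: e_col_def)
qed

lemma e_row_hecke_alg: "young_diagram D \<Longrightarrow> e_row D \<in> hecke_alg (card D)"
  using hecke_alg_hphi[OF e_col_hecke_alg[OF young_transpose]]
  by (simp add: hphi_e_col transpose_transpose card_transpose)

text \<open>The nodes (i, j) and (i + 1, j) occupy neighbouring positions within the block of column
  j, and there the antisymmetrizer absorbs the generator.\<close>

lemma e_col_hgen:
  assumes "young_diagram D" "(Suc i, j) \<in> D"
  shows "e_col D * hgen (col_tableau D (i, j)) = (- inverse qv) *\<^sub>H e_col D"
proof -
  have "(0, j) \<in> D" using young_down_closed[OF assms] by simp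
  then have j: "j < row_len D 0" by (simp add: young_row[OF assms(1)])
  then have "[0..<row_len D 0] = [0..<j] @ j # [Suc j..<row_len D 0]"
    by (metis le0 less_imp_le upt_add_eq_append upt_conv_Cons le_add_diff_inverse)
  moreover have i: "Suc i < col_len D j" using assms by (simp add: young_col)
  note juxtapose_block_hgen[OF e_minus_hgen[OF i] i,
      of "map (\<lambda>j. (col_len D j, e_minus (col_len D j))) [0..<j]"
         "map (\<lambda>j. (col_len D j, e_minus (col_len D j))) [Suc j..<row_len D 0]"]
  ultimately show ?thesis
    by (simp add: e_col_def col_tableau_def comp_def interv_sum_list_conv_sum_set_nat atLeast0LessThan)
qed

text \<open>The column rule for the transposed diagram, carried over by \<open>hphi\<close>, which
  turns -q^(-1) into -q and negates the generator, and then by \<open>hrev\<close>, which moves the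
  generator to the left.\<close>

lemma hgen_e_row:
  assumes "young_diagram D" "(i, Suc j) \<in> D"
  shows "hgen (row_tableau D (i, j)) * e_row D = qv *\<^sub>H e_row D"
proof -
  have "(Suc j, i) \<in> diagram_transpose D" using assms by (simp add: transpose_mem)
  from arg_cong[OF e_col_hgen[OF young_transpose[OF assms(1)] this], of hphi]
  have "- (e_row D * hgen (row_tableau D (i, j))) = - (qv *\<^sub>H e_row D)"
    by (simp add: hphi_simps hphi_hscale hphi_e_col transpose_transpose subst_simps
        row_tableau_eq[of D] hscale_minus_left hphi_uminus)
  from arg_cong[OF this, of "\<lambda>x. hrev (- x)"] show ?thesis
    by (simp add: hrev_simps hrev_hscale hrev_e_row)
qed

section \<open>The sandwich property of Young symmetrizers\<close>

lemma row_tableau_Suc: "row_tableau D (i, Suc j) = Suc (row_tableau D (i, j))"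
  by (simp add: row_tableau_def)

lemma col_tableau_Suc: "col_tableau D (Suc i, j) = Suc (col_tableau D (i, j))"
  by (simp add: col_tableau_def)

lemma row_tableau_less:
  assumes "young_diagram D" "b' \<in> D" "row_tableau D b < row_tableau D b'"
  shows "fst b \<le> fst b'"
proof (rule ccontr)
  obtain i j i' j' where [simp]: "b = (i, j)" "b' = (i', j')" by (cases b; cases b')
  assume "\<not> fst b \<le> fst b'"
  then have "i' < i" by simp
  have "j' < row_len D i'" using assms(1,2) by (simp add: young_row)
  then have "row_tableau D b' < (\<Sum>k<Suc i'. row_len D k)"
    by (simp add: row_tableau_def)
  also have "\<dots> \<le> (\<Sum>k<i. row_len D k)"
    using \<open>i' < i\<close> by (intro sum_mono2) auto
  also have "\<dots> \<le> row_tableau D b" by (simp add: row_tableau_def)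
  finally show False using assms(3) by simp
qed

lemma col_tableau_less:
  assumes "young_diagram D" "b' \<in> D" "col_tableau D b < col_tableau D b'"
  shows "snd b \<le> snd b'"
  using row_tableau_less[OF young_transpose[OF assms(1)], of "prod.swap b'" "prod.swap b"] assms(2,3)
  by (cases b; cases b') (simp add: col_tableau_eq transpose_mem)

lemma adj_chain_less:
  fixes f :: "nat \<Rightarrow> nat"
  assumes "\<And>k. k < n \<Longrightarrow> f k < f (Suc k)" "j < j'" "j' \<le> n"
  shows "f j < f j'"
  using assms(2,3)
proof (induction j')
  case (Suc j')
  then show ?case
    using assms(1)[of j'] by (cases "j = j'") (auto intro: less_trans)
qed simp

lemma chain_ge_index:
  fixes f :: "nat \<Rightarrow> nat"
  assumes "\<And>k. k < n \<Longrightarrow> f k < f (Suc k)"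
  shows "n \<le> f n"
  using assms by (induction n) (auto, metis Suc_leI le_less_trans less_SucI lessI)

text \<open>The column index of the image of a node is at least its own column index, and both have the same
  sum over the diagram; likewise for the inverse and the row indices.\<close>

lemma diagram_perm_unique:
  assumes D: "young_diagram D" and v: "v permutes {..<card D}"
    and row: "\<And>i j. (i, Suc j) \<in> D \<Longrightarrow> v (row_tableau D (i, j)) < v (row_tableau D (i, Suc j))"
    and col: "\<And>i j. (Suc i, j) \<in> D \<Longrightarrow> inv v (col_tableau D (i, j)) < inv v (col_tableau D (Suc i, j))"
    and sep: "\<And>i j k r r'. (i, Suc j) \<in> D \<Longrightarrow> (r, k) \<in> D \<Longrightarrow> (r', k) \<in> D \<Longrightarrow>
      v (row_tableau D (i, j)) = col_tableau D (r, k) \<Longrightarrow>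
      v (row_tableau D (i, Suc j)) = col_tableau D (r', k) \<Longrightarrow> False"
  shows "v = diagram_perm D"
proof -
  let ?rt = "row_tableau D" and ?ct = "col_tableau D"
  note rt = bij_row_tableau[OF D] and ct = bij_col_tableau[OF D]
  have v': "bij_betw v {..<card D} {..<card D}" using v by (rule permutes_imp_bij)
  have fin: "finite D" using D by (simp add: young_diagram_def)
  \<comment> \<open>Both maps permute the nodes: \<open>s\<close> follows a strand from its node in
    the row reading at the bottom to its node in the column reading at the top, and \<open>t\<close>
    goes back. The claim amounts to both being the identity.\<close>
  define s where "s = inv_into D ?ct \<circ> (v \<circ> ?rt)"
  define t where "t = inv_into D ?rt \<circ> (inv v \<circ> ?ct)"
  have iv': "bij_betw (inv v) {..<card D} {..<card D}"
    using permutes_inv[OF v] by (rule permutes_imp_bij)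
  have s: "bij_betw s D D"
    unfolding s_def by (rule bij_betw_trans[OF bij_betw_trans[OF rt v'] bij_betw_inv_into[OF ct]])
  have t: "bij_betw t D D"
    unfolding t_def by (rule bij_betw_trans[OF bij_betw_trans[OF ct iv'] bij_betw_inv_into[OF rt]])
  have sD: "s b \<in> D" and tD: "t b \<in> D" if "b \<in> D" for b
    using s t that by (auto simp: bij_betw_def)
  have ct_s: "?ct (s b) = v (?rt b)" if "b \<in> D" for b
    unfolding s_def o_apply
    by (rule bij_betw_inv_into_right[OF ct]) (use bij_betwE[OF bij_betw_trans[OF rt v']] that in auto)
  have rt_t: "?rt (t b) = inv v (?ct b)" if "b \<in> D" for b
    unfolding t_def o_apply
    by (rule bij_betw_inv_into_right[OF rt]) (use bij_betwE[OF bij_betw_trans[OF ct iv']] that in auto)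
  note closed = young_down_closed[OF D]
  have "snd b \<le> snd (s b)" if b: "b \<in> D" for b
  proof -
    obtain i j where [simp]: "b = (i, j)" by (cases b)
    have "j \<le> snd (s (i, j))"
    proof (rule chain_ge_index)
      fix k assume "k < j"
      then have k: "(i, Suc k) \<in> D" "(i, k) \<in> D" using b by (auto intro: closed)
      have "?ct (s (i, k)) < ?ct (s (i, Suc k))"
        using row[OF k(1)] by (simp add: ct_s k)
      then have "snd (s (i, k)) \<le> snd (s (i, Suc k))"
        by (rule col_tableau_less[OF D sD[OF k(1)]])
      \<comment> \<open>Equality would put two neighbours of a row into one column, which
        \<open>sep\<close> forbids. So column indices strictly increase along the image of a
        row.\<close>
      moreover have "snd (s (i, k)) \<noteq> snd (s (i, Suc k))"
      proof
        assume eq: "snd (s (i, k)) = snd (s (i, Suc k))"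
        obtain r c r' c' where rc: "s (i, k) = (r, c)" "s (i, Suc k) = (r', c')"
          by (cases "s (i, k)"; cases "s (i, Suc k)")
        with eq have "c = c'" by simp
        then show False
          using sep[OF k(1), of r c r'] sD[OF k(1)] sD[OF k(2)] ct_s[OF k(1)] ct_s[OF k(2)] rc
          by simp
      qed
      ultimately show "snd (s (i, k)) < snd (s (i, Suc k))" by simp
    qed
    then show ?thesis by simp
  qed
  moreover have "(\<Sum>b\<in>D. snd b) = (\<Sum>b\<in>D. snd (s b))"
    using sum.reindex_bij_betw[OF s, of snd] by simp
  ultimately have snd_s: "snd b = snd (s b)" if "b \<in> D" for b
    using sum_mono_inv[of snd D "\<lambda>b. snd (s b)"] that fin by blast
  have s_t: "s (t b) = b" if "b \<in> D" for b
  proof -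
    have "?ct (s (t b)) = ?ct b"
      using v by (simp add: ct_s tD that rt_t permutes_inverses)
    then show ?thesis
      using bij_betw_imp_inj_on[OF ct] sD[OF tD[OF that]] that by (simp add: inj_on_eq_iff)
  qed
  have snd_t: "snd (t b) = snd b" if "b \<in> D" for b
    using snd_s[OF tD[OF that]] s_t[OF that] by simp
  have "fst b \<le> fst (t b)" if b: "b \<in> D" for b
  proof -
    obtain i j where [simp]: "b = (i, j)" by (cases b)
    have "i \<le> fst (t (i, j))"
    proof (rule chain_ge_index[where f = "\<lambda>i. fst (t (i, j))"])
      fix k assume "k < i"
      then have k: "(Suc k, j) \<in> D" "(k, j) \<in> D" using b by (auto intro: closed)
      have less: "?rt (t (k, j)) < ?rt (t (Suc k, j))"
        using col[OF k(1)] by (simp add: rt_t k)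
      then have "fst (t (k, j)) \<le> fst (t (Suc k, j))"
        by (rule row_tableau_less[OF D tD[OF k(1)]])
      \<comment> \<open>By now \<open>t\<close> is known to preserve columns, so equal row indices
        would give two nodes the same image.\<close>
      moreover have "fst (t (k, j)) \<noteq> fst (t (Suc k, j))"
      proof
        assume "fst (t (k, j)) = fst (t (Suc k, j))"
        then have "t (k, j) = t (Suc k, j)"
          using snd_t[OF k(1)] snd_t[OF k(2)] by (simp add: prod_eq_iff)
        with less show False by simp
      qed
      ultimately show "fst (t (k, j)) < fst (t (Suc k, j))" by simp
    qed
    then show ?thesis by simp
  qed
  moreover have "(\<Sum>b\<in>D. fst b) = (\<Sum>b\<in>D. fst (t b))"
    using sum.reindex_bij_betw[OF t, of fst] by simp
  ultimately have "fst b = fst (t b)" if "b \<in> D" for b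
    using sum_mono_inv[of fst D "\<lambda>b. fst (t b)"] that fin by blast
  then have "t b = b" if "b \<in> D" for b
    using snd_t that by (simp add: prod_eq_iff)
  then have "v (?rt b) = ?ct b" if "b \<in> D" for b
    using rt_t[OF that] that v by (metis permutes_inverses(1))
  then show ?thesis by (intro permutes_eq_diagram_perm[OF D v])
qed

text \<open>Induction on the length of v. An inversion between neighbours of a row is absorbed by
  \<open>e_row\<close>, one between neighbours of a column by \<open>e_col\<close>, each leaving a
  scalar and a shorter permutation. If there is none, then by \<open>diagram_perm_unique\<close>
  either v is \<open>diagram_perm D\<close> or v sends two neighbours of a row into one column. In
  the latter case the same generator acts by q through \<open>e_row\<close> and by -q^(-1) through
  \<open>e_col\<close>, so the product vanishes.\<close>

lemma e_col_hbasis_e_row: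
  assumes D: "young_diagram D" and v: "v permutes {..<card D}"
  shows "\<exists>c. e_col D * hbasis v * e_row D = c *\<^sub>H (e_col D * hbasis (diagram_perm D) * e_row D)"
  using v
proof (induction "ninv v" arbitrary: v rule: less_induct)
  case less
  note v = less.prems
  let ?rt = "row_tableau D" and ?ct = "col_tableau D"
  let ?z = "e_col D * hbasis (diagram_perm D) * e_row D"
  have rtK: "?rt b < card D" if "b \<in> D" for b
    using that bij_row_tableau[OF D] by (auto simp: bij_betw_def)
  note closed = young_down_closed[OF D]
  consider (row) i j where "(i, Suc j) \<in> D" "v (?rt (i, Suc j)) < v (?rt (i, j))"
    | (col) i j where "(Suc i, j) \<in> D" "inv v (?ct (Suc i, j)) < inv v (?ct (i, j))"
    | (eq) "v = diagram_perm D"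
    | (coll) i j k r r' where "(i, Suc j) \<in> D" "(r, k) \<in> D" "(r', k) \<in> D"
        "v (?rt (i, j)) = ?ct (r, k)" "v (?rt (i, Suc j)) = ?ct (r', k)"
        "v (?rt (i, j)) < v (?rt (i, Suc j))"
        "\<And>i j. (Suc i, j) \<in> D \<Longrightarrow> inv v (?ct (i, j)) < inv v (?ct (Suc i, j))"
  proof (cases "\<exists>i j. (i, Suc j) \<in> D \<and> v (?rt (i, Suc j)) < v (?rt (i, j)) \<or>
      (Suc i, j) \<in> D \<and> inv v (?ct (Suc i, j)) < inv v (?ct (i, j))")
    case True
    then show ?thesis using that(1,2) by blast
  next
    case False
    have row: "v (?rt (i, j)) < v (?rt (i, Suc j))" if "(i, Suc j) \<in> D" for i j
    proof -
      have "v (?rt (i, j)) \<noteq> v (?rt (i, Suc j))"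
        using permutes_inj[OF v] by (simp add: inj_eq row_tableau_Suc)
      moreover have "\<not> v (?rt (i, Suc j)) < v (?rt (i, j))" using False that by blast
      ultimately show ?thesis by simp
    qed
    have col: "inv v (?ct (i, j)) < inv v (?ct (Suc i, j))" if "(Suc i, j) \<in> D" for i j
    proof -
      have "inv v (?ct (i, j)) \<noteq> inv v (?ct (Suc i, j))"
        using permutes_inj[OF permutes_inv[OF v]] by (simp add: inj_eq col_tableau_Suc)
      moreover have "\<not> inv v (?ct (Suc i, j)) < inv v (?ct (i, j))" using False that by blast
      ultimately show ?thesis by simp
    qed
    show ?thesis
    proof (cases "v = diagram_perm D")
      case True
      then show ?thesis by (rule that(3))
    next
      case False
      then have "\<exists>i j k r r'. (i, Suc j) \<in> D \<and> (r, k) \<in> D \<and> (r', k) \<in> D \<and>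
          v (?rt (i, j)) = ?ct (r, k) \<and> v (?rt (i, Suc j)) = ?ct (r', k)"
        using diagram_perm_unique[OF D v row col] by blast
      then show ?thesis using that(4) row col by blast
    qed
  qed
  then show ?case
  proof cases
    case row
    define a where "a = ?rt (i, j)"
    have a: "?rt (i, Suc j) = Suc a" by (simp add: a_def row_tableau_Suc)
    define v' where "v' = v \<circ> adj a"
    have v': "v' permutes {..<card D}"
      unfolding v'_def using rtK[OF row(1)] a v by (intro permutes_compose adj_permutes) auto
    have up: "v' a < v' (Suc a)" using row(2) by (simp add: v'_def a flip: a_def)
    have "v' \<circ> adj a = v" by (simp add: v'_def comp_assoc)
    then have "ninv v = Suc (ninv v')" "hbasis v = hbasis v' * hgen a"
      using ninv_right_up[OF v' up] hbasis_right_up[OF v' up] by simp_all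
    with less.hyps[OF _ v'] obtain c where "e_col D * hbasis v' * e_row D = c *\<^sub>H ?z" by auto
    moreover have "e_col D * hbasis v * e_row D = qv *\<^sub>H (e_col D * hbasis v' * e_row D)"
      using hgen_e_row[OF D row(1)] \<open>hbasis v = hbasis v' * hgen a\<close>
      by (simp add: mult.assoc hscale_simps flip: a_def)
    ultimately show ?thesis by (auto simp: hscale_simps)
  next
    case col
    define a where "a = ?ct (i, j)"
    have a: "?ct (Suc i, j) = Suc a" by (simp add: a_def col_tableau_Suc)
    have d: "inv v (Suc a) < inv v a" using col(2) a by (simp add: a_def)
    define v' where "v' = adj a \<circ> v"
    have v': "v' permutes {..<card D}" unfolding v'_def using permutes_adj(2)[OF v d] .
    have "ninv v = Suc (ninv v')" "hbasis v = hgen a * hbasis v'"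
      unfolding v'_def using ninv_down[OF permutes_bij[OF v] finite_invs_permutes[OF v] d] hbasis_down[OF v d]
      by simp_all
    with less.hyps[OF _ v'] obtain c where "e_col D * hbasis v' * e_row D = c *\<^sub>H ?z" by auto
    moreover have "e_col D * hbasis v * e_row D = (e_col D * hgen a) * hbasis v' * e_row D"
      by (simp add: \<open>hbasis v = hgen a * hbasis v'\<close> mult.assoc)
    then have "e_col D * hbasis v * e_row D = (- inverse qv) *\<^sub>H (e_col D * hbasis v' * e_row D)"
      using e_col_hgen[OF D col(1)] by (simp add: hscale_simps flip: a_def)
    ultimately show ?thesis by (auto simp: hscale_simps)
  next
    case eq
    then show ?thesis by (auto intro: exI[of _ 1] simp: hscale_simps)
  next
    case coll
    define a where "a = ?rt (i, j)"
    define y where "y = ?ct (r, k)"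
    have a: "?rt (i, Suc j) = Suc a" by (simp add: a_def row_tableau_Suc)
    have "r < r'" using coll(4-6) by (simp add: col_tableau_def)
    then have rk: "(Suc r, k) \<in> D" using closed[OF coll(3)] by simp
    have iv: "inv v (v x) = x" for x using v by (simp add: permutes_inverses)
    have "inv v (?ct (r, k)) < inv v (?ct (Suc r, k))" by (rule coll(7)[OF rk])
    moreover have "inv v (?ct (Suc r, k)) \<le> inv v (?ct (r', k))"
    proof (cases "Suc r = r'")
      case False
      with \<open>r < r'\<close> have "Suc r < r'" by simp
      from adj_chain_less[where f = "\<lambda>r. inv v (?ct (r, k))", OF _ this order_refl]
      have "inv v (?ct (Suc r, k)) < inv v (?ct (r', k))"
        using coll(7) closed[OF coll(3)] by simp
      then show ?thesis by simp
    qed simp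
    \<comment> \<open>This preimage is larger than a and at most Suc a. So v takes the neighbouring
      positions a, Suc a to the neighbouring positions y, Suc y.\<close>
    ultimately have "inv v (?ct (Suc r, k)) = Suc a"
      by (simp flip: coll(4,5) add: iv a flip: a_def)
    then have va: "v (Suc a) = Suc y" "v a = y"
      using coll(4) v by (metis col_tableau_Suc permutes_inverses(1) y_def, simp add: a_def y_def)
    have comm: "v \<circ> adj a = adj y \<circ> v"
    proof
      fix x
      consider "x = a" | "x = Suc a" | "x \<noteq> a" "x \<noteq> Suc a" by blast
      then show "(v \<circ> adj a) x = (adj y \<circ> v) x"
      proof cases
        case 3
        then have "v x \<noteq> y" "v x \<noteq> Suc y"
          using permutes_inj[OF v] va by (metis injD)+
        with 3 show ?thesis by simp
      qed (simp_all add: va)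
    qed
    \<comment> \<open>Both products lengthen v, and to the same permutation.\<close>
    have "hbasis v * hgen a = hgen y * hbasis v"
    proof -
      have "hbasis v * hgen a = hbasis (v \<circ> adj a)"
        by (rule hbasis_right_up[OF v]) (simp add: va)
      also have "\<dots> = hgen y * hbasis v"
        unfolding comm by (rule hbasis_up[OF v, symmetric]) (metis iv va lessI)
      finally show ?thesis .
    qed
    then have "e_col D * hbasis v * (hgen a * e_row D) = e_col D * hgen y * hbasis v * e_row D"
      by (metis mult.assoc)
    moreover have "hgen a * e_row D = qv *\<^sub>H e_row D"
      using hgen_e_row[OF D coll(1)] by (simp add: a_def)
    moreover have "e_col D * hgen y = (- inverse qv) *\<^sub>H e_col D"
      using e_col_hgen[OF D rk] by (simp add: y_def)
    ultimately have "qv *\<^sub>H (e_col D * hbasis v * e_row D) =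
        (- inverse qv) *\<^sub>H (e_col D * hbasis v * e_row D)"
      by (simp add: hscale_simps)
    moreover have "qv \<noteq> - inverse qv"
    proof
      assume "qv = - inverse qv"
      then have "qv ^ 2 = qv * (- inverse qv)"
        by (metis power2_eq_square)
      also have "\<dots> = - 1" using qv_nonzero by simp
      finally show False using qv_sq_plus_1 by simp
    qed
    ultimately have "e_col D * hbasis v * e_row D = 0 *\<^sub>H ?z"
      using hscale_cancel by (metis hscale_simps(6))
    then show ?thesis by blast
  qed
qed

lemma e_col_sandwich:
  assumes "young_diagram D" "x \<in> hecke_alg (card D)"
  shows "\<exists>c. e_col D * x * e_row D = c *\<^sub>H (e_col D * hbasis (diagram_perm D) * e_row D)"
  using assms(2)
proof (induction rule: hecke_alg_basis_induct)
  case (basis c w)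
  from e_col_hbasis_e_row[OF assms(1) basis] show ?case
    by (auto simp: hscale_simps)
next
  case (add x y)
  then show ?case by (auto simp: distrib_left distrib_right simp flip: hscale_add)
qed

section \<open>The idempotents\<close>

lemma braid_hecke_simps:
  "braid_hecke [] = 1"
  "braid_hecke ((i, s) # b) = (if s then hgen i else hgen_inv i) * braid_hecke b"
  "braid_hecke (b @ c) = braid_hecke b * braid_hecke c"
  by (simp_all add: braid_hecke_def)

lemma braid_inverse_simps:
  "braid_inverse [] = []"
  "braid_inverse ((i, s) # b) = braid_inverse b @ [(i, \<not> s)]"
  "braid_inverse (b @ c) = braid_inverse c @ braid_inverse b"
  "braid_inverse (braid_inverse b) = b"
  "length (braid_inverse b) = length b"
  by (simp_all add: braid_inverse_def rev_map comp_def case_prod_beta)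

lemma braid_hecke_inverse: "braid_hecke b * braid_hecke (braid_inverse b) = 1"
proof (induction b)
  case (Cons g b)
  obtain i s where [simp]: "g = (i, s)" by (cases g)
  have "braid_hecke (g # b) * braid_hecke (braid_inverse (g # b)) =
      (if s then hgen i else hgen_inv i) * (braid_hecke b * braid_hecke (braid_inverse b)) *
      (if s then hgen_inv i else hgen i)"
    by (simp add: braid_hecke_simps braid_inverse_simps mult.assoc)
  then show ?case by (simp add: Cons hgen_inv hgen_inv_left)
qed (simp add: braid_hecke_simps braid_inverse_simps)

lemma braid_hecke_inverse_left: "braid_hecke (braid_inverse b) * braid_hecke b = 1"
  using braid_hecke_inverse[of "braid_inverse b"] by (simp add: braid_inverse_simps)

lemma hphi_braid_hecke: "hphi (braid_hecke b) = (- 1) ^ length b *\<^sub>H braid_hecke b"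
proof (induction b)
  case (Cons g b)
  then show ?case
    by (cases g)
      (auto simp: braid_hecke_simps hphi_simps hphi_hgen_inv hscale_simps hscale_minus_left hscale_uminus)
qed (simp add: braid_hecke_simps hphi_simps hscale_simps)

lemma is_braid_simps:
  "is_braid n []"
  "is_braid n ((i, s) # b) \<longleftrightarrow> Suc i < n \<and> is_braid n b"
  "is_braid n (b @ c) \<longleftrightarrow> is_braid n b \<and> is_braid n c"
  "is_braid n (braid_inverse b) \<longleftrightarrow> is_braid n b"
  by (force simp: is_braid_def braid_inverse_def)+

lemma braid_hecke_alg: "is_braid n b \<Longrightarrow> braid_hecke b \<in> hecke_alg n"
proof (induction b)
  case (Cons g b)
  then show ?case
    by (cases g)
      (auto simp: braid_hecke_simps is_braid_simps hecke_alg_hgen_inv intro: hecke_alg.intros)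
qed (simp add: braid_hecke_simps hecke_alg_1)

lemma is_braid_perm_braid: "w permutes {..<K} \<Longrightarrow> is_braid K (perm_braid w)"
  using reduced_word_letters[OF _ reduced_word, of w K]
  by (auto simp: is_braid_def perm_braid_def)

definition hbasis_inv :: "(nat \<Rightarrow> nat) \<Rightarrow> hecke" where
  "hbasis_inv w = braid_hecke (braid_inverse (perm_braid w))"

lemma hbasis_inverse: "hbasis w * hbasis_inv w = 1" "hbasis_inv w * hbasis w = 1"
  by (simp_all add: hbasis_def hbasis_inv_def braid_hecke_inverse braid_hecke_inverse_left)

lemma hbasis_inv_alg: "w permutes {..<K} \<Longrightarrow> hbasis_inv w \<in> hecke_alg K"
  by (simp add: hbasis_inv_def braid_hecke_alg is_braid_simps is_braid_perm_braid)

lemma hphi_hbasis_both: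
  "hphi (hbasis w) = (- 1) ^ length (perm_braid w) *\<^sub>H hbasis w"
  "hphi (hbasis_inv w) = (- 1) ^ length (perm_braid w) *\<^sub>H hbasis_inv w"
  by (simp_all add: hbasis_def hbasis_inv_def hphi_braid_hecke braid_inverse_simps)

lemma hrev_hbasis_inv:
  assumes "w permutes {..<K}"
  shows "hrev (hbasis_inv w) = hbasis_inv (inv w)"
proof -
  have "hrev (hbasis_inv w) = hbasis_inv (inv w) * (hrev (hbasis w) * hrev (hbasis_inv w))"
    by (simp add: hrev_hbasis[OF assms] hbasis_inverse flip: mult.assoc)
  then show ?thesis by (simp add: hbasis_inverse hrev_simps flip: hrev_simps(3))
qed

definition e_dual :: "diagram \<Rightarrow> hecke" where
  "e_dual D = e_row D * hbasis (inv (diagram_perm D)) * e_col D * hbasis_inv (inv (diagram_perm D))"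

text \<open>\<open>hbasis\<close> and its inverse come from braids with equally many crossings, so
  their two signs under \<open>hphi\<close> cancel.\<close>

lemma hphi_e_tilde_transpose:
  assumes "young_diagram D"
  shows "hphi (e_tilde (diagram_transpose D)) = e_dual D"
proof -
  have "(- 1) ^ n * (- 1) ^ n = (1 :: caq)" for n
    by (simp flip: power_mult_distrib)
  then show ?thesis
    by (simp add: e_tilde_def e_dual_def hphi_simps hphi_e_col hphi_e_row transpose_transpose
        diagram_perm_transpose[OF assms] hphi_hbasis_both hscale_simps flip: hbasis_inv_def)
qed

lemma e_tilde_eq: "e_tilde D = e_col D * hbasis (diagram_perm D) * e_row D * hbasis_inv (diagram_perm D)"
  by (simp add: e_tilde_def hbasis_inv_def)

lemma hrev_e_dual:
  assumes "young_diagram D"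
  shows "hrev (e_dual D) = hbasis_inv (diagram_perm D) * e_tilde D * hbasis (diagram_perm D)"
proof -
  let ?w = "diagram_perm D"
  note w = diagram_perm_permutes[OF assms]
  have "inv (inv ?w) = ?w" using permutes_bij[OF w] by (simp add: inv_inv_eq)
  then have "hrev (hbasis (inv ?w)) = hbasis ?w" "hrev (hbasis_inv (inv ?w)) = hbasis_inv ?w"
    using hrev_hbasis[OF permutes_inv[OF w]] hrev_hbasis_inv[OF permutes_inv[OF w]] by simp_all
  then have "hrev (e_dual D) = hbasis_inv ?w * e_col D * hbasis ?w * e_row D"
    by (simp add: e_dual_def hrev_simps hrev_e_col hrev_e_row mult.assoc)
  also have "\<dots> = hbasis_inv ?w * e_tilde D * hbasis ?w"
    by (simp add: e_tilde_eq mult.assoc hbasis_inverse)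
  finally show ?thesis .
qed

lemma e_tilde_square:
  assumes "young_diagram D"
  shows "\<exists>c. e_tilde D * e_tilde D = c *\<^sub>H e_tilde D"
proof -
  let ?h = "hbasis (diagram_perm D)" and ?h' = "hbasis_inv (diagram_perm D)"
  note w = diagram_perm_permutes[OF assms]
  \<comment> \<open>With m = \<open>e_col D\<close>, p = \<open>e_row D\<close> and h =
    \<open>?h\<close>, the square of m h p h^(-1) is m x p h^(-1) for this x, the part between the
    first m and the last p.\<close>
  let ?x = "?h * e_row D * ?h' * e_col D * ?h"
  have "?x \<in> hecke_alg (card D)"
    by (intro hecke_alg.mult hbasis_hecke_alg w hbasis_inv_alg e_row_hecke_alg e_col_hecke_alg assms)
  from e_col_sandwich[OF assms this] obtain c
    where "e_col D * ?x * e_row D = c *\<^sub>H (e_col D * ?h * e_row D)" by blast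
  then have "e_col D * ?x * e_row D * ?h' = c *\<^sub>H e_tilde D"
    by (simp add: e_tilde_eq hscale_simps)
  then show ?thesis by (auto simp: e_tilde_eq mult.assoc)
qed

lemma e_scalar_eq:
  assumes "e_tilde D * e_tilde D = c *\<^sub>H e_tilde D" "e_tilde D \<noteq> 0"
  shows "e_scalar D = c"
  unfolding e_scalar_def using assms hscale_cancel by (intro the_equality) metis+

text \<open>If \<open>e_tilde D = 0\<close> then \<open>e_scalar D\<close> is unspecified, but both sides vanish for \<open>s = 0\<close>.\<close>

lemma e_idem_common_scalar:
  assumes D: "young_diagram D"
  shows "\<exists>s. e_idem D = s *\<^sub>H e_tilde D \<and> hphi (e_idem (diagram_transpose D)) = s *\<^sub>H e_dual D"
proof -
  let ?h = "hbasis (diagram_perm D)" and ?h' = "hbasis_inv (diagram_perm D)"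
  let ?T = "diagram_transpose D"
  have dual0: "e_tilde D = 0 \<longleftrightarrow> e_dual D = 0"
  proof
    assume "e_tilde D = 0"
    then have "hrev (hrev (e_dual D)) = 0" by (simp add: hrev_e_dual[OF D] hrev_simps)
    then show "e_dual D = 0" by (simp add: hrev_hrev)
  next
    assume "e_dual D = 0"
    then have "?h' * e_tilde D * ?h = 0" by (simp add: hrev_simps flip: hrev_e_dual[OF D])
    then have "?h * (?h' * e_tilde D * ?h) * ?h' = 0" by simp
    moreover have "?h * (?h' * e_tilde D * ?h) * ?h' = (?h * ?h') * e_tilde D * (?h * ?h')"
      by (simp only: mult.assoc)
    ultimately show "e_tilde D = 0" by (simp add: hbasis_inverse)
  qed
  show ?thesis
  proof (cases "e_tilde D = 0")
    case True
    then show ?thesis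
      using dual0
      by (intro exI[of _ 0])
        (simp add: e_idem_def hphi_hscale hphi_e_tilde_transpose[OF D] hscale_simps)
  next
    case False
    then have "e_dual D \<noteq> 0" by (simp add: dual0)
    then have T0: "e_tilde ?T \<noteq> 0"
      using hphi_e_tilde_transpose[OF D] by (auto simp: hphi_simps)
    obtain c where c: "e_tilde ?T * e_tilde ?T = c *\<^sub>H e_tilde ?T"
      using e_tilde_square[OF young_transpose[OF D]] by blast
    define c' where "c' = subst_q_inverse c"
    have "e_dual D * e_dual D = c' *\<^sub>H e_dual D"
      using arg_cong[OF c, of hphi]
      by (simp add: hphi_simps hphi_hscale hphi_e_tilde_transpose[OF D] c'_def)
    from arg_cong[OF this, of hrev]
    have "(?h' * e_tilde D * ?h) * (?h' * e_tilde D * ?h) = c' *\<^sub>H (?h' * e_tilde D * ?h)"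
      by (simp add: hrev_simps hrev_hscale hrev_e_dual[OF D])
    from arg_cong[OF this, of "\<lambda>x. ?h * x * ?h'"]
    have "(?h * ?h') * e_tilde D * (?h * ?h') * e_tilde D * (?h * ?h') =
        c' *\<^sub>H ((?h * ?h') * e_tilde D * (?h * ?h'))"
      by (simp only: mult.assoc hscale_simps)
    then have "e_tilde D * e_tilde D = c' *\<^sub>H e_tilde D"
      by (simp add: hbasis_inverse)
    from e_scalar_eq[OF this False] e_scalar_eq[OF c T0] show ?thesis
      by (intro exI[of _ "inverse c'"])
        (simp add: e_idem_def hphi_hscale hphi_e_tilde_transpose[OF D] c'_def subst_inverse)
  qed
qed

lemma e_tilde_hecke_alg: "young_diagram D \<Longrightarrow> e_tilde D \<in> hecke_alg (card D)"
  unfolding e_tilde_eq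
  by (intro hecke_alg.mult hbasis_hecke_alg hbasis_inv_alg e_row_hecke_alg e_col_hecke_alg
      diagram_perm_permutes)

lemma e_idem_hecke_alg: "young_diagram D \<Longrightarrow> e_idem D \<in> hecke_alg (card D)"
  by (simp add: e_idem_def hecke_alg_hscale e_tilde_hecke_alg)

text \<open>Both factors are confined to K strands so that either can be placed on a cable of width
  K and slid along it.\<close>

definition cyclic_step :: "nat \<Rightarrow> hecke \<Rightarrow> hecke \<Rightarrow> bool" where
  "cyclic_step K e f \<longleftrightarrow> (\<exists>x\<in>hecke_alg K. \<exists>y\<in>hecke_alg K. e = x * y \<and> f = y * x)"

lemma cyclic_stepI: "x \<in> hecke_alg K \<Longrightarrow> y \<in> hecke_alg K \<Longrightarrow> cyclic_step K (x * y) (y * x)"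
  by (auto simp: cyclic_step_def)

lemma e_idem_cyclic:
  assumes D: "young_diagram D"
  obtains g g' where "cyclic_step (card D) (e_idem D) g"
    "cyclic_step (card D) (hphi (e_idem (diagram_transpose D))) g'" "cyclic_step (card D) g' g"
proof -
  let ?h = "hbasis (diagram_perm D)" and ?h' = "hbasis_inv (diagram_perm D)"
  let ?k = "hbasis (inv (diagram_perm D))" and ?k' = "hbasis_inv (inv (diagram_perm D))"
  let ?m = "e_col D" and ?p = "e_row D"
  note w = diagram_perm_permutes[OF D]
  note alg = hecke_alg.mult hbasis_hecke_alg hbasis_inv_alg e_row_hecke_alg e_col_hecke_alg w D
    hecke_alg_hscale permutes_inv[OF w]
  \<comment> \<open>Sandwiching the inverse of k between m and p produces the factor b. The reversal
    fixes m and p, sends h to k and the inverse of k to the inverse of h, so the same b occurs in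
    the mirrored identity \<open>b'\<close>.\<close>
  obtain b where b: "?m * ?k' * ?p = b *\<^sub>H (?m * ?h * ?p)"
    using e_col_sandwich[OF D hbasis_inv_alg[OF permutes_inv[OF w]]] by blast
  have "hrev ?k' = ?h'"
    using hrev_hbasis_inv[OF w] hrev_hrev by metis
  with arg_cong[OF b, of hrev] have b': "?p * ?h' * ?m = b *\<^sub>H (?p * ?k * ?m)"
    by (simp add: hrev_simps hrev_hscale hrev_e_col hrev_e_row hrev_hbasis[OF w] mult.assoc)
  obtain s where s: "e_idem D = s *\<^sub>H e_tilde D" "hphi (e_idem (diagram_transpose D)) = s *\<^sub>H e_dual D"
    using e_idem_common_scalar[OF D] by blast
  show thesis
  proof (rule that)
    have "cyclic_step (card D) ((s *\<^sub>H (?m * ?h)) * (?p * ?h')) ((?p * ?h') * (s *\<^sub>H (?m * ?h)))"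
      by (rule cyclic_stepI) (intro alg)+
    moreover have "(?p * ?h') * (s *\<^sub>H (?m * ?h)) = s *\<^sub>H ((?p * ?h' * ?m) * ?h)"
      by (simp add: hscale_simps mult.assoc)
    then have "(?p * ?h') * (s *\<^sub>H (?m * ?h)) = (s * b) *\<^sub>H (?p * ?k * ?m * ?h)"
      by (simp only: b' hscale_simps)
    moreover have "e_idem D = (s *\<^sub>H (?m * ?h)) * (?p * ?h')"
      unfolding s e_tilde_eq by (simp add: hscale_simps mult.assoc)
    ultimately show "cyclic_step (card D) (e_idem D) ((s * b) *\<^sub>H (?p * ?k * ?m * ?h))"
      by simp
    have "cyclic_step (card D) ((s *\<^sub>H (?p * ?k)) * (?m * ?k')) ((?m * ?k') * (s *\<^sub>H (?p * ?k)))"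
      by (rule cyclic_stepI) (intro alg)+
    moreover have "(?m * ?k') * (s *\<^sub>H (?p * ?k)) = s *\<^sub>H ((?m * ?k' * ?p) * ?k)"
      by (simp add: hscale_simps mult.assoc)
    then have "(?m * ?k') * (s *\<^sub>H (?p * ?k)) = (s * b) *\<^sub>H (?m * ?h * ?p * ?k)"
      by (simp only: b hscale_simps)
    moreover have "hphi (e_idem (diagram_transpose D)) = (s *\<^sub>H (?p * ?k)) * (?m * ?k')"
      unfolding s e_dual_def by (simp add: hscale_simps mult.assoc)
    ultimately show "cyclic_step (card D) (hphi (e_idem (diagram_transpose D)))
        ((s * b) *\<^sub>H (?m * ?h * ?p * ?k))"
      by simp
    have "cyclic_step (card D) (((s * b) *\<^sub>H (?m * ?h)) * (?p * ?k)) ((?p * ?k) * ((s * b) *\<^sub>H (?m * ?h)))"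
      by (rule cyclic_stepI) (intro alg)+
    then show "cyclic_step (card D) ((s * b) *\<^sub>H (?m * ?h * ?p * ?k)) ((s * b) *\<^sub>H (?p * ?k * ?m * ?h))"
      by (simp add: hscale_simps mult.assoc)
  qed
qed

section \<open>Existence of the Jones--Ocneanu trace\<close>

abbreviation zq :: caq where "zq \<equiv> qv - inverse qv"

abbreviation hup :: "hecke \<Rightarrow> hecke" where "hup \<equiv> hshift (Suc 0)"

text \<open>The \<open>hcycle j\<close> represent the right cosets of the strands other than the leftmost one.\<close>

definition hcycle :: "nat \<Rightarrow> hecke" where
  "hcycle j = hprod [0..<j]"

lemma hcycle_0: "hcycle 0 = 1"
  by (simp add: hcycle_def hprod_simps)

lemma hcycle_Suc: "hcycle (Suc j) = hcycle j * hgen j"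
  by (simp add: hcycle_def hprod_simps)

lemma hcycle_hgen_far: "j < i \<Longrightarrow> hcycle j * hgen i = hgen i * hcycle j"
proof (induction j)
  case (Suc j)
  then show ?case by (simp add: hcycle_Suc hgen_far mult.assoc) (metis Suc Suc_lessD mult.assoc)
qed (simp add: hcycle_0)

lemma hcycle_hgen_less: "Suc i < j \<Longrightarrow> hcycle j * hgen i = hgen (Suc i) * hcycle j"
proof (induction j)
  case (Suc j)
  show ?case
  proof (cases "Suc i < j")
    case True
    then have "hcycle (Suc j) * hgen i = hcycle j * hgen i * hgen j"
      using hgen_far[of j i] by (simp add: hcycle_Suc mult.assoc)
    then show ?thesis using Suc.IH[OF True] by (simp add: hcycle_Suc mult.assoc)
  next
    case False
    with Suc.prems have [simp]: "j = Suc i" by simp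
    have "hcycle (Suc j) * hgen i = hcycle i * hgen (Suc i) * (hgen i * hgen (Suc i))"
      by (simp add: hcycle_Suc mult.assoc hgen_braid)
    then show ?thesis by (simp add: hcycle_Suc mult.assoc hcycle_hgen_far flip: mult.assoc)
  qed
qed simp

lemma hcycle_hgen_last: "hcycle (Suc j) * hgen j = zq *\<^sub>H hcycle (Suc j) + hcycle j"
  by (simp add: hcycle_Suc mult.assoc hgen_square distrib_left hscale_def hconst_left_commute[of "hcycle j"])

lemma hcycle_Suc_left: "hcycle (Suc j) = hgen 0 * hup (hcycle j)"
proof (induction j)
  case (Suc j)
  have "hcycle (Suc (Suc j)) = hgen 0 * hup (hcycle j) * hgen (Suc j)"
    by (subst hcycle_Suc) (simp only: Suc)
  then show ?case by (simp add: hcycle_Suc[of j] hshift_simps mult.assoc)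
qed (simp add: hcycle_0 hcycle_Suc hshift_simps)

lemma hcycle_hecke_alg: "j < K \<or> j = 0 \<Longrightarrow> hcycle j \<in> hecke_alg K"
  by (auto simp: hcycle_def hprod_simps hecke_alg_1 intro!: hprod_hecke_alg)

text \<open>Right multiplication by a generator keeps the form \<open>hup x * hcycle j\<close> up to
  sums: the generator following the cycle prolongs it, the last generator of the cycle splits off by
  the quadratic relation, and all others slide through the cycle into \<open>hup\<close>.\<close>

lemma hecke_alg_left_induct [consumes 1, case_names basis add]:
  assumes "y \<in> hecke_alg (Suc K)"
    and basis: "\<And>x j. x \<in> hecke_alg K \<Longrightarrow> j \<le> K \<Longrightarrow> P (hup x * hcycle j)"
    and add: "\<And>x y. P x \<Longrightarrow> P y \<Longrightarrow> P (x + y)"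
  shows "P y"
proof -
  define B where "B = {hup x * hcycle j | x j. x \<in> hecke_alg K \<and> j \<le> K}"
  have BI: "hup x * hcycle j \<in> B" if "x \<in> hecke_alg K" "j \<le> K" for x j
    using that by (auto simp: B_def)
  have const: "hup x * hcycle j * hconst c \<in> B" if "x \<in> hecke_alg K" "j \<le> K" for x j c
    using BI[of "hconst c * x" j] that
    by (simp add: hecke_alg.intros hshift_simps mult.assoc hconst_commute)
  have "y \<in> add_span B"
    using assms(1)
  proof (rule hecke_alg_add_span)
    show "1 \<in> B" using BI[of 1 0] by (simp add: hcycle_0 hshift_simps hecke_alg_1)
  next
    fix b i assume "b \<in> B" and i: "Suc i < Suc K"
    then obtain x j where b: "b = hup x * hcycle j" and x: "x \<in> hecke_alg K" "j \<le> K"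
      unfolding B_def by blast
    consider "j < i" | "i = j" | "j = Suc i" | "Suc i < j" by linarith
    then show "b * hgen i \<in> add_span B"
    proof cases
      case 1
      have "hgen (i - 1) \<in> hecke_alg K"
        by (rule hecke_alg.gen) (use 1 i in simp)
      with x have "x * hgen (i - 1) \<in> hecke_alg K" by (intro hecke_alg.mult)
      from BI[OF this x(2)] 1 show ?thesis
        by (simp add: b hshift_simps mult.assoc hcycle_hgen_far add_span.base)
    next
      case 2
      with BI[of x "Suc j"] x i show ?thesis by (simp add: b hcycle_Suc mult.assoc add_span.base)
    next
      case 3
      have "b * hgen i = hup x * hcycle j * hconst zq + hup x * hcycle i"
        by (simp add: b 3 mult.assoc hcycle_hgen_last distrib_left hscale_def hconst_commute
            hconst_left_commute[of "hup x"])
      moreover have "hup x * hcycle i \<in> B" using x 3 by (intro BI) auto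
      ultimately show ?thesis using const[OF x] by (simp add: add_span.intros)
    next
      case 4
      then have "x * hgen i \<in> hecke_alg K"
        using x by (intro hecke_alg.mult hecke_alg.gen) auto
      from BI[OF this x(2)] 4 show ?thesis
        by (simp add: b hshift_simps mult.assoc hcycle_hgen_less add_span.base)
    qed
  next
    fix b c assume "b \<in> B"
    then show "b * hconst c \<in> add_span B"
      using const unfolding B_def by (blast intro: add_span.base)
  qed
  then show ?thesis by induction (auto simp: B_def basis add)
qed

lemma hecke_alg_exhausts: "\<exists>K. x \<in> hecke_alg (Suc K)"
proof (induction x rule: hecke_induct_left)
  case (const c)
  then show ?case by (auto intro: hecke_alg.const)
next
  case (gen i x)
  then obtain K where "x \<in> hecke_alg (Suc K)" by blast
  then have "x \<in> hecke_alg (Suc (max K (Suc i)))" by (rule hecke_alg_mono) simp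
  then have "hgen i * x \<in> hecke_alg (Suc (max K (Suc i)))"
    by (intro hecke_alg.mult hecke_alg.gen) auto
  then show ?case by blast
next
  case (add x y)
  then obtain K L where "x \<in> hecke_alg (Suc K)" "y \<in> hecke_alg (Suc L)" by blast
  then have "x + y \<in> hecke_alg (Suc (max K L))"
    by (intro hecke_alg.add) (auto elim: hecke_alg_mono)
  then show ?case by blast
qed

lemma hecke_left_induct [case_names basis add]:
  assumes "\<And>x j. P (hup x * hcycle j)" "\<And>x y. P x \<Longrightarrow> P y \<Longrightarrow> P (x + y)"
  shows "P y"
proof -
  obtain K where "y \<in> hecke_alg (Suc K)" using hecke_alg_exhausts by blast
  then show ?thesis by (rule hecke_alg_left_induct) (use assms in auto)
qed

text \<open>The right action of \<open>H\<^sub>i\<close> on the coordinates with respect to the \<open>hcycle j\<close> over the subalgebra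
  \<open>hshift 1\<close> of the strands other than the leftmost one. That this respects the relations shows
  that these coordinates are well defined.\<close>

definition gen_act :: "nat \<Rightarrow> (nat \<Rightarrow> hecke) \<Rightarrow> nat \<Rightarrow> hecke" where
  "gen_act i X j = (if j < i then X j * hgen (i - 1) else if j = i then X (Suc i)
    else if j = Suc i then X i + hconst zq * X (Suc i) else X j * hgen i)"

lemma gen_act_square: "gen_act i (gen_act i X) j = hconst zq * gen_act i X j + X j"
  by (auto simp: gen_act_def mult.assoc hgen_square distrib_left hconst_left_commute[of "X _"])

lemma gen_act_far:
  assumes "Suc i < k"
  shows "gen_act i (gen_act k X) j = gen_act k (gen_act i X) j"
proof -
  have "hgen (k - Suc 0) * hgen (i - Suc 0) = hgen (i - Suc 0) * hgen (k - Suc 0)" if "j < i"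
    by (rule hgen_far) (use assms that in auto)
  moreover have "hgen (k - Suc 0) * hgen i = hgen i * hgen (k - Suc 0)" if "Suc i < j" "j < k"
    by (rule hgen_far) (use that in auto)
  moreover have "hgen k * hgen i = hgen i * hgen k"
    by (rule hgen_far) (use assms in auto)
  ultimately show ?thesis
    using assms by (auto simp: gen_act_def mult.assoc distrib_right)
qed

lemma gen_act_braid:
  "gen_act i (gen_act (Suc i) (gen_act i X)) j = gen_act (Suc i) (gen_act i (gen_act (Suc i) X)) j"
proof -
  have sq: "x * hgen i * hgen i = hconst zq * (x * hgen i) + x" for x
    by (simp add: mult.assoc hgen_square distrib_left hconst_left_commute[of x])
  consider "j < i" | "j = i" | "j = Suc i" | "j = Suc (Suc i)" | "Suc (Suc i) < j" by linarith
  then show ?thesis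
  proof cases
    case 1
    then show ?thesis
      using hgen_braid[of "i - 1"] by (simp add: gen_act_def mult.assoc)
  next
    case 4
    then show ?thesis by (simp add: gen_act_def distrib_right distrib_left sq mult.assoc[of "hconst zq"] add_ac)
  next
    case 5
    then show ?thesis using hgen_braid[of i] by (simp add: gen_act_def mult.assoc)
  qed (simp_all add: gen_act_def distrib_right mult.assoc)
qed

lemma gen_act_linear:
  "gen_act i (\<lambda>j. X j + Y j) = (\<lambda>j. gen_act i X j + gen_act i Y j)"
  "gen_act i (\<lambda>j. hconst c * X j) = (\<lambda>j. hconst c * gen_act i X j)"
  "gen_act i (\<lambda>j. 0) = (\<lambda>j. 0)"
proof -
  have "hconst zq * (hconst c * x) = hconst c * (hconst zq * x)" for x
    by (rule hconst_left_commute)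
  then show "gen_act i (\<lambda>j. hconst c * X j) = (\<lambda>j. hconst c * gen_act i X j)"
    by (auto simp: gen_act_def fun_eq_iff distrib_left mult.assoc)
qed (auto simp: gen_act_def fun_eq_iff distrib_left distrib_right)

text \<open>\<open>fold\<close> lets the first letter act first, as a right action requires.\<close>

definition word_act :: "nat list \<Rightarrow> (nat \<Rightarrow> hecke) \<Rightarrow> nat \<Rightarrow> hecke" where
  "word_act w X = fold gen_act w X"

lemma word_act_linear:
  "word_act w (\<lambda>j. X j + Y j) = (\<lambda>j. word_act w X j + word_act w Y j)"
  "word_act w (\<lambda>j. hconst c * X j) = (\<lambda>j. hconst c * word_act w X j)"
  "word_act w (\<lambda>j. 0) = (\<lambda>j. 0)"
  unfolding word_act_def
  by (induction w arbitrary: X Y) (simp_all add: gen_act_linear)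

definition free_act :: "free_hecke \<Rightarrow> (nat \<Rightarrow> hecke) \<Rightarrow> nat \<Rightarrow> hecke" where
  "free_act x X j = lin_ext (\<lambda>w c. hconst c * word_act w X j) x"

lemma free_act_add: "free_act (x + y) X j = free_act x X j + free_act y X j"
  unfolding free_act_def by (rule lin_ext_add) (simp_all add: hconst_simps distrib_right)

lemma free_act_diff: "free_act (x - y) X j = free_act x X j - free_act y X j"
  unfolding free_act_def by (rule lin_ext_diff) (simp_all add: hconst_simps distrib_right)

lemma free_act_single: "free_act (Poly_Mapping.single w c) X j = hconst c * word_act w X j"
  unfolding free_act_def by (rule lin_ext_single) (simp add: hconst_simps)

lemma free_act_linear:
  "free_act x (\<lambda>j. X j + Y j) j = free_act x X j + free_act x Y j"
  "free_act x (\<lambda>j. hconst c * X j) j = hconst c * free_act x X j"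
proof (induction x rule: free_hecke_induct)
  case (single w d)
  case 1
  show ?case by (simp add: free_act_single word_act_linear distrib_left)
  case 2
  show ?case by (simp add: free_act_single word_act_linear) (rule hconst_left_commute)
next
  case (add x y)
  case 1
  show ?case using add by (simp add: free_act_add add_ac)
  case 2
  show ?case using add by (simp add: free_act_add distrib_left)
qed

lemma free_act_mult_apply: "free_act (x * y) X j = free_act y (free_act x X) j"
proof (induction x rule: free_hecke_induct)
  case (single v c)
  show ?case
  proof (induction y rule: free_hecke_induct)
    case (single w d)
    have "free_act (Poly_Mapping.single v c) X = (\<lambda>j. hconst c * word_act v X j)"
      by (simp add: fun_eq_iff free_act_single)
    then show ?case
      by (simp add: mult_single plus_list_def free_act_single word_act_linear hconst_simps
          mult.commute[of c] mult.assoc)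
        (simp add: word_act_def)
  qed (simp add: distrib_left free_act_add)
next
  case (add x y)
  have "free_act (x + y) X = (\<lambda>j. free_act x X j + free_act y X j)"
    by (simp add: fun_eq_iff free_act_add)
  with add show ?case by (simp add: distrib_right free_act_add free_act_linear)
qed

lemma free_act_mult: "free_act (x * y) X = free_act y (free_act x X)"
  by (rule ext) (rule free_act_mult_apply)

lemma free_act_simps:
  "free_act (free_gen i) X = gen_act i X"
  "free_act (free_const c) X = (\<lambda>j. hconst c * X j)"
  "free_act 1 X = X"
  by (simp_all add: fun_eq_iff free_gen_def free_const_def free_one free_act_single hconst_simps
      word_act_def del: single_one)

lemma free_act_hecke_ideal: "x \<in> hecke_ideal \<Longrightarrow> free_act x X j = 0"
proof (induction arbitrary: X rule: hecke_ideal.induct)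
  case zero
  show ?case using free_act_diff[of 0 0 X j] by simp
next
  case (relator r u v)
  from relator have r: "free_act r Y = (\<lambda>j. 0)" for Y
  proof (cases rule: hecke_relators.cases)
    case (quadratic i)
    have "free_act (free_gen i * free_gen i) Y k =
        free_act (free_const zq * free_gen i + 1) Y k" for k
      by (simp add: free_act_mult free_act_add free_act_simps gen_act_linear gen_act_square)
    then show ?thesis by (simp add: quadratic free_act_diff fun_eq_iff)
  next
    case (far i k)
    have "free_act (free_gen i * free_gen k) Y l = free_act (free_gen k * free_gen i) Y l" for l
      using far(2) gen_act_far[of i k Y l] gen_act_far[of k i Y l]
      by (auto simp: free_act_mult free_act_simps)
    then show ?thesis by (simp add: far free_act_diff fun_eq_iff)
  next
    case (braid k i)
    have "free_act (free_gen i * free_gen k * free_gen i) Y l =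
        free_act (free_gen k * free_gen i * free_gen k) Y l" for l
      using braid(2) gen_act_braid[of i Y l] gen_act_braid[of k Y l]
      by (auto simp: free_act_mult free_act_simps)
    then show ?thesis by (simp add: braid free_act_diff fun_eq_iff)
  qed
  have "free_act v (\<lambda>j. 0) j = 0"
    using free_act_linear(2)[of v 0 "\<lambda>j. 0" j] by (simp add: hconst_simps)
  then show ?case unfolding free_act_mult r .
qed (simp add: free_act_add)

section \<open>Coordinates over the subalgebra of the other strands\<close>

definition hact :: "hecke \<Rightarrow> (nat \<Rightarrow> hecke) \<Rightarrow> nat \<Rightarrow> hecke" where
  "hact x = free_act (rep_hecke x)"

lemma hact_abs: "hact (abs_hecke x) = free_act x"
proof -
  have "rep_hecke (abs_hecke x) - x \<in> hecke_ideal"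
    using Quotient3_abs_rep[OF Quotient3_hecke, of "abs_hecke x"] by (simp only: hecke.abs_eq_iff)
  then have "free_act (rep_hecke (abs_hecke x) - x) X j = 0" for X j
    by (rule free_act_hecke_ideal)
  then have "free_act (rep_hecke (abs_hecke x)) X j = free_act x X j" for X j
    unfolding free_act_diff by simp
  then show ?thesis unfolding hact_def by blast
qed

lemma hact_simps:
  "hact (x + y) X = (\<lambda>j. hact x X j + hact y X j)"
  "hact (x * y) X = hact y (hact x X)"
  "hact (hgen i) X = gen_act i X"
  "hact (hconst c) X = (\<lambda>j. hconst c * X j)"
proof -
  have "\<exists>x'. z = abs_hecke x'" for z
    by (induction z rule: hecke.abs_induct) blast
  then obtain x' y' where [simp]: "x = abs_hecke x'" "y = abs_hecke y'"
    by metis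
  show "hact (x + y) X = (\<lambda>j. hact x X j + hact y X j)" "hact (x * y) X = hact y (hact x X)"
    by (simp_all add: plus_hecke.abs_eq times_hecke.abs_eq hact_abs free_act_add free_act_mult fun_eq_iff)
qed (simp_all add: hgen.abs_eq hconst.abs_eq hact_abs free_act_simps)

definition unit_at :: "nat \<Rightarrow> hecke \<Rightarrow> nat \<Rightarrow> hecke" where
  "unit_at j x k = (if k = j then x else 0)"

definition coords :: "hecke \<Rightarrow> nat \<Rightarrow> hecke" where
  "coords x = hact x (unit_at 0 1)"

lemma coords_add: "coords (x + y) j = coords x j + coords y j"
  by (simp add: coords_def hact_simps)

lemma hact_hshift_unit: "hact (hup y) (unit_at 0 x) = unit_at 0 (x * y)"
proof (induction y arbitrary: x rule: hecke_induct_right)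
  case (gen i y)
  have "gen_act (Suc i) (unit_at 0 z) = unit_at 0 (z * hgen i)" for z
    by (auto simp: gen_act_def unit_at_def fun_eq_iff)
  with gen show ?case by (simp add: hshift_simps hact_simps mult.assoc)
qed (auto simp: hshift_simps hact_simps unit_at_def fun_eq_iff hconst_commute distrib_left)

lemma hact_hcycle_unit: "hact (hcycle j) (unit_at 0 x) = unit_at j x"
proof (induction j)
  case 0
  show ?case using hact_simps(4)[of 1] by (simp add: hcycle_0 hconst_simps)
next
  case (Suc j)
  have "gen_act j (unit_at j x) = unit_at (Suc j) x"
    by (auto simp: gen_act_def unit_at_def fun_eq_iff)
  with Suc show ?case by (simp add: hcycle_Suc hact_simps)
qed

text \<open>Starting from the entry 1 at place 0, \<open>hup x\<close> multiplies this entry by x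
  and \<open>hcycle j\<close> carries it to place j. Thus x and j can be recovered from the
  coordinates, and an additive map can be prescribed on these products.\<close>

lemma coords_basis: "coords (hup x * hcycle j) = unit_at j x"
  by (simp add: coords_def hact_simps hact_hshift_unit[of x 1, simplified] hact_hcycle_unit)

lemma finite_coords: "finite {j. coords y j \<noteq> 0}"
proof (induction y rule: hecke_left_induct)
  case (basis x j)
  have "{k. coords (hup x * hcycle j) k \<noteq> 0} \<subseteq> {j}"
    unfolding coords_basis by (auto simp: unit_at_def)
  then show ?case by (rule finite_subset) simp
next
  case (add x y)
  have "{j. coords (x + y) j \<noteq> 0} \<subseteq> {j. coords x j \<noteq> 0} \<union> {j. coords y j \<noteq> 0}"
    by (auto simp: coords_add)
  then show ?case by (rule finite_subset) (use add in simp)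
qed

subsection \<open>Closing the leftmost strand\<close>

abbreviation circle :: caq where
  "circle \<equiv> (av - inverse av) / zq"

text \<open>The closure of the leftmost strand of \<open>hcycle j\<close>. For j = 0 this is a free
  circle; otherwise \<open>hcycle (Suc i)\<close> is \<open>hgen 0 * hup (hcycle i)\<close>, and its
  only crossing with the leftmost strand becomes a curl of value a.\<close>

definition close_cycle :: "nat \<Rightarrow> hecke" where
  "close_cycle j = (case j of 0 \<Rightarrow> hconst circle | Suc i \<Rightarrow> hconst av * hcycle i)"

definition partial_closure :: "hecke \<Rightarrow> hecke" where
  "partial_closure y = Sum_any (\<lambda>j. coords y j * close_cycle j)"

lemma partial_closure_basis: "partial_closure (hup x * hcycle j) = x * close_cycle j"
proof -
  have "partial_closure (hup x * hcycle j) = Sum_any (\<lambda>k. (x * close_cycle k when k = j))"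
    unfolding partial_closure_def coords_basis
    by (rule arg_cong[of _ _ Sum_any]) (auto simp: unit_at_def fun_eq_iff when_def)
  then show ?thesis by simp
qed

lemma partial_closure_add: "partial_closure (x + y) = partial_closure x + partial_closure y"
proof -
  have "finite {j. coords z j * close_cycle j \<noteq> 0}" for z
    by (rule finite_subset[OF _ finite_coords[of z]]) auto
  then show ?thesis
    by (simp add: partial_closure_def coords_add distrib_right Sum_any.distrib)
qed

lemma partial_closure_left: "partial_closure (hup u * y) = u * partial_closure y"
proof (induction y rule: hecke_left_induct)
  case (basis x j)
  then show ?case
    using partial_closure_basis[of "u * x" j]
    by (simp add: hshift_simps partial_closure_basis mult.assoc)
qed (simp add: distrib_left partial_closure_add)

lemma partial_closure_hconst: "partial_closure (hconst c * y) = hconst c * partial_closure y"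
  using partial_closure_left[of "hconst c" y] by (simp add: hshift_simps)

lemma close_cycle_Suc: "close_cycle (Suc j) = hconst av * hcycle j"
  by (simp add: close_cycle_def)

text \<open>Linearity from the left is built into the coordinates; from the right it depends on the
  position of the generator relative to the cycle. Closing shortens a nonempty cycle by one, so each
  rule for \<open>hcycle\<close> and the generator Suc i becomes the rule for i.\<close>

lemma partial_closure_right_hgen:
  "partial_closure (y * hgen (Suc i)) = partial_closure y * hgen i"
proof (induction y rule: hecke_left_induct)
  case (basis x j)
  consider "j < Suc i" | "j = Suc i" | "j = Suc (Suc i)" | "Suc (Suc i) < j" by linarith
  then show ?case
  proof cases
    case 1
    have "close_cycle j * hgen i = hgen i * close_cycle j"
      using 1 by (cases j) (simp_all add: close_cycle_def hconst_commute hcycle_hgen_far mult.assoc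
          hconst_left_commute[of "hgen i"])
    then show ?thesis
      using 1 partial_closure_basis[of "x * hgen i" j]
      by (simp add: hshift_simps partial_closure_basis mult.assoc hcycle_hgen_far)
  next
    case 2
    have "hup x * hcycle j * hgen (Suc i) = hup x * hcycle (Suc j)"
      by (simp add: 2 hcycle_Suc mult.assoc)
    then show ?thesis
      by (simp only: partial_closure_basis) (simp add: 2 close_cycle_Suc hcycle_Suc mult.assoc)
  next
    case 3
    have "hup x * hcycle j * hgen (Suc i) =
        hconst zq * (hup x * hcycle j) + hup x * hcycle (Suc i)"
      by (simp add: 3 mult.assoc hcycle_hgen_last distrib_left hscale_def hconst_left_commute[of "hup x"])
    then have "partial_closure (hup x * hcycle j * hgen (Suc i)) =
        hconst zq * (x * close_cycle j) + x * close_cycle (Suc i)"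
      by (simp only: partial_closure_add partial_closure_hconst partial_closure_basis)
    also have "\<dots> = x * hconst av * (hconst zq * hcycle (Suc i) + hcycle i)"
      by (simp add: 3 close_cycle_Suc distrib_left mult.assoc hconst_left_commute[of x]
          hconst_left_commute[of "hconst av"])
    also have "\<dots> = x * close_cycle j * hgen i"
      by (simp add: 3 close_cycle_Suc mult.assoc hcycle_hgen_last hscale_def)
    finally show ?thesis by (simp add: partial_closure_basis)
  next
    case 4
    then obtain k where k: "j = Suc k" "Suc i < k" by (cases j) auto
    show ?thesis
      using 4 partial_closure_basis[of "x * hgen (Suc i)" j] k
      by (simp add: hshift_simps partial_closure_basis mult.assoc hcycle_hgen_less close_cycle_Suc
          hconst_left_commute[of "hgen _"])
  qed
qed (simp add: distrib_right partial_closure_add)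

lemma partial_closure_right: "partial_closure (y * hup u) = partial_closure y * u"
proof (induction u arbitrary: y rule: hecke_induct_right)
  case (gen i u)
  then show ?case using partial_closure_right_hgen[of "y * hup u" i]
    by (simp add: hshift_simps mult.assoc)
qed (simp_all add: hshift_simps hconst_commute partial_closure_hconst distrib_left partial_closure_add)

lemma partial_closure_values:
  "partial_closure (hup x) = hconst circle * x"
  "partial_closure (hup x * hgen 0) = hconst av * x"
  "partial_closure (hup x * (hgen 0 * hup y)) = hconst av * (x * y)"
proof -
  show "partial_closure (hup x) = hconst circle * x"
    using partial_closure_basis[of x 0] by (simp add: hcycle_0 close_cycle_def hconst_commute)
  show *: "partial_closure (hup x * hgen 0) = hconst av * x" for x
    using partial_closure_basis[of x 1]
    by (simp add: hcycle_0 hcycle_Suc close_cycle_def hconst_commute)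
  show "partial_closure (hup x * (hgen 0 * hup y)) = hconst av * (x * y)"
    using partial_closure_right[of "hup x * hgen 0" y] by (simp add: * mult.assoc)
qed

lemma partial_closure_hecke_alg: "y \<in> hecke_alg (Suc K) \<Longrightarrow> partial_closure y \<in> hecke_alg K"
proof (induction rule: hecke_alg_left_induct)
  case (basis x j)
  have "close_cycle j \<in> hecke_alg K"
    using basis(2) by (cases j) (auto simp: close_cycle_def intro!: hecke_alg.intros hcycle_hecke_alg)
  with basis show ?case by (simp only: partial_closure_basis) (rule hecke_alg.mult)
qed (simp add: partial_closure_add hecke_alg.add)

section \<open>The iterated closure as a Jones--Ocneanu trace\<close>

definition closure_trace :: "nat \<Rightarrow> hecke \<Rightarrow> caq" where
  "closure_trace K x = hchar ((partial_closure ^^ K) x)"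

lemma closure_trace_Suc: "closure_trace (Suc K) x = closure_trace K (partial_closure x)"
  by (simp add: closure_trace_def funpow_swap1)

lemma closure_trace_add: "closure_trace K (x + y) = closure_trace K x + closure_trace K y"
  by (induction K arbitrary: x y)
    (simp_all add: closure_trace_Suc partial_closure_add, simp add: closure_trace_def hchar_simps)

lemma closure_trace_hconst: "closure_trace K (hconst c * x) = c * closure_trace K x"
  by (induction K arbitrary: x)
    (simp_all add: closure_trace_Suc partial_closure_hconst, simp add: closure_trace_def hchar_simps)

lemma hecke_alg_le1: "x \<in> hecke_alg K \<Longrightarrow> K \<le> 1 \<Longrightarrow> \<exists>c. x = hconst c"
  by (induction rule: hecke_alg.induct) (auto simp flip: hconst_simps)

text \<open>The new strand is the rightmost one while strands are closed from the left. After the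
  others are closed, a single circle remains, which is the base case.\<close>

lemma closure_trace_stabilize:
  "x \<in> hecke_alg K \<Longrightarrow> closure_trace (Suc K) x = circle * closure_trace K x"
proof (induction K arbitrary: x)
  case 0
  then obtain c where [simp]: "x = hconst c" using hecke_alg_le1 by blast
  have "partial_closure x = hconst circle * hconst c"
    using partial_closure_values(1)[of "hconst c"] by (simp add: hshift_simps)
  then show ?case by (simp add: closure_trace_def hchar_simps)
next
  case (Suc K)
  from Suc.IH[OF partial_closure_hecke_alg[OF Suc.prems]] show ?case
    by (simp add: closure_trace_Suc)
qed

lemma closure_trace_markov:
  "x \<in> hecke_alg (Suc K) \<Longrightarrow> closure_trace (Suc (Suc K)) (x * hgen K) = av * closure_trace (Suc K) x"
proof (induction K arbitrary: x)
  case 0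
  then obtain c where [simp]: "x = hconst c" using hecke_alg_le1 by (metis One_nat_def order_refl)
  have 1: "partial_closure (x * hgen 0) = hconst av * hconst c"
    using partial_closure_values(2)[of "hconst c"] by (simp add: hshift_simps)
  show ?case
    by (simp only: closure_trace_Suc[of "Suc 0"] 1 closure_trace_hconst) simp
next
  case (Suc K)
  from Suc.IH[OF partial_closure_hecke_alg[OF Suc.prems]] show ?case
    by (simp add: closure_trace_Suc[of "Suc (Suc K)"] closure_trace_Suc[of "Suc K"] partial_closure_right_hgen)
qed

lemma partial_closure_hgen_0: "partial_closure (hgen 0) = hconst av"
  using partial_closure_values(2)[of 1] by (simp add: hshift_simps)

text \<open>Double coset decomposition with respect to the strands other than the leftmost: a
  nontrivial cycle is \<open>hgen 0\<close> followed by a shifted cycle.\<close>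

lemma hecke_two_types [case_names shift cross add]:
  assumes "\<And>u. P (hup u)" "\<And>u v. P (hup u * (hgen 0 * hup v))"
    and "\<And>x y. P x \<Longrightarrow> P y \<Longrightarrow> P (x + y)"
  shows "P x"
proof (induction x rule: hecke_left_induct)
  case (basis x j)
  show ?case
  proof (cases j)
    case 0
    then show ?thesis using assms(1)[of x] by (simp add: hcycle_0)
  next
    case (Suc i)
    show ?thesis using assms(2)[of x "hcycle i"] by (simp only: Suc hcycle_Suc_left)
  qed
qed (rule assms(3))

text \<open>The two terms come from writing the right-hand \<open>hgen 0\<close> as its inverse plus
  q - 1/q. The scalar part leaves a curl of value a next to x; in the conjugate of
  \<open>hup x\<close> by \<open>hgen 0\<close> it is the first strand of x that gets
  closed.\<close>

lemma partial_closure_sandwich: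
  "partial_closure (hgen 0 * (hup x * hgen 0)) = hconst (zq * av) * x + hup (partial_closure x)"
proof -
  have comm: "hgen 0 * hup (hup w) = hup (hup w) * hgen 0" for w
    using hecke_alg_commute_hshift[OF hecke_alg.gen[of 0 2], of w] by (simp add: hshift_hshift numeral_2_eq_2)
  show ?thesis
  proof (induction x rule: hecke_two_types)
    case (shift u)
    have "hgen 0 * (hup (hup u) * hgen 0) = hup (hup u) * (hgen 0 * hgen 0)"
      by (metis comm mult.assoc)
    also have "\<dots> = hconst zq * (hup (hup u) * hgen 0) + hup (hup u)"
      by (simp add: hgen_square distrib_left hconst_left_commute[of "hup _"])
    finally show ?case
      by (simp only: partial_closure_add partial_closure_hconst partial_closure_values hshift_simps
          hconst_simps mult.assoc)
  next
    case (cross u v)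
    have "hgen 0 * (hup (hup u * (hgen 0 * hup v)) * hgen 0) =
        hgen 0 * hup (hup u) * (hgen (Suc 0) * (hup (hup v) * hgen 0))"
      by (simp add: hshift_simps mult.assoc)
    also have "\<dots> = hup (hup u) * (hgen 0 * (hgen (Suc 0) * hgen 0) * hup (hup v))"
      by (simp add: comm[symmetric, of v]) (simp add: comm mult.assoc)
    also have "hgen 0 * (hgen (Suc 0) * hgen 0) = hup (hgen 0) * (hgen 0 * hup (hgen 0))"
      using hgen_braid[of 0] by (simp add: hshift_simps)
    finally have "partial_closure (hgen 0 * (hup (hup u * (hgen 0 * hup v)) * hgen 0)) =
        hconst av * (hup u * ((hgen 0 * hgen 0) * hup v))"
      by (simp only: partial_closure_left partial_closure_right partial_closure_hgen_0)
        (simp add: hconst_left_commute[of "hgen 0"] hconst_left_commute[of "hup u"] mult.assoc)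
    also have "\<dots> = hconst (zq * av) * (hup u * (hgen 0 * hup v)) + hconst av * hup (u * v)"
      by (simp add: hgen_square distrib_left distrib_right hshift_simps hconst_simps mult.assoc
          hconst_left_commute[of "hup u"] hconst_left_commute[of "hconst av" zq])
    finally show ?case by (simp only: partial_closure_values hshift_simps)
  next
    case (add x y)
    then show ?case by (simp add: hshift_simps distrib_left distrib_right partial_closure_add)
  qed
qed

text \<open>The terms with factor q - 1/q agree at once; one more closure turns both remaining ones
  into \<open>partial_closure u * partial_closure v\<close>.\<close>

lemma closure_trace_sandwich:
  "closure_trace (Suc K) (u * partial_closure (hgen 0 * (hup v * hgen 0))) =
   closure_trace (Suc K) (partial_closure (hgen 0 * (hup u * hgen 0)) * v)"
proof -
  have "closure_trace (Suc K) (u * hup (partial_closure v)) = closure_trace (Suc K) (hup (partial_closure u) * v)"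
    by (simp only: closure_trace_Suc partial_closure_left partial_closure_right)
  then show ?thesis
    by (simp only: partial_closure_sandwich distrib_left distrib_right mult.assoc
        hconst_left_commute[of u] closure_trace_add)
qed

text \<open>The double coset of \<open>hgen 0\<close> is the substantial case: after one closure the
  two orders are the two sides of the sandwich identity.\<close>

lemma closure_trace_hgen_0:
  "closure_trace (Suc (Suc K)) (x * hgen 0) = closure_trace (Suc (Suc K)) (hgen 0 * x)"
proof (induction x rule: hecke_two_types)
  case (shift u)
  have "partial_closure (hgen 0 * hup u) = hconst av * u"
    using partial_closure_values(3)[of 1 u] by (simp add: hshift_simps)
  then show ?case by (simp add: closure_trace_Suc[of "Suc K"] partial_closure_values)
next
  case (cross u v)
  have "partial_closure (hup u * (hgen 0 * hup v) * hgen 0) =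
      u * partial_closure (hgen 0 * (hup v * hgen 0))"
    by (simp add: mult.assoc partial_closure_left[of u])
  moreover have "partial_closure (hgen 0 * (hup u * (hgen 0 * hup v))) =
      partial_closure (hgen 0 * (hup u * hgen 0)) * v"
    using partial_closure_right[of "hgen 0 * (hup u * hgen 0)" v] by (simp add: mult.assoc)
  ultimately show ?case
    by (simp only: closure_trace_Suc[of "Suc K"] closure_trace_sandwich)
next
  case (add x y)
  then show ?case by (simp add: distrib_left distrib_right closure_trace_add)
qed

text \<open>It suffices to move generators. Those other than \<open>hgen 0\<close> are shifts, which
  pass through the closure of the first strand, so the induction on K applies to them;
  \<open>hgen 0\<close> is covered by the preceding lemma.\<close>

lemma closure_trace_commute:
  "x \<in> hecke_alg K \<Longrightarrow> y \<in> hecke_alg K \<Longrightarrow> closure_trace K (x * y) = closure_trace K (y * x)"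
proof (induction K arbitrary: x y)
  case 0
  then obtain c where "x = hconst c" using hecke_alg_le1 by blast
  then show ?case by (simp add: hconst_commute)
next
  case (Suc K)
  from Suc.prems(2,1) show ?case
  proof (induction arbitrary: x rule: hecke_alg.induct)
    case (const c)
    then show ?case by (simp add: hconst_commute)
  next
    case (gen i)
    show ?case
    proof (cases i)
      case 0
      with gen obtain L where "K = Suc L" by (cases K) auto
      then show ?thesis by (simp add: 0 closure_trace_hgen_0)
    next
      case i: (Suc l)
      then have "hgen l \<in> hecke_alg K" using gen by (intro hecke_alg.gen) simp
      from Suc.IH[OF partial_closure_hecke_alg[OF gen(2)] this]
      show ?thesis
        using partial_closure_right[of x "hgen l"] partial_closure_left[of "hgen l" x]
        by (simp add: i closure_trace_Suc hshift_simps)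
    qed
  next
    case (add y z)
    then show ?case by (simp add: distrib_left distrib_right closure_trace_add)
  next
    case (mult y z)
    have "closure_trace (Suc K) (x * (y * z)) = closure_trace (Suc K) (z * x * y)"
      using mult.IH(2)[of "x * y"] mult.prems mult.hyps by (simp add: mult.assoc hecke_alg.mult)
    also have "\<dots> = closure_trace (Suc K) (y * z * x)"
      using mult.IH(1)[of "z * x"] mult.prems mult.hyps by (simp add: mult.assoc hecke_alg.mult)
    finally show ?case .
  qed
qed

theorem closure_trace: "is_jones_ocneanu_trace closure_trace"
  unfolding is_jones_ocneanu_trace_def
proof (intro conjI allI ballI impI)
  show "closure_trace 0 1 = 1" by (simp add: closure_trace_def hchar_simps)
  fix K :: nat and x assume K: "1 \<le> K" "x \<in> hecke_alg K"
  then obtain L where [simp]: "K = Suc L" by (cases K) auto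
  show "closure_trace (K + 1) (x * hgen (K - 1)) = av * closure_trace K x"
    using closure_trace_markov[of x L] K by simp
qed (simp_all add: closure_trace_add closure_trace_hconst hscale_def closure_trace_commute
    closure_trace_stabilize)

section \<open>The trace and the semilinear automorphism\<close>

lemma hprod_hgen_commute:
  "(\<And>k. k \<in> set ws \<Longrightarrow> Suc i < k \<or> Suc k < i) \<Longrightarrow> hprod ws * hgen i = hgen i * hprod ws"
proof (induction ws)
  case (Cons k ws)
  have "hgen k * hgen i = hgen i * hgen k"
    by (rule hgen_far) (use Cons.prems[of k] in auto)
  moreover have "hprod ws * hgen i = hgen i * hprod ws"
    by (rule Cons.IH) (use Cons.prems in auto)
  ultimately show ?case by (simp add: hprod_simps mult.assoc) (metis mult.assoc)
qed (simp add: hprod_simps)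

lemma rev_upt_split: "j \<le> l \<Longrightarrow> l \<le> k \<Longrightarrow> rev [j..<k] = rev [l..<k] @ rev [j..<l]"
  by (metis le_add_diff_inverse rev_append upt_add_eq_append)

text \<open>The braid relation applies to the factors H_i H_{i-1} of the descending product followed
  by H_i and yields a word beginning with H_{i-1}; the factors on either side are far enough to be
  passed.\<close>

lemma descending_hgen:
  assumes "j < i" "i < k"
  shows "hprod (rev [j..<k]) * hgen i = hgen (i - 1) * hprod (rev [j..<k])"
proof -
  obtain l where [simp]: "i = Suc l" using assms(1) by (cases i) auto
  let ?A = "hprod (rev [Suc (Suc l)..<k])" and ?B = "hprod (rev [j..<l])"
  have "rev [j..<k] = rev [Suc (Suc l)..<k] @ rev [j..<Suc (Suc l)]"
    by (rule rev_upt_split) (use assms in auto)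
  also have "rev [j..<Suc (Suc l)] = Suc l # l # rev [j..<l]" using assms by simp
  finally have split: "hprod (rev [j..<k]) = ?A * (hgen (Suc l) * (hgen l * ?B))"
    by (simp only: hprod_simps)
  have A: "?A * hgen l = hgen l * ?A" by (rule hprod_hgen_commute) auto
  have B: "?B * hgen (Suc l) = hgen (Suc l) * ?B" by (rule hprod_hgen_commute) auto
  have "hprod (rev [j..<k]) * hgen i = ?A * (hgen (Suc l) * (hgen l * hgen (Suc l))) * ?B"
    by (simp add: split B mult.assoc)
  also have "\<dots> = ?A * hgen l * (hgen (Suc l) * hgen l * ?B)"
    by (simp add: mult.assoc flip: hgen_braid)
  also have "\<dots> = hgen l * hprod (rev [j..<k])"
    by (simp add: A split mult.assoc)
  finally show ?thesis by simp
qed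

text \<open>The axioms of the trace add a strand on the right, hence this mirror version of the
  decomposition, with the descending words H_{K-1} ... H_j as coset representatives. A nonempty one
  starts with the last generator, which gives the form in \<open>cross\<close>.\<close>

lemma hecke_alg_right_induct [consumes 1, case_names sub cross add]:
  assumes "y \<in> hecke_alg (Suc K)"
    and sub: "\<And>x. x \<in> hecke_alg K \<Longrightarrow> P x"
    and cross: "\<And>x u. x \<in> hecke_alg K \<Longrightarrow> u \<in> hecke_alg K \<Longrightarrow> 1 \<le> K \<Longrightarrow> P (x * (hgen (K - 1) * u))"
    and add: "\<And>x y. x \<in> hecke_alg (Suc K) \<Longrightarrow> y \<in> hecke_alg (Suc K) \<Longrightarrow> P x \<Longrightarrow> P y \<Longrightarrow> P (x + y)"
  shows "P y"
proof -
  define c where "c = (\<lambda>j. hprod (rev [j..<K]))"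
  define B where "B = {x * c j | x j. x \<in> hecke_alg K \<and> j \<le> K}"
  have BI: "x * c j \<in> B" if "x \<in> hecke_alg K" "j \<le> K" for x j
    using that by (auto simp: B_def)
  have const: "x * c j * hconst d \<in> B" if "x \<in> hecke_alg K" "j \<le> K" for x j d
    using BI[of "hconst d * x" j] that by (simp add: hecke_alg.intros mult.assoc hconst_commute)
  have c_Suc: "c j = c (Suc j) * hgen j" if "j < K" for j
  proof -
    have "rev [j..<K] = rev [Suc j..<K] @ [j]"
      using that by (simp add: upt_conv_Cons)
    then show ?thesis by (simp add: c_def hprod_simps)
  qed
  have "y \<in> add_span B"
    using assms(1)
  proof (rule hecke_alg_add_span)
    show "1 \<in> B" using BI[of 1 K] by (simp add: c_def hprod_simps hecke_alg_1)
  next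
    fix b d assume "b \<in> B"
    then show "b * hconst d \<in> add_span B"
      using const unfolding B_def by (blast intro: add_span.base)
  next
    fix b i assume "b \<in> B" and i: "Suc i < Suc K"
    then obtain x j where b: "b = x * c j" and x: "x \<in> hecke_alg K" "j \<le> K"
      unfolding B_def by blast
    consider "j < i" | "i = j" | "j = Suc i" | "Suc i < j" by linarith
    then show "b * hgen i \<in> add_span B"
    proof cases
      case 1
      have "hgen (i - 1) \<in> hecke_alg K"
        by (rule hecke_alg.gen) (use 1 i in simp)
      with x have "x * hgen (i - 1) \<in> hecke_alg K" by (intro hecke_alg.mult)
      from BI[OF this x(2)] 1 i show ?thesis
        by (simp add: b c_def mult.assoc descending_hgen add_span.base)
    next
      case 2
      have "c j * hgen i = c j * hconst zq + c (Suc i)"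
        using i 2 by (simp add: c_Suc[of j] mult.assoc hgen_square distrib_left hconst_commute
            hconst_left_commute[of "c _"])
      moreover have "x * c (Suc i) \<in> B" using x i by (intro BI) auto
      ultimately show ?thesis
        using const[OF x, of zq] by (simp add: b distrib_left mult.assoc add_span.intros)
    next
      case 3
      with BI[of x i] x i c_Suc[of i] show ?thesis by (simp add: b mult.assoc add_span.base)
    next
      case 4
      then have "x * hgen i \<in> hecke_alg K"
        using x by (intro hecke_alg.mult hecke_alg.gen) auto
      moreover have "c j * hgen i = hgen i * c j"
        unfolding c_def by (rule hprod_hgen_commute) (use 4 in auto)
      ultimately show ?thesis
        using BI[of "x * hgen i" j] x by (simp add: b mult.assoc add_span.base)
    qed
  qed
  then have "y \<in> hecke_alg (Suc K) \<and> P y"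
  proof induction
    case (base b)
    then obtain x j where b: "b = x * c j" and x: "x \<in> hecke_alg K" "j \<le> K"
      unfolding B_def by blast
    then have x': "x \<in> hecke_alg (Suc K)" by (auto elim: hecke_alg_mono)
    have "x * c j \<in> hecke_alg (Suc K) \<and> P (x * c j)"
    proof (cases "j = K")
      case True
      then show ?thesis using x x' sub by (simp add: c_def hprod_simps)
    next
      case False
      then obtain L where L: "K = Suc L" "j \<le> L" using x(2) by (cases K) auto
      then have "c j = hgen (K - 1) * hprod (rev [j..<L])"
        by (simp add: c_def hprod_simps)
      moreover have "hprod (rev [j..<L]) \<in> hecke_alg K"
        using L by (intro hprod_hecke_alg) auto
      moreover have "c j \<in> hecke_alg (Suc K)"
        unfolding c_def by (intro hprod_hecke_alg) auto
      ultimately show ?thesis using cross[OF x(1)] x' L by (auto intro: hecke_alg.mult)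
    qed
    then show ?case by (simp only: b)
  qed (auto intro: add hecke_alg.add)
  then show ?thesis by blast
qed

text \<open>A choice made by \<open>SOME\<close> obeys the axioms once a map obeying them
  exists.\<close>

lemma jones_ocneanu_trace_is_trace: "is_jones_ocneanu_trace jones_ocneanu_trace"
  unfolding jones_ocneanu_trace_def by (rule someI[of is_jones_ocneanu_trace, OF closure_trace])

lemma trace_add:
  "x \<in> hecke_alg K \<Longrightarrow> y \<in> hecke_alg K \<Longrightarrow>
    jones_ocneanu_trace K (x + y) = jones_ocneanu_trace K x + jones_ocneanu_trace K y"
  and trace_hscale: "x \<in> hecke_alg K \<Longrightarrow> jones_ocneanu_trace K (c *\<^sub>H x) = c * jones_ocneanu_trace K x"
  and trace_0: "jones_ocneanu_trace 0 1 = 1"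
  and trace_commute: "x \<in> hecke_alg K \<Longrightarrow> y \<in> hecke_alg K \<Longrightarrow>
    jones_ocneanu_trace K (x * y) = jones_ocneanu_trace K (y * x)"
  and trace_stabilize: "x \<in> hecke_alg K \<Longrightarrow> jones_ocneanu_trace (Suc K) x = circle * jones_ocneanu_trace K x"
  and trace_markov: "x \<in> hecke_alg K \<Longrightarrow> 1 \<le> K \<Longrightarrow>
    jones_ocneanu_trace (Suc K) (x * hgen (K - 1)) = av * jones_ocneanu_trace K x"
  using jones_ocneanu_trace_is_trace unfolding is_jones_ocneanu_trace_def Suc_eq_plus1[symmetric] by blast+

text \<open>Each strand accounts for one sign. When it closes to a circle, the value of the circle
  is negated by inverting q; when it is removed by the Markov rule, a is fixed but the crossing
  removed is negated by \<open>hphi\<close>.\<close>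

lemma hphi_trace:
  "x \<in> hecke_alg K \<Longrightarrow> jones_ocneanu_trace K (hphi x) = (- 1) ^ K * subst_q_inverse (jones_ocneanu_trace K x)"
proof (induction K arbitrary: x)
  case 0
  then obtain c where x: "x = hconst c" using hecke_alg_le1 by blast
  have "jones_ocneanu_trace 0 (hconst d) = d" for d
    using trace_hscale[OF hecke_alg_1[of 0], of d] trace_0 by (simp add: hscale_def)
  then show ?case by (simp add: x hphi_simps)
next
  case (Suc K)
  have circ: "subst_q_inverse circle = - circle"
    by (simp add: subst_simps) (metis minus_diff_eq minus_divide_right)
  from Suc.prems show ?case
  proof (induction rule: hecke_alg_right_induct)
    case (sub x)
    show ?case
      by (simp only: trace_stabilize[OF sub] trace_stabilize[OF hecke_alg_hphi[OF sub]]
          Suc.IH[OF sub] subst_hom circ) simp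
  next
    case (cross x u)
    \<comment> \<open>Cyclicity brings the last generator to the end, where the Markov rule
      applies.\<close>
    have *: "jones_ocneanu_trace (Suc K) (v * (hgen (K - 1) * w)) = av * jones_ocneanu_trace K (w * v)"
      if "v \<in> hecke_alg K" "w \<in> hecke_alg K" for v w
    proof -
      have h: "hgen (K - 1) \<in> hecke_alg (Suc K)" using cross(3) by (intro hecke_alg.gen) simp
      have vw: "v \<in> hecke_alg (Suc K)" "w \<in> hecke_alg (Suc K)"
        using that by (auto elim: hecke_alg_mono)
      have "jones_ocneanu_trace (Suc K) ((v * hgen (K - 1)) * w) =
          jones_ocneanu_trace (Suc K) (w * (v * hgen (K - 1)))"
        by (intro trace_commute hecke_alg.mult h vw)
      also have "\<dots> = av * jones_ocneanu_trace K (w * v)"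
        using trace_markov[OF hecke_alg.mult[OF that(2,1)] cross(3)] by (simp only: mult.assoc)
      finally show ?thesis by (simp only: mult.assoc)
    qed
    have "hphi (x * (hgen (K - 1) * u)) = (- 1) *\<^sub>H (hphi x * (hgen (K - 1) * hphi u))"
      by (simp add: hphi_simps hscale_minus_left hscale_simps)
    then have "jones_ocneanu_trace (Suc K) (hphi (x * (hgen (K - 1) * u))) =
        - (av * jones_ocneanu_trace K (hphi (u * x)))"
      using cross hecke_alg_hphi
      by (simp add: trace_hscale hphi_simps hecke_alg.intros hecke_alg_mono[of _ K "Suc K"] * del: One_nat_def)
    also have "\<dots> = (- 1) ^ Suc K * subst_q_inverse (av * jones_ocneanu_trace K (u * x))"
      using Suc.IH[OF hecke_alg.mult[OF cross(2,1)]] by (simp add: subst_simps)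
    finally show ?case using *[OF cross(1,2)] by simp
  next
    case (add x y)
    then show ?case by (simp add: hphi_simps trace_add hecke_alg_hphi subst_hom distrib_left)
  qed
qed

section \<open>Sliding elements through cabled braids\<close>

lemma slide_hshift:
  assumes "\<And>i. Suc i < m \<Longrightarrow> z * hgen (p + i) = hgen (p' + i) * z" "u \<in> hecke_alg m"
  shows "z * hshift p u = hshift p' u * z"
  using assms(2)
proof induction
  case (const c)
  then show ?case by (simp add: hshift_simps hconst_commute)
next
  case (gen i)
  then show ?case by (simp add: hshift_simps assms(1))
next
  case (add x y)
  then show ?case by (simp add: hshift_simps distrib_left distrib_right)
next
  case (mult x y)
  then show ?case by (simp add: hshift_simps) (metis mult.assoc)
qed

text \<open>A single strand passing over \<open>n\<close> strands is \<open>H\<^bsub>k+n-1\<^esub> \<dots> H\<^sub>k\<close>.\<close>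

lemma two_descending_hgen:
  "hprod (rev [k..<k + n]) * hprod (rev [Suc k..<Suc k + n]) * hgen k =
   hgen (k + n) * hprod (rev [k..<k + n]) * hprod (rev [Suc k..<Suc k + n])"
proof (induction n)
  case (Suc n)
  let ?A = "hprod (rev [k..<k + n])" and ?B = "hprod (rev [Suc k..<Suc k + n])"
  let ?h = "hgen (k + n)" and ?h' = "hgen (Suc (k + n))"
  have A: "?A * ?h' = ?h' * ?A" by (rule hprod_hgen_commute) auto
  have "rev [k..<k + Suc n] = (k + n) # rev [k..<k + n]"
    "rev [Suc k..<Suc k + Suc n] = Suc (k + n) # rev [Suc k..<Suc k + n]"
    by simp_all
  then have split: "hprod (rev [k..<k + Suc n]) = ?h * ?A"
    "hprod (rev [Suc k..<Suc k + Suc n]) = ?h' * ?B"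
    by (simp_all only: hprod_simps)
  have "?h * ?A * (?h' * ?B) * hgen k = ?h * (?A * ?h') * ?B * hgen k"
    by (simp only: mult.assoc)
  also have "\<dots> = ?h * ?h' * (?A * ?B * hgen k)"
    by (simp only: A mult.assoc)
  also have "\<dots> = ?h * (?h' * ?h) * (?A * ?B)"
    unfolding Suc by (simp only: mult.assoc)
  also have "\<dots> = ?h' * ?h * (?h' * ?A) * ?B"
    unfolding hgen_braid by (simp only: mult.assoc)
  also have "\<dots> = ?h' * (?h * ?A) * (?h' * ?B)"
    unfolding A[symmetric] by (simp only: mult.assoc)
  finally show ?case unfolding split by (simp only: add_Suc_right mult.assoc)
qed (simp add: hprod_simps)

lemma braid_hecke_positive: "braid_hecke (map (\<lambda>i. (i, True)) ws) = hprod ws"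
  by (simp add: braid_hecke_def hprod_def comp_def)

lemma cable_positive_Suc:
  "cable_positive p (Suc m) n = cable_positive p m n @ map (\<lambda>i. (i, True)) (rev [p + m..<p + m + n])"
  by (simp add: cable_positive_def)

lemma cable_positive_0: "cable_positive p 0 n = []"
  by (simp add: cable_positive_def)

lemma cable_positive_far:
  assumes "Suc i < p \<or> p + m + n \<le> i"
  shows "braid_hecke (cable_positive p m n) * hgen i = hgen i * braid_hecke (cable_positive p m n)"
  using assms
proof (induction m)
  case (Suc m)
  let ?B = "hprod (rev [p + m..<p + m + n])"
  have "?B * hgen i = hgen i * ?B" by (rule hprod_hgen_commute) (use Suc.prems in auto)
  moreover have "braid_hecke (cable_positive p m n) * hgen i = hgen i * braid_hecke (cable_positive p m n)"
    using Suc by auto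
  ultimately show ?case
    by (simp add: cable_positive_Suc braid_hecke_simps braid_hecke_positive mult.assoc) (metis mult.assoc)
qed (simp add: cable_positive_0 braid_hecke_simps)

lemma cable_positive_right:
  assumes "Suc i < n"
  shows "braid_hecke (cable_positive p m n) * hgen (p + m + i) = hgen (p + i) * braid_hecke (cable_positive p m n)"
proof (induction m)
  case (Suc m)
  let ?B = "hprod (rev [p + m..<p + m + n])"
  have "?B * hgen (p + Suc m + i) = hgen (p + m + i) * ?B"
    using descending_hgen[of "p + m" "p + Suc m + i" "p + m + n"] assms by simp
  with Suc show ?case
    by (simp add: cable_positive_Suc braid_hecke_simps braid_hecke_positive mult.assoc) (metis mult.assoc)
qed (simp add: cable_positive_0 braid_hecke_simps)

text \<open>Strands of the left cable beyond i + 1 commute with the generator; the two strands that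
  it joins carry it across the right cable, which is \<open>two_descending_hgen\<close>; the strands
  before them then lie away from it.\<close>

lemma cable_positive_left:
  assumes "Suc i < m"
  shows "braid_hecke (cable_positive p m n) * hgen (p + i) = hgen (p + n + i) * braid_hecke (cable_positive p m n)"
  using assms
proof (induction m)
  case (Suc m)
  let ?X = "\<lambda>m. braid_hecke (cable_positive p m n)"
  let ?B = "\<lambda>m. hprod (rev [p + m..<p + m + n])"
  have X_Suc: "?X (Suc k) = ?X k * ?B k" for k
    by (simp add: cable_positive_Suc braid_hecke_simps braid_hecke_positive)
  show ?case
  proof (cases "Suc i < m")
    case True
    have "?B m * hgen (p + i) = hgen (p + i) * ?B m"
      by (rule hprod_hgen_commute) (use True in auto)
    with Suc.IH[OF True] show ?thesis by (simp add: X_Suc mult.assoc) (metis mult.assoc)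
  next
    case False
    with Suc.prems have [simp]: "m = Suc i" by simp
    have B: "?B i * ?B (Suc i) * hgen (p + i) = hgen (p + i + n) * ?B i * ?B (Suc i)"
      using two_descending_hgen[of "p + i" n] by simp
    have X: "?X i * hgen (p + i + n) = hgen (p + i + n) * ?X i"
      by (rule cable_positive_far) simp
    have X_m: "?X (Suc m) = ?X i * (?B i * ?B (Suc i))"
      by (simp only: \<open>m = Suc i\<close> X_Suc mult.assoc)
    have "?X (Suc m) * hgen (p + i) = ?X i * (?B i * ?B (Suc i) * hgen (p + i))"
      by (simp only: X_m mult.assoc)
    also have "\<dots> = (?X i * hgen (p + i + n)) * (?B i * ?B (Suc i))"
      unfolding B by (simp only: mult.assoc)
    also have "\<dots> = hgen (p + i + n) * ?X (Suc m)"
      by (simp only: X X_m mult.assoc)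
    also have "p + i + n = p + n + i" by simp
    finally show ?thesis .
  qed
qed simp

section \<open>Elements placed on the cables of a braid\<close>

definition cables :: "nat \<Rightarrow> (nat \<Rightarrow> nat) \<Rightarrow> (nat \<Rightarrow> hecke) \<Rightarrow> hecke" where
  "cables N sz u = juxtapose (map (\<lambda>j. (sz j, u j)) [0..<N])"

lemma sum_list_upt: "sum_list (map f [0..<n]) = (\<Sum>j<n. f j)" for f :: "nat \<Rightarrow> nat"
  by (simp add: interv_sum_list_conv_sum_set_nat atLeast0LessThan)

lemma cables_hecke_alg:
  assumes "\<And>j. j < N \<Longrightarrow> u j \<in> hecke_alg (sz j)"
  shows "cables N sz u \<in> hecke_alg (\<Sum>j<N. sz j)"
proof -
  have "cables N sz u \<in> hecke_alg (sum_list (map fst (map (\<lambda>j. (sz j, u j)) [0..<N])))"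
    unfolding cables_def by (rule juxtapose_hecke_alg) (use assms in auto)
  then show ?thesis by (simp add: comp_def sum_list_upt)
qed

lemma cables_cong: "(\<And>j. j < N \<Longrightarrow> sz j = sz' j) \<Longrightarrow> (\<And>j. j < N \<Longrightarrow> u j = u' j) \<Longrightarrow> cables N sz u = cables N sz' u'"
  unfolding cables_def by (intro arg_cong[of _ _ juxtapose] map_cong) auto

lemma hphi_cables: "hphi (cables N sz u) = cables N sz (\<lambda>j. hphi (u j))"
  by (simp add: cables_def hphi_juxtapose comp_def)

text \<open>Interchange law: \<open>y j\<close> can pass the later factors of x because these are
  shifted beyond its strands.\<close>

lemma juxtapose_mult:
  assumes "\<And>j. j \<in> set js \<Longrightarrow> y j \<in> hecke_alg (sz j)"
  shows "juxtapose (map (\<lambda>j. (sz j, x j * y j)) js) =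
    juxtapose (map (\<lambda>j. (sz j, x j)) js) * juxtapose (map (\<lambda>j. (sz j, y j)) js)"
  using assms
proof (induction js)
  case (Cons j js)
  have "hshift (sz j) z * y j = y j * hshift (sz j) z" for z
    by (rule hecke_alg_commute_hshift) (use Cons.prems in auto)
  note comm = this
  let ?J = "\<lambda>x. hshift (sz j) (juxtapose (map (\<lambda>j. (sz j, x j)) js))"
  have IH: "juxtapose (map (\<lambda>j. (sz j, x j * y j)) js) =
      juxtapose (map (\<lambda>j. (sz j, x j)) js) * juxtapose (map (\<lambda>j. (sz j, y j)) js)"
    by (rule Cons.IH) (use Cons.prems in auto)
  have "x j * y j * (?J x * ?J y) = x j * (y j * ?J x) * ?J y"
    by (simp only: mult.assoc)
  also have "\<dots> = x j * ?J x * (y j * ?J y)"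
    by (simp only: mult.assoc flip: comm)
  finally show ?case by (simp only: list.map juxtapose.simps IH hshift_simps)
qed simp

lemma cables_mult:
  "(\<And>j. j < N \<Longrightarrow> y j \<in> hecke_alg (sz j)) \<Longrightarrow> cables N sz (\<lambda>j. x j * y j) = cables N sz x * cables N sz y"
  unfolding cables_def by (rule juxtapose_mult) auto

lemma cables_split:
  assumes "Suc i < N"
  shows "cables N sz u = cables i sz u * hshift (\<Sum>j<i. sz j) (u i) * hshift ((\<Sum>j<i. sz j) + sz i) (u (Suc i)) *
    hshift ((\<Sum>j<i. sz j) + sz i + sz (Suc i)) (juxtapose (map (\<lambda>j. (sz j, u j)) [Suc (Suc i)..<N]))"
proof -
  have "[0..<N] = [0..<i] @ i # Suc i # [Suc (Suc i)..<N]"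
    using assms by (metis upt_conv_Cons Suc_lessD le0 less_imp_le upt_add_eq_append le_add_diff_inverse)
  then show ?thesis
    by (simp add: cables_def juxtapose_append hshift_simps hshift_hshift mult.assoc comp_def sum_list_upt add.assoc)
qed

lemma cables_adj_split:
  assumes "Suc i < N"
  shows "cables N (sz \<circ> adj i) (u \<circ> adj i) =
    cables i sz u * hshift (\<Sum>j<i. sz j) (u (Suc i)) * hshift ((\<Sum>j<i. sz j) + sz (Suc i)) (u i) *
    hshift ((\<Sum>j<i. sz j) + sz i + sz (Suc i)) (juxtapose (map (\<lambda>j. (sz j, u j)) [Suc (Suc i)..<N]))"
proof -
  have 1: "cables i (sz \<circ> adj i) (u \<circ> adj i) = cables i sz u"
    by (rule cables_cong) auto
  have 2: "(\<Sum>j<i. (sz \<circ> adj i) j) = (\<Sum>j<i. sz j)"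
    by (rule sum.cong) auto
  have 3: "map (\<lambda>j. ((sz \<circ> adj i) j, (u \<circ> adj i) j)) [Suc (Suc i)..<N] =
      map (\<lambda>j. (sz j, u j)) [Suc (Suc i)..<N]"
    by (rule map_cong) auto
  show ?thesis
    unfolding cables_split[OF assms, of "sz \<circ> adj i" "u \<circ> adj i"] 1 2 3
    by (simp add: add.commute add.left_commute)
qed

text \<open>Four groups of factors are moved through the crossing separately. Those to its left and
  right commute with it, and those on the two crossing cables trade places, after which they commute
  with each other.\<close>

lemma cable_positive_slide:
  assumes i: "Suc i < N" and u: "\<And>j. j < N \<Longrightarrow> u j \<in> hecke_alg (sz j)"
  defines "z \<equiv> braid_hecke (cable_positive (\<Sum>j<i. sz j) (sz i) (sz (Suc i)))"
  shows "z * cables N sz u = cables N (sz \<circ> adj i) (u \<circ> adj i) * z"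
proof -
  define p where "p = (\<Sum>j<i. sz j)"
  define m where "m = sz i"
  define n where "n = sz (Suc i)"
  define A where "A = cables i sz u"
  define R where "R = juxtapose (map (\<lambda>j. (sz j, u j)) [Suc (Suc i)..<N])"
  note defs = p_def[symmetric] m_def[symmetric] n_def[symmetric] A_def[symmetric] R_def[symmetric]
  have z: "z = braid_hecke (cable_positive p m n)" unfolding z_def defs ..
  have "A \<in> hecke_alg p" unfolding A_def p_def using i u by (intro cables_hecke_alg) auto
  then have "z * hshift 0 A = hshift 0 A * z"
    unfolding z by (rule slide_hshift[rotated]) (simp add: cable_positive_far)
  then have zA: "z * A = A * z" by (simp add: hshift_0)
  have um: "u i \<in> hecke_alg m" and un: "u (Suc i) \<in> hecke_alg n"
    unfolding m_def n_def using i u by auto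
  have zm: "z * hshift p (u i) = hshift (p + n) (u i) * z"
    unfolding z by (rule slide_hshift[OF _ um]) (rule cable_positive_left)
  have zn: "z * hshift (p + m) (u (Suc i)) = hshift p (u (Suc i)) * z"
    unfolding z by (rule slide_hshift[OF _ un]) (rule cable_positive_right)
  \<comment> \<open>\<open>slide_hshift\<close> asks for a bound on the strands that R occupies; any
    bound will do.\<close>
  obtain K where "R \<in> hecke_alg (Suc K)" using hecke_alg_exhausts by blast
  then have zR: "z * hshift (p + m + n) R = hshift (p + m + n) R * z"
    unfolding z by (rule slide_hshift[rotated]) (simp add: cable_positive_far)
  have swap: "hshift (p + n) (u i) * hshift p (u (Suc i)) = hshift p (u (Suc i)) * hshift (p + n) (u i)"
    using arg_cong[OF hecke_alg_commute_hshift[OF un, of "u i"], of "hshift p"]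
    by (simp add: hshift_simps hshift_hshift)
  have "z * cables N sz u = z * A * hshift p (u i) * hshift (p + m) (u (Suc i)) * hshift (p + m + n) R"
    unfolding cables_split[OF i, of sz u] defs by (simp only: mult.assoc)
  also have "\<dots> = A * (z * hshift p (u i)) * hshift (p + m) (u (Suc i)) * hshift (p + m + n) R"
    by (simp only: zA mult.assoc)
  also have "\<dots> = A * hshift (p + n) (u i) * (z * hshift (p + m) (u (Suc i))) * hshift (p + m + n) R"
    by (simp only: zm mult.assoc)
  also have "\<dots> = A * (hshift (p + n) (u i) * hshift p (u (Suc i))) * (z * hshift (p + m + n) R)"
    by (simp only: zn mult.assoc)
  also have "\<dots> = A * hshift p (u (Suc i)) * hshift (p + n) (u i) * hshift (p + m + n) R * z"
    by (simp only: swap zR mult.assoc)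
  also have "\<dots> = cables N (sz \<circ> adj i) (u \<circ> adj i) * z"
    unfolding cables_adj_split[OF i, of sz u] defs ..
  finally show ?thesis .
qed

lemma cable_crossing_slide:
  fixes s :: bool
  assumes i: "Suc i < N" and u: "\<And>j. j < N \<Longrightarrow> u j \<in> hecke_alg (sz j)"
  defines "z \<equiv> braid_hecke (cable_crossing sz (i, s))"
  shows "z * cables N sz u = cables N (sz \<circ> adj i) (u \<circ> adj i) * z"
proof (cases s)
  case True
  then show ?thesis
    using cable_positive_slide[OF i, of u sz] u by (simp add: z_def cable_crossing_def Let_def)
next
  case False
  let ?sz = "sz \<circ> adj i" and ?u = "u \<circ> adj i"
  \<comment> \<open>A negative crossing is the inverse of the positive one with the two cables in
    exchanged order, so the rule for the latter is multiplied by the inverse on both sides.\<close>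
  let ?b = "cable_positive (\<Sum>j<i. sz j) (sz (Suc i)) (sz i)"
  define y where "y = braid_hecke ?b"
  have z: "z = braid_hecke (braid_inverse ?b)"
    using False by (simp add: z_def cable_crossing_def Let_def)
  have "(\<Sum>j<i. ?sz j) = (\<Sum>j<i. sz j)" by (rule sum.cong) auto
  then have y: "y = braid_hecke (cable_positive (\<Sum>j<i. ?sz j) (?sz i) (?sz (Suc i)))"
    by (simp add: y_def)
  have "adj i j < N" if "j < N" for j using i that by (auto simp: transpose_def)
  then have "y * cables N ?sz ?u = cables N (?sz \<circ> adj i) (?u \<circ> adj i) * y"
    unfolding y by (intro cable_positive_slide i) (simp add: u)
  moreover have "?sz \<circ> adj i = sz" "?u \<circ> adj i = u" by (simp_all add: comp_assoc)
  ultimately have *: "y * cables N ?sz ?u = cables N sz u * y" by (simp only:)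
  have zy: "z * y = 1" "y * z = 1"
    by (simp_all add: z y_def braid_hecke_inverse braid_hecke_inverse_left)
  have "z * cables N sz u = z * (cables N sz u * y) * z" by (simp only: mult.assoc zy mult_1_right)
  also have "\<dots> = (z * y) * cables N ?sz ?u * z" by (simp only: *[symmetric] mult.assoc)
  finally show ?thesis by (simp only: zy mult_1_left)
qed

lemma braid_perm_permutes: "is_braid N b \<Longrightarrow> braid_perm b permutes {..<N}"
  unfolding braid_perm_def by (rule word_perm_permutes) (auto simp: is_braid_def)

lemma braid_perm_Cons: "braid_perm ((i, s) # b) = adj i \<circ> braid_perm b"
  by (simp add: braid_perm_def)

lemma inv_braid_perm_Cons: "inv (braid_perm ((i, s) # b)) = inv (braid_perm b) \<circ> adj i"
  unfolding braid_perm_Cons by (rule inv_adj_comp) (simp add: braid_perm_def bij_word_perm)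

lemma inv_braid_perm_less: "is_braid N b \<Longrightarrow> j < N \<Longrightarrow> inv (braid_perm b) j < N"
  using permutes_in_image[OF permutes_inv[OF braid_perm_permutes], of N b j] by simp

lemma cable_slide:
  assumes "is_braid N b" "\<And>j. j < N \<Longrightarrow> u j \<in> hecke_alg (sz j)"
  shows "braid_hecke (cable sz b) * cables N sz u =
    cables N (sz \<circ> inv (braid_perm b)) (u \<circ> inv (braid_perm b)) * braid_hecke (cable sz b)"
  using assms
proof (induction b)
  case Nil
  have "inv (braid_perm []) = id" by (simp add: braid_perm_def del: id_apply)
  then show ?case by (simp add: braid_hecke_simps)
next
  case (Cons g b)
  obtain i s where g: "g = (i, s)" by (cases g)
  then have b: "Suc i < N" "is_braid N b" using Cons.prems(1) by (simp_all add: is_braid_simps)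
  let ?sz = "sz \<circ> inv (braid_perm b)" and ?u = "u \<circ> inv (braid_perm b)"
  let ?z = "braid_hecke (cable_crossing ?sz (i, s))"
  have IH: "braid_hecke (cable sz b) * cables N sz u = cables N ?sz ?u * braid_hecke (cable sz b)"
    by (rule Cons.IH[OF b(2)]) (rule Cons.prems(2))
  have "braid_hecke (cable sz (g # b)) * cables N sz u = ?z * (braid_hecke (cable sz b) * cables N sz u)"
    by (simp add: g braid_hecke_simps mult.assoc)
  also have "\<dots> = ?z * cables N ?sz ?u * braid_hecke (cable sz b)"
    by (simp only: IH mult.assoc)
  also have "?z * cables N ?sz ?u = cables N (?sz \<circ> adj i) (?u \<circ> adj i) * ?z"
    by (rule cable_crossing_slide[OF b(1)]) (simp add: Cons.prems(2) inv_braid_perm_less b(2))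
  finally show ?case
    by (simp add: g inv_braid_perm_Cons braid_hecke_simps mult.assoc comp_assoc del: o_apply)
qed

lemma is_braid_cable_positive:
  assumes "p + m + n \<le> K"
  shows "is_braid K (cable_positive p m n)"
  using assms by (auto simp: is_braid_def cable_positive_def)

lemma is_braid_cable:
  assumes "is_braid N b"
  shows "is_braid (\<Sum>j<N. sz j) (cable sz b)"
  using assms
proof (induction b)
  case (Cons g b)
  obtain i s where g: "g = (i, s)" by (cases g)
  then have b: "Suc i < N" "is_braid N b" using Cons.prems by (simp_all add: is_braid_simps)
  define sz' where "sz' = sz \<circ> inv (braid_perm b)"
  have "(\<Sum>j<i. sz' j) + sz' i + sz' (Suc i) = (\<Sum>j<Suc (Suc i). sz' j)" by simp
  also have "\<dots> \<le> (\<Sum>j<N. sz' j)" using b(1) by (intro sum_mono2) auto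
  also have "\<dots> = (\<Sum>j<N. sz j)"
    unfolding sz'_def o_def
    by (rule sum.reindex_bij_betw[OF permutes_imp_bij[OF permutes_inv[OF braid_perm_permutes[OF b(2)]]]])
  finally have le: "(\<Sum>j<i. sz' j) + sz' i + sz' (Suc i) \<le> (\<Sum>j<N. sz j)" .
  then have "is_braid (\<Sum>j<N. sz j) (cable_crossing sz' (i, s))"
    by (auto simp: cable_crossing_def Let_def is_braid_simps intro!: is_braid_cable_positive)
  then show ?case using Cons.IH[OF b(2)] by (simp add: g is_braid_simps sz'_def)
qed (simp add: is_braid_simps)

text \<open>Sizes and y are constant along the permutation of the braid, so y slides through the
  whole cabled braid and reappears unchanged; it commutes with that braid. The trace property then
  brings it from behind x to the front of x.\<close>

lemma trace_cables_cyclic: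
  assumes b: "is_braid N b"
    and inv: "\<And>j. j < N \<Longrightarrow> sz (inv (braid_perm b) j) = sz j" "\<And>j. j < N \<Longrightarrow> y (inv (braid_perm b) j) = y j"
    and alg: "\<And>j. j < N \<Longrightarrow> x j \<in> hecke_alg (sz j)" "\<And>j. j < N \<Longrightarrow> y j \<in> hecke_alg (sz j)"
  shows "jones_ocneanu_trace (\<Sum>j<N. sz j) (braid_hecke (cable sz b) * cables N sz (\<lambda>j. x j * y j)) =
    jones_ocneanu_trace (\<Sum>j<N. sz j) (braid_hecke (cable sz b) * cables N sz (\<lambda>j. y j * x j))"
proof -
  let ?z = "braid_hecke (cable sz b)"
  have z: "?z \<in> hecke_alg (\<Sum>j<N. sz j)" by (intro braid_hecke_alg is_braid_cable b)
  have X: "cables N sz x \<in> hecke_alg (\<Sum>j<N. sz j)" and Y: "cables N sz y \<in> hecke_alg (\<Sum>j<N. sz j)"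
    using alg by (auto intro: cables_hecke_alg)
  have "cables N (sz \<circ> inv (braid_perm b)) (y \<circ> inv (braid_perm b)) = cables N sz y"
    using inv by (intro cables_cong) auto
  then have slide: "?z * cables N sz y = cables N sz y * ?z"
    using cable_slide[of N b y sz] b alg(2) by simp
  have "jones_ocneanu_trace (\<Sum>j<N. sz j) (?z * cables N sz x * cables N sz y) =
      jones_ocneanu_trace (\<Sum>j<N. sz j) (cables N sz y * (?z * cables N sz x))"
    by (intro trace_commute hecke_alg.mult z X Y)
  also have "?z * cables N sz x * cables N sz y = ?z * cables N sz (\<lambda>j. x j * y j)"
    by (simp only: cables_mult[OF alg(2)] mult.assoc)
  also have "cables N sz y * (?z * cables N sz x) = ?z * cables N sz (\<lambda>j. y j * x j)"
    by (simp only: cables_mult[OF alg(1)] mult.assoc[symmetric] slide)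
  finally show ?thesis .
qed

section \<open>The sign of a cabled braid\<close>

text \<open>The number of crossings after cabling: the inverse permutation finds the bottom
  positions, and thereby the widths, of the two cables that meet at a letter.\<close>

fun crossing_weight :: "(nat \<Rightarrow> nat) \<Rightarrow> nat list \<Rightarrow> nat" where
  "crossing_weight sz [] = 0"
| "crossing_weight sz (i # ws) =
     sz (inv (word_perm ws) i) * sz (inv (word_perm ws) (Suc i)) + crossing_weight sz ws"

text \<open>The sign of the block permutation in which position a is replaced by \<open>sz a\<close>
  positions: an inversion (a, b) of w becomes \<open>sz a * sz b\<close> inversions.\<close>

definition weighted_sign :: "(nat \<Rightarrow> nat) \<Rightarrow> (nat \<Rightarrow> nat) \<Rightarrow> int" where
  "weighted_sign sz w = (- 1) ^ (\<Sum>(a, b)\<in>invs w. sz a * sz b)"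

lemma weighted_sign_adj:
  assumes "bij w" "finite (invs w)"
  shows "weighted_sign sz (adj i \<circ> w) = (- 1) ^ (sz (inv w i) * sz (inv w (Suc i))) * weighted_sign sz w"
  using assms(1)
proof (cases rule: bij_cases_inv[of w i])
  case 1
  then show ?thesis
    using invs_up[OF assms(1)] assms(2) by (simp add: weighted_sign_def power_add)
next
  case 2
  have "finite (invs (adj i \<circ> w))" using assms by (simp add: finite_invs_adj)
  then have "weighted_sign sz w =
      (- 1) ^ (sz (inv w (Suc i)) * sz (inv w i)) * weighted_sign sz (adj i \<circ> w)"
    using invs_down(2)[OF assms(1) 2]
    unfolding weighted_sign_def invs_down(1)[OF assms(1) 2] by (simp add: power_add)
  moreover have "(- 1) ^ n * ((- 1) ^ n * x) = (x :: int)" for n x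
    by (simp flip: mult.assoc power_mult_distrib)
  ultimately show ?thesis by (simp add: mult.commute[of "sz _" "sz _"])
qed

text \<open>A letter that undoes an inversion changes the exponent by the same parity as one that
  creates it, so the number of crossings modulo 2 depends only on the permutation.\<close>

lemma weighted_sign_word: "weighted_sign sz (word_perm ws) = (- 1) ^ crossing_weight sz ws"
proof (induction ws)
  case Nil
  have "invs id = {}" by (auto simp: invs_def)
  then show ?case by (simp add: weighted_sign_def del: id_apply)
next
  case (Cons i ws)
  then show ?case
    by (simp add: weighted_sign_adj bij_word_perm finite_invs_word_perm power_add del: o_apply)
qed

lemma crossing_weight_append:
  "crossing_weight sz (u @ v) = crossing_weight (sz \<circ> inv (word_perm v)) u + crossing_weight sz v"
proof (induction u)
  case (Cons i u)
  have "inv (word_perm (u @ v)) = inv (word_perm v) \<circ> inv (word_perm u)"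
    by (simp add: word_perm_append o_inv_distrib bij_word_perm)
  with Cons show ?case by simp
qed simp

lemma weighted_sign_comp:
  assumes "s permutes {..<N}" "w permutes {..<N}"
  shows "weighted_sign sz (s \<circ> w) = weighted_sign (sz \<circ> inv w) s * weighted_sign sz w"
proof -
  obtain u v where uv: "word_perm u = s" "word_perm v = w"
    using reduced_word_exists assms by blast
  have "weighted_sign sz (s \<circ> w) = weighted_sign sz (word_perm (u @ v))"
    by (simp add: word_perm_append uv)
  also have "\<dots> = weighted_sign (sz \<circ> inv (word_perm v)) (word_perm u) * weighted_sign sz (word_perm v)"
    by (simp only: weighted_sign_word crossing_weight_append power_add)
  finally show ?thesis by (simp only: uv)
qed

text \<open>For a below b the inversions are (a, b) and, for every z in between, (a, z) and (z, b).
  The last two have equal weight and cancel modulo 2, and the square of \<open>sz a\<close> has the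
  parity of \<open>sz a\<close>.\<close>

lemma weighted_sign_transpose:
  assumes "a \<noteq> b" "sz a = sz b"
  shows "weighted_sign sz (transpose a b) = (- 1) ^ sz a"
proof -
  have *: "weighted_sign sz (transpose a b) = (- 1) ^ sz a" if "a < b" "sz a = sz b" for a b
  proof -
    let ?A = "Pair a ` {a<..<b}" and ?B = "(\<lambda>z. (z, b)) ` {a<..<b}"
    have inv_eq: "invs (transpose a b) = insert (a, b) (?A \<union> ?B)"
      using that(1) by (auto simp: invs_def transpose_def image_iff split: if_splits)
    have "(\<Sum>(x, y)\<in>?A. sz x * sz y) = (\<Sum>z\<in>{a<..<b}. sz a * sz z)"
      by (subst sum.reindex) (auto simp: inj_on_def)
    moreover have "(\<Sum>(x, y)\<in>?B. sz x * sz y) = (\<Sum>z\<in>{a<..<b}. sz a * sz z)"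
      by (subst sum.reindex) (auto simp: inj_on_def that(2) mult.commute)
    moreover have "(\<Sum>(x, y)\<in>?A \<union> ?B. sz x * sz y) =
        (\<Sum>(x, y)\<in>?A. sz x * sz y) + (\<Sum>(x, y)\<in>?B. sz x * sz y)"
      by (rule sum.union_disjoint) auto
    ultimately have "(\<Sum>(x, y)\<in>invs (transpose a b). sz x * sz y) =
        sz a * sz a + 2 * (\<Sum>z\<in>{a<..<b}. sz a * sz z)"
      unfolding inv_eq by (subst sum.insert) (auto simp: that(2))
    then show ?thesis
      by (simp add: weighted_sign_def power_add power_mult) (cases "even (sz a)"; simp)
  qed
  show ?thesis
  proof (cases "a < b")
    case True
    then show ?thesis using * assms by blast
  next
    case False
    then have "weighted_sign sz (transpose b a) = (- 1) ^ sz b"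
      using * assms by simp
    then show ?thesis by (simp only: transpose_commute[of b a] assms(2))
  qed
qed

text \<open>Composing with the transposition of a and \<open>p a\<close> cuts a out of its cycle:
  \<open>p'\<close> runs through the same cycle but jumps over a.\<close>

lemma funpow_skip_iff:
  assumes p: "p permutes S" and a: "a \<in> S" "p a \<noteq> a" and ij: "i \<in> S - {a}" "j \<in> S - {a}"
  defines "p' \<equiv> transpose a (p a) \<circ> p"
  shows "(\<exists>k. (p' ^^ k) i = j) \<longleftrightarrow> (\<exists>k. (p ^^ k) i = j)"
proof
  have p'_cases: "p' x = (if p x = a then p a else p x)" if "x \<noteq> a" for x
    using that permutes_inj[OF p] by (auto simp: p'_def transpose_def inj_eq)
  have p'_mem: "p' x \<in> S - {a}" if "x \<in> S - {a}" for x
    using that p a p'_cases[of x] by (auto simp: permutes_in_image)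
  show "\<exists>k. (p ^^ k) i = j" if ex: "\<exists>k. (p' ^^ k) i = j"
  proof -
    have "(p' ^^ k) i \<in> S - {a} \<and> (\<exists>l. (p' ^^ k) i = (p ^^ l) i)" for k
    proof (induction k)
      case 0
      show ?case using ij by (auto intro: exI[of _ 0])
    next
      case (Suc k)
      then obtain l where l: "(p' ^^ k) i = (p ^^ l) i" "(p' ^^ k) i \<in> S - {a}" by blast
      then have "p' ((p' ^^ k) i) = (p ^^ Suc l) i \<or> p' ((p' ^^ k) i) = (p ^^ Suc (Suc l)) i"
        using p'_cases[of "(p' ^^ k) i"] by (auto split: if_splits)
      moreover have "(p' ^^ Suc k) i = p' ((p' ^^ k) i)" by simp
      ultimately show ?case using p'_mem[OF l(2)] by metis
    qed
    with ex show ?thesis by metis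
  qed
  show "\<exists>k. (p' ^^ k) i = j" if ex: "\<exists>k. (p ^^ k) i = j"
  proof -
    obtain k where "(p ^^ k) i = j" using ex by blast
    then show ?thesis using ij(1)
    proof (induction k arbitrary: i rule: less_induct)
      case (less k)
      show ?case
      proof (cases k)
        case 0
        with less show ?thesis by (auto intro: exI[of _ 0])
      next
        case k: (Suc k')
        have step: ?thesis if "\<exists>l. (p' ^^ l) (p' i) = j"
          using that by (metis funpow_simps_right(2) o_apply)
        show ?thesis
        proof (cases "p i = a")
          case False
          then have "(p ^^ k') (p' i) = j"
            using less.prems k p'_cases[of i] by (simp add: funpow_swap1)
          then show ?thesis
            using less.IH[of k' "p' i"] p'_mem[OF less.prems(2)] k by (intro step) auto
        next
          case True
          then have j: "(p ^^ k') a = j" using less.prems k by (simp add: funpow_swap1)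
          then obtain k'' where k'': "k' = Suc k''" using ij(2) by (cases k') auto
          have "(p ^^ k'') (p' i) = j"
            using j k'' True p'_cases[of i] less.prems by (simp add: funpow_swap1)
          then show ?thesis
            using less.IH[of k'' "p' i"] p'_mem[OF less.prems(2)] k k'' by (intro step) auto
        qed
      qed
    qed
  qed
qed

text \<open>Block version of the rule that the sign times (-1) to the number of points is (-1) to
  the number of cycles. The induction removes a point a. A fixed point is an orbit of its own; any
  other point is cut out of its cycle by a transposition, whose weighted sign (-1)^(sz a) makes up
  for the loss of \<open>sz a\<close> points.\<close>

lemma weighted_sign_orbits:
  assumes "finite S" "S \<subseteq> {..<N}" "p permutes S"
    and "\<And>i j. i \<in> S \<Longrightarrow> j \<in> S \<Longrightarrow> c i = c j \<longleftrightarrow> (\<exists>k. (p ^^ k) i = j)"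
    and "\<And>i. i \<in> S \<Longrightarrow> sz i = f (c i)"
  shows "weighted_sign sz p * (- 1) ^ (\<Sum>i\<in>S. sz i) = (- 1) ^ (\<Sum>d\<in>c ` S. f d)"
  using assms
proof (induction "card S" arbitrary: S p)
  case 0
  then have "S = {}" "p = id" by auto
  moreover have "invs id = {}" by (auto simp: invs_def)
  ultimately show ?case by (simp add: weighted_sign_def del: id_apply)
next
  case (Suc n)
  note p = Suc.prems(3) and orb = Suc.prems(4) and szf = Suc.prems(5) and fin = Suc.prems(1)
  from Suc.hyps(2) obtain a where a: "a \<in> S" by fastforce
  let ?T = "S - {a}"
  have T: "n = card ?T" "finite ?T" "?T \<subseteq> {..<N}" using Suc.hyps(2) Suc.prems(1,2) a by auto
  have sumS: "(\<Sum>i\<in>S. sz i) = sz a + (\<Sum>i\<in>?T. sz i)" by (rule sum.remove[OF fin a])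
  show ?case
  proof (cases "p a = a")
    case True
    have pT: "p permutes ?T" by (rule permutes_superset[OF p]) (use True in auto)
    have IH: "weighted_sign sz p * (- 1) ^ (\<Sum>i\<in>?T. sz i) = (- 1) ^ (\<Sum>d\<in>c ` ?T. f d)"
      by (rule Suc.hyps(1)[OF T(1,2,3) pT]) (rule orb szf; simp)+
    have "(p ^^ k) a = a" for k using True by (induction k) auto
    then have "c a \<notin> c ` ?T" using orb[OF a] by auto
    moreover have "c ` S = insert (c a) (c ` ?T)" using a by blast
    ultimately have "(\<Sum>d\<in>c ` S. f d) = sz a + (\<Sum>d\<in>c ` ?T. f d)"
      using T(2) szf[OF a] by simp
    with IH sumS show ?thesis by (simp add: power_add mult.left_commute)
  next
    case False
    define b where "b = p a"
    define p' where "p' = transpose a b \<circ> p"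
    have b: "b \<in> ?T" using False a p by (auto simp: b_def permutes_in_image)
    have ab: "transpose a b permutes S" using a b by (intro permutes_swap_id) auto
    have p'S: "p' permutes S" unfolding p'_def by (rule permutes_compose[OF p ab])
    have p'a: "p' a = a" by (simp add: p'_def b_def)
    have p'T: "p' permutes ?T" by (rule permutes_superset[OF p'S]) (use p'a in auto)
    have orb': "c i = c j \<longleftrightarrow> (\<exists>k. (p' ^^ k) i = j)" if "i \<in> ?T" "j \<in> ?T" for i j
      using funpow_skip_iff[OF p a False that] orb[of i j] that unfolding p'_def b_def by blast
    have IH: "weighted_sign sz p' * (- 1) ^ (\<Sum>i\<in>?T. sz i) = (- 1) ^ (\<Sum>d\<in>c ` ?T. f d)"
      by (rule Suc.hyps(1)[OF T(1,2,3) p'T orb']) (assumption | rule szf, simp)+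
    have cab: "c a = c b" using orb[OF a, of b] b by (auto simp: b_def intro: exI[of _ 1])
    have "c ` S = insert (c a) (c ` ?T)" using a by blast
    also have "\<dots> = c ` ?T" unfolding cab using b by (intro insert_absorb imageI)
    finally have cS: "c ` S = c ` ?T" .
    have szab: "sz a = sz b" using szf a b cab by simp
    \<comment> \<open>The transposition is composed after \<open>p'\<close>, so its weights are read
      at the preimages of a and b; these are a itself and a point in the orbit of b.\<close>
    have "inv p' a = a" using p'a permutes_inj[OF p'T] by (metis inv_f_f)
    moreover have "sz (inv p' b) = sz b"
    proof -
      have mem: "inv p' b \<in> ?T" using b permutes_in_image[OF permutes_inv[OF p'T], of b] by simp
      have "p' (inv p' b) = b" using permutes_inverses(1)[OF p'T] .
      then have "c (inv p' b) = c b" using orb'[OF mem b] by (auto intro: exI[of _ 1])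
      then show ?thesis using szf mem b by simp
    qed
    ultimately have "weighted_sign (sz \<circ> inv p') (transpose a b) = (- 1) ^ sz a"
      using weighted_sign_transpose[of a b "sz \<circ> inv p'"] b szab by simp
    moreover have "transpose a b \<circ> p' = p" by (simp add: p'_def fun_eq_iff)
    moreover have "transpose a b permutes {..<N}" "p' permutes {..<N}"
      using ab p'T Suc.prems(2) T(3) by (auto intro: permutes_subset)
    ultimately have wp: "weighted_sign sz p = (- 1) ^ sz a * weighted_sign sz p'"
      using weighted_sign_comp[of "transpose a b" N p' sz] by simp
    have sq: "(- 1) ^ k * x * ((- 1) ^ k * y) = x * (y :: int)" for k x y
    proof -
      have "(- 1) ^ k * x * ((- 1) ^ k * y) = ((- 1) ^ k * (- 1) ^ k) * (x * y)" by (simp only: ac_simps)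
      then show ?thesis by (simp flip: power_mult_distrib)
    qed
    show ?thesis by (simp only: sumS cS power_add wp sq IH)
  qed
qed

section \<open>The transposition symmetry\<close>

lemma length_cable_positive: "length (cable_positive p m n) = m * n"
  by (induction m) (simp_all add: cable_positive_0 cable_positive_Suc)

lemma length_cable: "length (cable sz b) = crossing_weight sz (map fst b)"
proof (induction b)
  case (Cons g b)
  then show ?case
    by (cases g) (simp add: cable_crossing_def Let_def length_cable_positive braid_inverse_simps
        braid_perm_def mult.commute)
qed simp

lemma cable_crossing_cong:
  assumes "Suc i < N" "\<And>j. j < N \<Longrightarrow> sz j = sz' j"
  shows "cable_crossing sz (i, s) = cable_crossing sz' (i, s)"
proof -
  have "(\<Sum>j<i. sz j) = (\<Sum>j<i. sz' j)" using assms by (intro sum.cong) auto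
  moreover have "sz i = sz' i" "sz (Suc i) = sz' (Suc i)" using assms by auto
  ultimately show ?thesis by (simp only: cable_crossing_def prod.case Let_def)
qed

lemma cable_cong:
  assumes "is_braid N b" "\<And>j. j < N \<Longrightarrow> sz j = sz' j"
  shows "cable sz b = cable sz' b"
  using assms(1)
proof (induction b)
  case (Cons g b)
  obtain i s where g: "g = (i, s)" by (cases g)
  then have b: "Suc i < N" "is_braid N b" using Cons.prems by (simp_all add: is_braid_simps)
  have "cable_crossing (sz \<circ> inv (braid_perm b)) g = cable_crossing (sz' \<circ> inv (braid_perm b)) g"
    unfolding g by (rule cable_crossing_cong[OF b(1)]) (simp add: assms(2) inv_braid_perm_less[OF b(2)])
  with Cons.IH[OF b(2)] show ?case by (simp del: o_apply)
qed simp

text \<open>Stated as an equality of parities because the sign is computed in the integers and used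
  in \<open>caq\<close>.\<close>

lemma weighted_sign_components:
  assumes L: "is_framed_link L"
  shows "even (length (cable (f \<circ> component L) (diagram L)) + (\<Sum>j<strands L. f (component L j))) =
    even (\<Sum>d<num_components L. f d)"
proof -
  let ?p = "braid_perm (diagram L)"
  from L have b: "is_braid (strands L) (diagram L)"
    and comp: "component L ` {..<strands L} = {..<num_components L}"
    and orb: "\<And>i j. i < strands L \<Longrightarrow> j < strands L \<Longrightarrow>
      component L i = component L j \<longleftrightarrow> (\<exists>k. (?p ^^ k) i = j)"
    unfolding is_framed_link_def by blast+
  have "weighted_sign (f \<circ> component L) ?p * (- 1) ^ (\<Sum>i<strands L. (f \<circ> component L) i) =
      (- 1) ^ (\<Sum>d\<in>component L ` {..<strands L}. f d)"
    by (rule weighted_sign_orbits[OF _ subset_refl braid_perm_permutes[OF b]]) (simp_all add: orb)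
  then have "(- 1 :: int) ^ (length (cable (f \<circ> component L) (diagram L)) + (\<Sum>j<strands L. f (component L j))) =
      (- 1) ^ (\<Sum>d<num_components L. f d)"
    by (simp add: comp braid_perm_def weighted_sign_word length_cable power_add)
  then show ?thesis by (auto simp: minus_one_power_iff split: if_splits)
qed

section \<open>Cyclic steps on all cables of a link\<close>

lemma trace_cables_step:
  assumes L: "is_framed_link L"
    and young: "\<And>d. d < num_components L \<Longrightarrow> young_diagram (lam d)"
    and step: "\<And>D. young_diagram D \<Longrightarrow> cyclic_step (card D) (e D) (f D)"
  defines "D \<equiv> \<lambda>j. lam (component L j)"
  defines "sz \<equiv> \<lambda>j. card (D j)"
  shows "jones_ocneanu_trace (\<Sum>j<strands L. sz j)
      (braid_hecke (cable sz (diagram L)) * cables (strands L) sz (\<lambda>j. e (D j))) =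
    jones_ocneanu_trace (\<Sum>j<strands L. sz j)
      (braid_hecke (cable sz (diagram L)) * cables (strands L) sz (\<lambda>j. f (D j)))"
proof -
  let ?N = "strands L" and ?p = "braid_perm (diagram L)"
  from L have b: "is_braid ?N (diagram L)"
    and comp: "component L ` {..<?N} = {..<num_components L}"
    and orb: "\<And>i j. i < ?N \<Longrightarrow> j < ?N \<Longrightarrow> component L i = component L j \<longleftrightarrow> (\<exists>k. (?p ^^ k) i = j)"
    unfolding is_framed_link_def by blast+
  \<comment> \<open>The factors are chosen for each diagram, not for each strand, so that they agree
    along a component.\<close>
  have "\<forall>D. \<exists>x y. young_diagram D \<longrightarrow>
      x \<in> hecke_alg (card D) \<and> y \<in> hecke_alg (card D) \<and> e D = x * y \<and> f D = y * x"
    using step unfolding cyclic_step_def by blast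
  then obtain x y where xy: "\<And>D. young_diagram D \<Longrightarrow>
      x D \<in> hecke_alg (card D) \<and> y D \<in> hecke_alg (card D) \<and> e D = x D * y D \<and> f D = y D * x D"
    by metis
  have D: "young_diagram (D j)" if "j < ?N" for j
    unfolding D_def using comp that by (intro young) blast
  have inv: "D (inv ?p j) = D j" if "j < ?N" for j
  proof -
    have "?p (inv ?p j) = j" using permutes_inverses(1)[OF braid_perm_permutes[OF b]] .
    then have "component L (inv ?p j) = component L j"
      using orb[OF inv_braid_perm_less[OF b that] that] by (auto intro: exI[of _ 1])
    then show ?thesis by (simp add: D_def)
  qed
  have "cables ?N sz (\<lambda>j. e (D j)) = cables ?N sz (\<lambda>j. x (D j) * y (D j))"
    "cables ?N sz (\<lambda>j. f (D j)) = cables ?N sz (\<lambda>j. y (D j) * x (D j))"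
    using xy D by (auto intro!: cables_cong)
  moreover have "jones_ocneanu_trace (\<Sum>j<?N. sz j)
      (braid_hecke (cable sz (diagram L)) * cables ?N sz (\<lambda>j. x (D j) * y (D j))) =
    jones_ocneanu_trace (\<Sum>j<?N. sz j)
      (braid_hecke (cable sz (diagram L)) * cables ?N sz (\<lambda>j. y (D j) * x (D j)))"
    by (rule trace_cables_cyclic[OF b]) (use xy D in \<open>auto simp: sz_def inv\<close>)
  ultimately show ?thesis by simp
qed

theorem proposition4p4:
  fixes L :: framed_link and lam :: "diagram list"
  assumes "is_framed_link L"
    and "length lam = num_components L"
    and "\<forall>D\<in>set lam. young_diagram D"
  shows "colored_homflypt L lam =
    (- 1) ^ (\<Sum>D\<leftarrow>lam. card D) *
    subst_q_inverse (colored_homflypt L (map diagram_transpose lam))"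
proof -
  let ?N = "strands L" and ?b = "diagram L"
  from assms(1) have b: "is_braid ?N ?b" and comp: "component L ` {..<?N} = {..<num_components L}"
    unfolding is_framed_link_def by blast+
  define f where "f = (\<lambda>d. card (lam ! d))"
  define D where "D = (\<lambda>j. lam ! component L j)"
  define sz where "sz = (\<lambda>j. card (D j))"
  define K where "K = (\<Sum>j<?N. sz j)"
  define z where "z = braid_hecke (cable sz ?b)"
  define e' where "e' = (\<lambda>D. hphi (e_idem (diagram_transpose D)))"
  have young: "young_diagram (lam ! d)" if "d < num_components L" for d
    using assms(2,3) that by simp
  have comp_less: "component L j < length lam" if "j < ?N" for j
    using comp that assms(2) by auto
  have D: "young_diagram (D j)" if "j < ?N" for j
    unfolding D_def using comp_less[OF that] assms(2) by (intro young) simp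
  have homfly: "colored_homflypt L lam = jones_ocneanu_trace K (z * cables ?N sz (\<lambda>j. e_idem (D j)))"
    by (simp add: colored_homflypt_def Let_def cables_def K_def z_def sz_def D_def)
  have "\<forall>D. \<exists>g g'. young_diagram D \<longrightarrow> cyclic_step (card D) (e_idem D) g \<and>
      cyclic_step (card D) (e' D) g' \<and> cyclic_step (card D) g' g"
    unfolding e'_def using e_idem_cyclic by metis
  then obtain g g' where steps: "\<And>D. young_diagram D \<Longrightarrow> cyclic_step (card D) (e_idem D) (g D)"
      "\<And>D. young_diagram D \<Longrightarrow> cyclic_step (card D) (e' D) (g' D)"
      "\<And>D. young_diagram D \<Longrightarrow> cyclic_step (card D) (g' D) (g D)"
    by metis
  have tr: "jones_ocneanu_trace K (z * cables ?N sz (\<lambda>j. e (D j))) =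
      jones_ocneanu_trace K (z * cables ?N sz (\<lambda>j. h (D j)))"
    if "\<And>D. young_diagram D \<Longrightarrow> cyclic_step (card D) (e D) (h D)" for e h
    unfolding K_def z_def sz_def D_def by (rule trace_cables_step[OF assms(1) young that])
  \<comment> \<open>Both chains of cyclic steps end at \<open>g\<close>.\<close>
  have equiv: "colored_homflypt L lam = jones_ocneanu_trace K (z * cables ?N sz (\<lambda>j. e' (D j)))"
    unfolding homfly by (simp only: tr[OF steps(1)] tr[OF steps(2)] tr[OF steps(3)])
  define D' where "D' = (\<lambda>j. map diagram_transpose lam ! component L j)"
  have D': "D' j = diagram_transpose (D j)" if "j < ?N" for j
    using comp_less[OF that] by (simp add: D'_def D_def)
  then have sz': "card (D' j) = sz j" if "j < ?N" for j
    using that by (simp add: sz_def card_transpose)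
  let ?X = "z * cables ?N sz (\<lambda>j. e_idem (diagram_transpose (D j)))"
  have "colored_homflypt L (map diagram_transpose lam) =
      jones_ocneanu_trace (\<Sum>j<?N. card (D' j))
        (braid_hecke (cable (\<lambda>j. card (D' j)) ?b) * cables ?N (\<lambda>j. card (D' j)) (\<lambda>j. e_idem (D' j)))"
    by (simp add: colored_homflypt_def Let_def cables_def D'_def)
  \<comment> \<open>Transposition preserves the number of nodes, hence the widths of the cables and
    the cabled braid. As \<open>D' j\<close> is the transpose of \<open>D j\<close> only for valid
    positions j, the congruence lemmas are used.\<close>
  also have "(\<Sum>j<?N. card (D' j)) = K"
    unfolding K_def by (rule sum.cong) (simp_all add: sz')
  also have "cable (\<lambda>j. card (D' j)) ?b = cable sz ?b"
    by (rule cable_cong[OF b]) (rule sz')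
  also have "cables ?N (\<lambda>j. card (D' j)) (\<lambda>j. e_idem (D' j)) =
      cables ?N sz (\<lambda>j. e_idem (diagram_transpose (D j)))"
    by (rule cables_cong) (simp_all add: sz_def D' card_transpose)
  finally have T: "colored_homflypt L (map diagram_transpose lam) = jones_ocneanu_trace K ?X"
    by (simp only: z_def)
  have z: "z \<in> hecke_alg K"
    unfolding z_def K_def by (intro braid_hecke_alg is_braid_cable b)
  have E: "cables ?N sz (\<lambda>j. e_idem (diagram_transpose (D j))) \<in> hecke_alg K"
    unfolding K_def sz_def
    using e_idem_hecke_alg[OF young_transpose[OF D]] by (intro cables_hecke_alg) (simp add: card_transpose)
  have sign: "(- 1) ^ K * ((- 1) ^ K * x) = (x :: caq)" for x
    by (simp flip: mult.assoc power_mult_distrib)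
  have "subst_q_inverse (jones_ocneanu_trace K ?X) = (- 1) ^ K * jones_ocneanu_trace K (hphi ?X)"
    by (simp only: hphi_trace[OF hecke_alg.mult[OF z E]] sign)
  also have "hphi ?X = (- 1) ^ length (cable sz ?b) *\<^sub>H (z * cables ?N sz (\<lambda>j. e' (D j)))"
    by (simp add: z_def e'_def hphi_simps hphi_braid_hecke hphi_cables hscale_simps)
  also have "jones_ocneanu_trace K \<dots> =
      (- 1) ^ length (cable sz ?b) * jones_ocneanu_trace K (z * cables ?N sz (\<lambda>j. e' (D j)))"
  proof (rule trace_hscale)
    have "hphi (cables ?N sz (\<lambda>j. e_idem (diagram_transpose (D j)))) \<in> hecke_alg K"
      using E by (rule hecke_alg_hphi)
    with z show "z * cables ?N sz (\<lambda>j. e' (D j)) \<in> hecke_alg K"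
      by (simp add: hphi_cables e'_def hecke_alg.mult)
  qed
  finally have main: "subst_q_inverse (colored_homflypt L (map diagram_transpose lam)) =
      (- 1) ^ (length (cable sz ?b) + K) * colored_homflypt L lam"
    by (simp add: T equiv power_add)
  have "sz = f \<circ> component L" by (simp add: fun_eq_iff sz_def D_def f_def)
  then have "even (length (cable sz ?b) + K) = even (\<Sum>d<num_components L. f d)"
    using weighted_sign_components[OF assms(1), of f] by (simp add: K_def)
  also have "(\<Sum>d<num_components L. f d) = (\<Sum>D\<leftarrow>lam. card D)"
    by (simp add: f_def sum_list_sum_nth assms(2) atLeast0LessThan)
  finally have "(- 1 :: caq) ^ (length (cable sz ?b) + K) = (- 1) ^ (\<Sum>D\<leftarrow>lam. card D)"
    by (simp only: minus_one_power_iff)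
  moreover have "(- 1) ^ n * ((- 1) ^ n * x) = (x :: caq)" for n x
    by (simp flip: mult.assoc power_mult_distrib)
  ultimately show ?thesis by (simp only: main)
qed

end
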